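(* Let $n\ge2$ and let $(X,w)$ be a Euclidean $4$-design in $\mathbb R^n$ supported by two concentric spheres, $X=X_1\cup X_2$ with $X_i\subset S^{n-1}(r_i)$, such that $0\notin X$, $w$ is constant on each $X_i$, $s_{\lambda,\mu}\le 2$ for all $\lambda,\mu\in\{1,2\}$, and $N_2\ge N_1\ge n+2$ where $N_i=|X_i|$. Write $A(X_1,X_1)=\{\alpha_1,\alpha_2\}$ with $\alpha_1>\alpha_2$, $A(X_2,X_2)=\{\beta_1,\beta_2\}$ with $\beta_1>\beta_2$, and $A(X_1,X_2)=\{\gamma_1,\gamma_2\}$ with $\gamma_1>\gamma_2$. Then: (1)(a) $\gamma_1\gamma_2=-\frac1n$; (b) $(N_1-1)\alpha_1+1\ne0$ and $\alpha_2=-\frac{n\alpha_1-n+N_1}{n((N_1-1)\alpha_1+1)}$; (c) $(N_2-1)\beta_1+1\ne0$ and $\beta_2=-\frac{n\beta_1-n+N_2}{n((N_2-1)\beta_1+1)}$; (d) for every $\boldsymbol x\in X_1$, the number of $\boldsymbol z\in X_2$ with $\frac{\boldsymbol x\cdot\boldsymbol z}{r_1r_2}=\gamma_1$ equals $\frac{N_2}{1+n\gamma_1^2}$; (e) for every $\boldsymbol y\in X_2$, the number of $\boldsymbol z\in X_1$ with $\frac{\boldsymbol z\cdot\boldsymbol y}{r_1r_2}=\gamma_1$ equals $\frac{N_1}{1+n\gamma_1^2}$. (2) If $\gamma_1=\frac1{\sqrt n}$, then $(X,w)$ is similar to one of the following Euclidean $4$-designs $(X',w')$ with $X'=X'_1\cup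 X'_2$, $X'_1\subset S^{n-1}(r_1)$, $X'_2\subset S^{n-1}(r_2)$: (i) $n=2$, $X'_1=\{\pm(\frac1{\sqrt2},\frac1{\sqrt2}),\pm(\frac1{\sqrt2},-\frac1{\sqrt2})\}$, $X'_2=\{(\pm r_2,0),(0,\pm r_2)\}$, $w'=1$ on $X'_1$ and $w'=r_2^{-4}$ on $X'_2$, for some $r_2>0$, $r_2\ne1$; (ii) $n=(2k-1)^2-4$ for an integer $k\ge2$, $|X'_1|=2(2k+1)(k-1)^3$, $|X'_2|=2k^3(2k-3)$, $A(X'_1,X'_1)=\{\frac{k-2}{k(2k-3)},-\frac1{2k-3}\}$, $A(X'_2,X'_2)=\{\frac1{2k+1},-\frac{k+1}{(k-1)(2k+1)}\}$, $A(X'_1,X'_2)=\{\pm\frac1{\sqrt n}\}$, $r_1=1$, $w'=1$ on $X'_1$ and $w'=\frac{(2k+1)^2(k-1)^4}{(2k-3)^2k^4}r_2^{-4}$ on $X'_2$, for some $r_2>0$, $r_2\ne1$. (3) If $\gamma_1\ne\frac1{\sqrt n}$, then $(X,w)$ is a tight Euclidean $4$-design.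
   Context: A weighted finite set $(X,w)$: finite $X\subset\mathbb R^n$, $w:X\to\mathbb R_{>0}$; supported by two concentric spheres: $X=X_1\cup X_2$ disjoint nonempty, $X_i\subset S_i=S^{n-1}(r_i)$ (sphere of radius $r_i\ge0$ centred at the origin, $r_1\ne r_2$). It is a Euclidean $t$-design if $\sum_i\frac{w(X_i)}{|S_i|}\int_{S_i}f\,d\sigma_i=\sum_{\boldsymbol u\in X}w(\boldsymbol u)f(\boldsymbol u)$ for all polynomials $f$ of degree $\le t$ ($\sigma_i$ surface measure, $|S_i|=\sigma_i(S_i)$, $w(X_i)=\sum_{X_i}w$). $A(X_\lambda,X_\mu)=\{\frac{\boldsymbol x\cdot\boldsymbol y}{r_\lambda r_\mu}:\boldsymbol x\in X_\lambda,\boldsymbol y\in X_\mu,\boldsymbol x\ne\boldsymbol y\}$, $s_{\lambda,\mu}=|A(X_\lambda,X_\mu)|$. Under the stated hypotheses each of $A(X_1,X_1)$, $A(X_2,X_2)$, $A(X_1,X_2)$ has exactly two elements (this is the setting in which the notation $\alpha_i,\beta_i,\gamma_i$ is introduced). A tight Euclidean $4$-design is one with $|X|=\dim\mathcal P_2(S)=\binom{n+2}{2}$, $S=S_1\cup S_2$, $\mathcal P_2(S)$ = restrictions to $S$ of polynomials of degree $\le2$. $(X,w)$ and $(X',w')$ are similar if there are a similarity $\rho$ of $\mathbb R^n$ fixing the origin and $\mu>0$ with $X'=\rho^{-1}(X)$, $w'(\boldsymbol x')=\mu w(\rho(\boldsymbol x'))$. *)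

theory Defs
  imports "HOL-Analysis.Analysis" "HOL-Library.Function_Algebras"
begin

text \<open>
  Points of \<open>n\<close>-dimensional Euclidean space are vectors of type \<^typ>\<open>real ^ 'n\<close>, with
  \<open>n = CARD('n)\<close>.  A polynomial of degree at most \<open>t\<close> is given by its coefficients on the
  monomials with multi-exponent \<open>a\<close>, \<open>|a| \<le> t\<close>; this set of exponents is finite.
\<close>

definition polynomial_of_degree_le :: "nat \<Rightarrow> (real ^ 'n \<Rightarrow> real) \<Rightarrow> bool" where
  "polynomial_of_degree_le t f \<longleftrightarrow>
     (\<exists>c :: ('n \<Rightarrow> nat) \<Rightarrow> real. \<forall>x.
        f x = (\<Sum>a\<in>{a. (\<Sum>i\<in>UNIV. a i) \<le> t}. c a * (\<Prod>i\<in>UNIV. (x $ i) ^ a i)))"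

text \<open>
  For \<open>r > 0\<close> the surface measure of a Borel set \<open>E\<close> on the sphere of radius \<open>r\<close> is \<open>n / r\<close>
  times the Lebesgue measure of the cone \<open>{s x | x \<in> E, 0 < s \<le> 1}\<close>, i.e. the preimage of
  \<open>E\<close> under the radial projection of the punctured ball; in particular the whole sphere gets
  \<open>n r^(n-1)\<close> times the volume of the unit ball.
\<close>

definition sphere_measure :: "real \<Rightarrow> (real ^ 'n) measure" where
  "sphere_measure r =
     scale_measure (ennreal (real CARD('n) / r))
       (distr (restrict_space lborel (cball 0 r - {0})) (restrict_space borel (sphere 0 r))
         (\<lambda>x. (r / norm x) *\<^sub>R x))"

text \<open>
  The average of \<open>f\<close> over the sphere.  For \<open>r = 0\<close> the sphere is the single point \<open>0\<close>, and the
  average is the value there.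
\<close>

definition sphere_average :: "real \<Rightarrow> (real ^ 'n \<Rightarrow> real) \<Rightarrow> real" where
  "sphere_average r f =
     (if r = 0 then f 0
      else (\<integral>x. f x \<partial>sphere_measure r) / measure (sphere_measure r :: (real ^ 'n) measure) (sphere 0 r))"

text \<open>Weights are total functions; only their values on the finite set matter.\<close>

definition supported_by_two_spheres ::
  "real \<Rightarrow> real \<Rightarrow> (real ^ 'n) set \<Rightarrow> (real ^ 'n) set \<Rightarrow> (real ^ 'n \<Rightarrow> real) \<Rightarrow> bool" where
  "supported_by_two_spheres r1 r2 X1 X2 w \<longleftrightarrow>
     0 \<le> r1 \<and> 0 \<le> r2 \<and> r1 \<noteq> r2 \<and>
     finite (X1 \<union> X2) \<and> X1 \<inter> X2 = {} \<and> X1 \<noteq> {} \<and> X2 \<noteq> {} \<and>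
     X1 \<subseteq> sphere 0 r1 \<and> X2 \<subseteq> sphere 0 r2 \<and>
     (\<forall>x\<in>X1 \<union> X2. 0 < w x)"

definition euclidean_design ::
  "nat \<Rightarrow> real \<Rightarrow> real \<Rightarrow> (real ^ 'n) set \<Rightarrow> (real ^ 'n) set \<Rightarrow> (real ^ 'n \<Rightarrow> real) \<Rightarrow> bool" where
  "euclidean_design t r1 r2 X1 X2 w \<longleftrightarrow>
     supported_by_two_spheres r1 r2 X1 X2 w \<and>
     (\<forall>f. polynomial_of_degree_le t f \<longrightarrow>
        (\<Sum>x\<in>X1. w x) * sphere_average r1 f + (\<Sum>x\<in>X2. w x) * sphere_average r2 f
          = (\<Sum>u\<in>X1 \<union> X2. w u * f u))"

text \<open>\<open>angle_set r s X Y\<close> is \<open>A(X, Y)\<close> for \<open>X\<close>, \<open>Y\<close> on the spheres of radii \<open>r\<close>, \<open>s\<close>.\<close>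

definition angle_set :: "real \<Rightarrow> real \<Rightarrow> (real ^ 'n) set \<Rightarrow> (real ^ 'n) set \<Rightarrow> real set" where
  "angle_set r s X Y = {(x \<bullet> y) / (r * s) | x y. x \<in> X \<and> y \<in> Y \<and> x \<noteq> y}"

interpretation fun_space: vector_space "\<lambda>(c :: real) (f :: real ^ 'n \<Rightarrow> real) x. c * f x"
  by unfold_locales (auto simp: fun_eq_iff algebra_simps)

text \<open>The restriction of \<open>f\<close> to \<open>S\<close> is represented by its extension by zero.\<close>

definition polynomials_on :: "nat \<Rightarrow> (real ^ 'n) set \<Rightarrow> (real ^ 'n \<Rightarrow> real) set" where
  "polynomials_on t S = {\<lambda>x. if x \<in> S then f x else 0 | f. polynomial_of_degree_le t f}"

definition tight_euclidean_4_design ::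
  "real \<Rightarrow> real \<Rightarrow> (real ^ 'n) set \<Rightarrow> (real ^ 'n) set \<Rightarrow> (real ^ 'n \<Rightarrow> real) \<Rightarrow> bool" where
  "tight_euclidean_4_design r1 r2 X1 X2 w \<longleftrightarrow>
     euclidean_design 4 r1 r2 X1 X2 w \<and>
     card (X1 \<union> X2)
       = fun_space.dim (polynomials_on 2 (sphere 0 r1 \<union> sphere 0 r2 :: (real ^ 'n) set)) \<and>
     card (X1 \<union> X2) = (CARD('n) + 2) choose 2"

definition similarity :: "(real ^ 'n \<Rightarrow> real ^ 'n) \<Rightarrow> bool" where
  "similarity \<rho> \<longleftrightarrow> bij \<rho> \<and> (\<exists>c>0. \<forall>x y. dist (\<rho> x) (\<rho> y) = c * dist x y)"

definition similar ::
  "(real ^ 'n) set \<Rightarrow> (real ^ 'n \<Rightarrow> real) \<Rightarrow> (real ^ 'n) set \<Rightarrow> (real ^ 'n \<Rightarrow> real) \<Rightarrow> bool" where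
  "similar X w X' w' \<longleftrightarrow>
     (\<exists>\<rho> \<mu>. similarity \<rho> \<and> \<rho> 0 = 0 \<and> 0 < \<mu> \<and>
        X' = \<rho> -` X \<and> (\<forall>x'\<in>X'. w' x' = \<mu> * w (\<rho> x')))"

text \<open>
  In dimension two, with \<open>i \<noteq> j\<close> naming the two coordinates, this is the point \<open>(a, b)\<close>.
\<close>

definition plane_point :: "'n \<Rightarrow> 'n \<Rightarrow> real \<Rightarrow> real \<Rightarrow> real ^ 'n" where
  "plane_point i j a b = a *\<^sub>R axis i 1 + b *\<^sub>R axis j 1"

text \<open>
  The two families of exceptional designs.  In both the first sphere is the unit sphere and
  \<open>r2\<close> is a free parameter.
\<close>

definition square_design ::
  "real \<Rightarrow> (real ^ 'n) set \<Rightarrow> (real ^ 'n) set \<Rightarrow> (real ^ 'n \<Rightarrow> real) \<Rightarrow> bool" where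
  "square_design r2 X1 X2 w \<longleftrightarrow>
     CARD('n) = 2 \<and> 0 < r2 \<and> r2 \<noteq> 1 \<and> euclidean_design 4 1 r2 X1 X2 w \<and>
     (\<exists>i j. i \<noteq> j \<and>
        X1 = {plane_point i j (1 / sqrt 2) (1 / sqrt 2), - plane_point i j (1 / sqrt 2) (1 / sqrt 2),
              plane_point i j (1 / sqrt 2) (- (1 / sqrt 2)), - plane_point i j (1 / sqrt 2) (- (1 / sqrt 2))} \<and>
        X2 = {plane_point i j r2 0, plane_point i j (- r2) 0,
              plane_point i j 0 r2, plane_point i j 0 (- r2)}) \<and>
     (\<forall>x\<in>X1. w x = 1) \<and> (\<forall>x\<in>X2. w x = 1 / r2 ^ 4)"

definition exceptional_design ::
  "int \<Rightarrow> real \<Rightarrow> (real ^ 'n) set \<Rightarrow> (real ^ 'n) set \<Rightarrow> (real ^ 'n \<Rightarrow> real) \<Rightarrow> bool" where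
  "exceptional_design k r2 X1 X2 w \<longleftrightarrow>
     2 \<le> k \<and> int CARD('n) = (2 * k - 1)\<^sup>2 - 4 \<and> 0 < r2 \<and> r2 \<noteq> 1 \<and>
     euclidean_design 4 1 r2 X1 X2 w \<and>
     int (card X1) = 2 * (2 * k + 1) * (k - 1) ^ 3 \<and>
     int (card X2) = 2 * k ^ 3 * (2 * k - 3) \<and>
     (let \<kappa> = real_of_int k; n = real CARD('n) in
        angle_set 1 1 X1 X1 = {(\<kappa> - 2) / (\<kappa> * (2 * \<kappa> - 3)), - (1 / (2 * \<kappa> - 3))} \<and>
        angle_set r2 r2 X2 X2 = {1 / (2 * \<kappa> + 1), - ((\<kappa> + 1) / ((\<kappa> - 1) * (2 * \<kappa> + 1)))} \<and>
        angle_set 1 r2 X1 X2 = {1 / sqrt n, - (1 / sqrt n)} \<and>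
        (\<forall>x\<in>X1. w x = 1) \<and>
        (\<forall>x\<in>X2. w x = ((2 * \<kappa> + 1)\<^sup>2 * (\<kappa> - 1) ^ 4) / ((2 * \<kappa> - 3)\<^sup>2 * \<kappa> ^ 4) * (1 / r2 ^ 4)))"

end

theory Submission
  imports Defs "HOL-Computational_Algebra.Polynomial"
begin

text \<open>
  Testing the design condition on \<open>f\<close> and on \<open>|x|\<^sup>2 f\<close> separates the two spheres in degree at most two, so
  after normalization both \<open>X1\<close> and \<open>X2\<close> are spherical 2-designs; this gives the relations between the
  inner products and the intersection numbers. On each pair of classes the square of an inner
  product is an affine function of it (plus a multiple of the identity). Inserting this into the
  degree 4 condition for \<open>(x \<bullet> z)\<^sup>2 (y \<bullet> z)\<^sup>2\<close> with \<open>x\<close>, \<open>y\<close> in the design and comparing coefficients gives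
  linear relations whose combination is a trace identity for \<open>|X1| + |X2|\<close>. If
  \<open>\<gamma>1 + \<gamma>2 \<noteq> 0\<close>, it says that the design is tight. If \<open>\<gamma>1 + \<gamma>2 = 0\<close>, the degree 3 condition shows
  that all parameters depend on \<open>n\<close> and \<open>|X2|\<close> only; the strongly regular graph on \<open>X2\<close> has rational, hence
  integral, eigenvalues, which produces an odd integer \<open>r\<close> with \<open>n + 3 < r\<^sup>2 \<le> n + 4 + 4 / (n - 1)\<close>,
  and therefore \<open>r\<^sup>2 = n + 4\<close>.
\<close>

section \<open>Polynomials of bounded degree\<close>

text \<open>Degree 4 leaves room for \<open>|x|\<^sup>2 f\<close> only when \<open>f\<close> is at
  most quadratic. In degrees 3 and 4 the spheres stay coupled, with coefficients
  \<open>w1 * r1 ^ 3\<close>, \<open>w2 * r2 ^ 3\<close> and \<open>w1 * r1 ^ 4\<close>,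
  \<open>w2 * r2 ^ 4\<close>. A two-valued inner product is a root of a quadratic, and Gram matrices
  of 2-designs multiply by a fixed rule, so the degree 4 condition never leaves the span of inner
  product, constant and identity. Pairs inside a class give \<open>a1 * g = a2 * h = 2 * C\<close>,
  which eliminates the weights. For pairs across the classes the slope carries the factor
  \<open>s = \<gamma>1 + \<gamma>2\<close>. This factor causes the dichotomy: for
  \<open>s = 0\<close> the slope relation is empty and degree 3 has to replace it. Seen from a point
  of one class, the cubes over the other class are then multiples of inner products with sum zero,
  so each class satisfies a cubic equation of its own. The odd integer is
  \<open>(2 - \<beta>1 - \<beta>2) / (\<beta>1 - \<beta>2)\<close>. Dimension 2 is treated apart
  because its bounds admit the genuine exception \<open>r = 3\<close>,
  \<open>r\<^sup>2 = n + 7\<close>, the square.\<close>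

lemma finite_exponents: "finite {a :: 'n::finite \<Rightarrow> nat. (\<Sum>i\<in>UNIV. a i) \<le> t}"
proof (rule finite_subset)
  show "{a :: 'n \<Rightarrow> nat. (\<Sum>i\<in>UNIV. a i) \<le> t} \<subseteq> PiE UNIV (\<lambda>_. {..t})"
  proof
    fix a :: "'n \<Rightarrow> nat" assume a: "a \<in> {a. (\<Sum>i\<in>UNIV. a i) \<le> t}"
    have "a i \<le> t" for i
      using member_le_sum[of i UNIV a] a by simp
    then show "a \<in> PiE UNIV (\<lambda>_. {..t})" by (simp add: PiE_def)
  qed
qed (simp add: finite_PiE)

lemma polynomial_monomial:
  fixes a :: "'n::finite \<Rightarrow> nat"
  assumes "(\<Sum>i\<in>UNIV. a i) \<le> t"
  shows "polynomial_of_degree_le t (\<lambda>x :: real^'n. \<Prod>i\<in>UNIV. (x $ i) ^ a i)"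
  unfolding polynomial_of_degree_le_def
proof (intro exI allI)
  fix x :: "real^'n"
  show "(\<Prod>i\<in>UNIV. (x $ i) ^ a i) = (\<Sum>b | (\<Sum>i\<in>UNIV. b i) \<le> t. (if b = a then 1 else 0) * (\<Prod>i\<in>UNIV. (x $ i) ^ b i))"
    using assms by (simp add: finite_exponents if_distrib[of "\<lambda>k. k * _"] sum.delta cong: if_cong)
qed

lemma polynomial_scale:
  assumes "polynomial_of_degree_le t f"
  shows "polynomial_of_degree_le t (\<lambda>x. k * f x)"
proof -
  obtain c where "\<And>x. f x = (\<Sum>a | (\<Sum>i\<in>UNIV. a i) \<le> t. c a * (\<Prod>i\<in>UNIV. (x $ i) ^ a i))"
    using assms unfolding polynomial_of_degree_le_def by blast
  then show ?thesis
    unfolding polynomial_of_degree_le_def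
    by (intro exI[of _ "\<lambda>a. k * c a"]) (simp add: sum_distrib_left mult.assoc)
qed

lemma polynomial_const: "polynomial_of_degree_le t (\<lambda>x :: real^'n. c)"
  using polynomial_scale[OF polynomial_monomial[of "\<lambda>_. 0" t], of c] by simp

lemma polynomial_add:
  assumes "polynomial_of_degree_le t f" "polynomial_of_degree_le t g"
  shows "polynomial_of_degree_le t (\<lambda>x. f x + g x)"
proof -
  obtain c d where "\<And>x. f x = (\<Sum>a | (\<Sum>i\<in>UNIV. a i) \<le> t. c a * (\<Prod>i\<in>UNIV. (x $ i) ^ a i))"
    "\<And>x. g x = (\<Sum>a | (\<Sum>i\<in>UNIV. a i) \<le> t. d a * (\<Prod>i\<in>UNIV. (x $ i) ^ a i))"
    using assms unfolding polynomial_of_degree_le_def by blast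
  then show ?thesis
    unfolding polynomial_of_degree_le_def
    by (intro exI[of _ "\<lambda>a. c a + d a"]) (simp add: sum.distrib distrib_right)
qed

lemma polynomial_sum:
  assumes "\<And>j. j \<in> J \<Longrightarrow> polynomial_of_degree_le t (f j)"
  shows "polynomial_of_degree_le t (\<lambda>x :: real^'n. \<Sum>j\<in>J. f j x)"
  using assms
  by (induction J rule: infinite_finite_induct) (simp_all add: polynomial_add polynomial_const)

lemma polynomial_mult:
  fixes f g :: "real^'n \<Rightarrow> real"
  assumes "polynomial_of_degree_le s f" "polynomial_of_degree_le t g"
  shows "polynomial_of_degree_le (s + t) (\<lambda>x. f x * g x)"
proof -
  obtain c d where f: "\<And>x. f x = (\<Sum>a | (\<Sum>i\<in>UNIV. a i) \<le> s. c a * (\<Prod>i\<in>UNIV. (x $ i) ^ a i))"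
    and g: "\<And>x. g x = (\<Sum>a | (\<Sum>i\<in>UNIV. a i) \<le> t. d a * (\<Prod>i\<in>UNIV. (x $ i) ^ a i))"
    using assms unfolding polynomial_of_degree_le_def by blast
  have "f x * g x = (\<Sum>a | (\<Sum>i\<in>UNIV. a i) \<le> s. \<Sum>b | (\<Sum>i\<in>UNIV. b i) \<le> t.
     c a * d b * (\<Prod>i\<in>UNIV. (x $ i) ^ (a i + b i)))" for x
    unfolding f g sum_product by (intro sum.cong) (simp_all add: power_add prod.distrib)
  moreover have "polynomial_of_degree_le (s + t) (\<lambda>x :: real^'n. \<Sum>a | (\<Sum>i\<in>UNIV. a i) \<le> s. \<Sum>b | (\<Sum>i\<in>UNIV. b i) \<le> t.
     c a * d b * (\<Prod>i\<in>UNIV. (x $ i) ^ (a i + b i)))"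
    by (intro polynomial_sum polynomial_scale polynomial_monomial) (simp add: sum.distrib add_mono)
  ultimately show ?thesis by simp
qed

lemma polynomial_mono:
  fixes f :: "real^'n \<Rightarrow> real"
  assumes "polynomial_of_degree_le s f" "s \<le> t"
  shows "polynomial_of_degree_le t f"
  \<comment> \<open>The constant 1 counts as a polynomial of degree at most
    \<open>t - s\<close>.\<close>
  using polynomial_mult[OF assms(1) polynomial_const[of "t - s" 1]] assms(2) by simp

lemma polynomial_power:
  fixes f :: "real^'n \<Rightarrow> real"
  assumes "polynomial_of_degree_le t f"
  shows "polynomial_of_degree_le (k * t) (\<lambda>x. f x ^ k)"
proof (induction k)
  case (Suc k)
  then show ?case using polynomial_mult[OF assms Suc] by simp
qed (simp add: polynomial_const)

lemma polynomial_prod: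
  fixes f :: "'j \<Rightarrow> real^'n \<Rightarrow> real"
  assumes "\<And>j. j \<in> J \<Longrightarrow> polynomial_of_degree_le (t j) (f j)"
  shows "polynomial_of_degree_le (\<Sum>j\<in>J. t j) (\<lambda>x. \<Prod>j\<in>J. f j x)"
  using assms
  by (induction J rule: infinite_finite_induct) (simp_all add: polynomial_mult polynomial_const)

lemma polynomial_component: "polynomial_of_degree_le 1 (\<lambda>x :: real^'n. x $ j)"
proof -
  have "(\<Prod>i\<in>UNIV. (x $ i) ^ (if i = j then 1 else 0)) = x $ j" for x :: "real^'n"
    by (simp add: if_distrib[of "\<lambda>k. _ ^ k"] prod.delta cong: if_cong)
  then show ?thesis
    using polynomial_monomial[of "\<lambda>i. if i = j then 1 else 0" 1] by (simp add: sum.delta)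
qed

lemma polynomial_inner: "polynomial_of_degree_le 1 (\<lambda>x :: real^'n. v \<bullet> x)"
  unfolding inner_vec_def inner_real_def
  by (intro polynomial_sum polynomial_scale polynomial_component)

lemma polynomial_comp_linear:
  fixes f :: "real^'n \<Rightarrow> real" and \<rho> :: "real^'n \<Rightarrow> real^'n"
  assumes "polynomial_of_degree_le t f" "linear \<rho>"
  shows "polynomial_of_degree_le t (\<lambda>x. f (\<rho> x))"
proof -
  have comp: "polynomial_of_degree_le 1 (\<lambda>x. \<rho> x $ i)" for i
    using polynomial_inner[of "adjoint \<rho> (axis i 1)"] assms(2)
    by (simp add: adjoint_clauses inner_axis inner_commute[of "axis i 1"] inner_axis')
  obtain c where f: "\<And>x. f x = (\<Sum>a | (\<Sum>i\<in>UNIV. a i) \<le> t. c a * (\<Prod>i\<in>UNIV. (x $ i) ^ a i))"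
    using assms unfolding polynomial_of_degree_le_def by blast
  show ?thesis unfolding f
  proof (intro polynomial_sum polynomial_scale)
    fix a :: "'n \<Rightarrow> nat" assume "a \<in> {a. (\<Sum>i\<in>UNIV. a i) \<le> t}"
    \<comment> \<open>The factor 1 is the degree of a component, in the shape in which
      \<open>polynomial_power\<close> states its bound.\<close>
    then have a: "(\<Sum>i\<in>UNIV. a i * 1) \<le> t" by simp
    show "polynomial_of_degree_le t (\<lambda>x. \<Prod>i\<in>UNIV. (\<rho> x $ i) ^ a i)"
      by (rule polynomial_mono[OF polynomial_prod a]) (rule polynomial_power[OF comp])
  qed
qed

lemma continuous_polynomial:
  "polynomial_of_degree_le t f \<Longrightarrow> continuous_on UNIV (f :: real^'n \<Rightarrow> real)"
proof -
  assume "polynomial_of_degree_le t f"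
  then obtain c where f: "f = (\<lambda>x. \<Sum>a | (\<Sum>i\<in>UNIV. a i) \<le> t. c a * (\<Prod>i\<in>UNIV. (x $ i) ^ a i))"
    unfolding polynomial_of_degree_le_def fun_eq_iff by blast
  show ?thesis unfolding f by (intro continuous_intros)
qed

section \<open>Averages over spheres\<close>

lemma nn_integral_lborel_translate:
  fixes f :: "'a::euclidean_space \<Rightarrow> ennreal"
  assumes "f \<in> borel_measurable borel"
  shows "(\<integral>\<^sup>+x. f (x + c) \<partial>lborel) = (\<integral>\<^sup>+x. f x \<partial>lborel)"
  using assms by (subst (2) lborel_distr_plus[of c, symmetric]) (simp add: nn_integral_distr add.commute)

lemma nn_integral_lborel_reflect:
  fixes f :: "'a::euclidean_space \<Rightarrow> ennreal"
  assumes [measurable]: "f \<in> borel_measurable borel"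
  shows "(\<integral>\<^sup>+x. f (c - x) \<partial>lborel) = (\<integral>\<^sup>+x. f x \<partial>lborel)"
proof -
  have "(\<integral>\<^sup>+x. f x \<partial>lborel) = (\<integral>\<^sup>+x. f (- x) \<partial>lborel)"
    using nn_integral_distr[of "uminus :: 'a \<Rightarrow> 'a" lborel borel f] lborel_affine[of "- 1" "0 :: 'a"]
    by (simp add: density_1)
  also have "\<dots> = (\<integral>\<^sup>+x. f (- (x + (- c))) \<partial>lborel)"
    by (rule nn_integral_lborel_translate[symmetric]) measurable
  finally show ?thesis by simp
qed

text \<open>
  The uniqueness argument for Haar measure: both sides are translation invariant and agree on the unit ball.
\<close>

lemma lborel_distr_orthogonal:
  fixes Q :: "'a::euclidean_space \<Rightarrow> 'a"
  assumes "orthogonal_transformation Q"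
  shows "distr lborel borel Q = lborel"
proof (rule measure_eqI)
  fix A assume "A \<in> sets (distr lborel borel Q)"
  then have A [measurable]: "A \<in> sets borel" by simp
  have lin: "linear Q" and nrm: "\<And>x. norm (Q x) = norm x" and "bij Q"
    using assms by (auto simp: orthogonal_transformation orthogonal_transformation_bij)
  have Q [measurable]: "Q \<in> borel_measurable borel"
    using lin by (intro borel_measurable_continuous_onI linear_continuous_on) (simp add: linear_conv_bounded_linear)
  \<comment> \<open>\<open>B\<close> is a set of finite positive volume that \<open>Q\<close> fixes.
    Translating \<open>y\<close> by \<open>Q x\<close>, exchanging the integrals and translating
    \<open>x\<close> by the preimage of \<open>y\<close> turns the integrand into
    \<open>indicator A (Q x - y) * indicator B (Q x)\<close>; the integral over \<open>y\<close> is
    then the volume of a reflected translate of \<open>A\<close>.\<close>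
  define B where "B = cball (0::'a) 1"
  have [measurable]: "B \<in> sets borel" unfolding B_def by simp
  have BQ: "indicator B (Q x) = (indicator B x :: ennreal)" for x
    by (simp add: B_def indicator_def nrm)
  have "(\<integral>\<^sup>+x. indicator A (Q x) \<partial>lborel) * emeasure lborel B
      = (\<integral>\<^sup>+x. (\<integral>\<^sup>+y. indicator A (Q x) * indicator B y \<partial>lborel) \<partial>lborel)"
    by (simp add: nn_integral_cmult nn_integral_multc)
  also have "\<dots> = (\<integral>\<^sup>+x. (\<integral>\<^sup>+y. indicator A (Q x) * indicator B (y + Q x) \<partial>lborel) \<partial>lborel)"
    by (intro nn_integral_cong nn_integral_lborel_translate[symmetric]) measurable
  also have "\<dots> = (\<integral>\<^sup>+y. (\<integral>\<^sup>+x. indicator A (Q x) * indicator B (y + Q x) \<partial>lborel) \<partial>lborel)"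
    by (rule lborel_pair.Fubini') measurable
  also have "\<dots> = (\<integral>\<^sup>+y. (\<integral>\<^sup>+x. indicator A (Q x - y) * indicator B (Q x) \<partial>lborel) \<partial>lborel)"
  proof (rule nn_integral_cong)
    fix y :: 'a
    obtain z where z: "y = Q z" using \<open>bij Q\<close> by (meson bij_pointE)
    have "(\<integral>\<^sup>+x. indicator A (Q x - y) * indicator B (Q x) \<partial>lborel)
       = (\<integral>\<^sup>+x. indicator A (Q (x + z) - y) * indicator B (Q (x + z)) \<partial>lborel)"
      by (rule nn_integral_lborel_translate[symmetric]) measurable
    then show "(\<integral>\<^sup>+x. indicator A (Q x) * indicator B (y + Q x) \<partial>lborel)
       = (\<integral>\<^sup>+x. indicator A (Q x - y) * indicator B (Q x) \<partial>lborel)"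
      by (simp add: linear_add[OF lin] z add.commute)
  qed
  also have "\<dots> = (\<integral>\<^sup>+x. (\<integral>\<^sup>+y. indicator A (Q x - y) * indicator B (Q x) \<partial>lborel) \<partial>lborel)"
    by (rule lborel_pair.Fubini') measurable
  also have "\<dots> = (\<integral>\<^sup>+x. emeasure lborel A * indicator B x \<partial>lborel)"
    by (simp add: nn_integral_multc nn_integral_lborel_reflect[of "indicator A"] BQ)
  also have "\<dots> = emeasure lborel A * emeasure lborel B"
    by (simp add: nn_integral_cmult)
  finally have "(\<integral>\<^sup>+x. indicator A (Q x) \<partial>lborel) * emeasure lborel B = emeasure lborel A * emeasure lborel B" .
  moreover have "emeasure lborel B \<noteq> 0" "emeasure lborel B \<noteq> top"
    using emeasure_lborel_cball_finite[of "0::'a" 1] content_cball_pos[of 1 "0::'a"]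
    by (auto simp: B_def measure_def)
  moreover have "(\<integral>\<^sup>+x. indicator A (Q x) \<partial>lborel) = emeasure (distr lborel borel Q) A"
    by (simp add: nn_integral_distr[symmetric] flip: nn_integral_indicator)
  ultimately show "emeasure (distr lborel borel Q) A = emeasure lborel A"
    by (metis ennreal_divide_times ennreal_times_divide ennreal_mult_divide_eq mult.commute)
qed simp

text \<open>The factor \<open>n / r\<close> of \<open>sphere_measure\<close> and the Jacobian
  \<open>r ^ n\<close> of rescaling the ball occur in numerator and denominator and cancel.
  Integrating over the unit ball for every \<open>r\<close> confines the radius to the argument of
  \<open>f\<close>.\<close>

lemma sphere_average_eq:
  fixes f :: "real^'n \<Rightarrow> real"
  assumes r: "r > 0" and [measurable]: "f \<in> borel_measurable borel"
  shows "sphere_average r f = (\<integral>x. indicator (cball 0 1 - {0}) x * f ((r / norm x) *\<^sub>R x) \<partial>lborel)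
     / measure lborel (cball 0 1 :: (real^'n) set)"
proof -
  define D where "D = cball 0 r - {0 :: real^'n}"
  define M where "M = restrict_space lborel D"
  define R where "R = (\<lambda>x::real^'n. (r / norm x) *\<^sub>R x)"
  define c where "c = real CARD('n) / r"
  have c: "c > 0" using r by (simp add: c_def)
  have [measurable]: "D \<in> sets borel" unfolding D_def by measurable
  have Rm [measurable]: "R \<in> borel_measurable borel" unfolding R_def by measurable
  have RM: "R \<in> measurable M (restrict_space borel (sphere 0 r))"
    unfolding M_def
    by (rule measurable_restrict_space3) (use r in \<open>auto simp: R_def D_def\<close>)
  have fS: "f \<in> borel_measurable (restrict_space borel (sphere 0 r))"
    by (rule measurable_restrict_space1) measurable
  define N where "N = distr M (restrict_space borel (sphere 0 r)) R"
  have S: "sphere_measure r = scale_measure (ennreal c) N"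
    by (simp add: sphere_measure_def N_def M_def R_def D_def c_def)
  have "scale_measure (ennreal c) N = density N (\<lambda>_. ennreal c)"
    by (intro measure_eqI) (auto simp: emeasure_density nn_integral_cmult)
  then have "integral\<^sup>L (sphere_measure r) f = c * integral\<^sup>L N f"
    unfolding S using c fS by (simp add: integral_density N_def)
  also have "integral\<^sup>L N f = (\<integral>x. f (R x) \<partial>M)"
    unfolding N_def by (rule integral_distr[OF RM fS])
  also have "\<dots> = (\<integral>x. indicator D x * f (R x) \<partial>lborel)"
    unfolding M_def by (subst integral_restrict_space) auto
  finally have I: "integral\<^sup>L (sphere_measure r) f = c * (\<integral>x. indicator D x * f (R x) \<partial>lborel)" .
  have scl: "(\<integral>x. g x \<partial>lborel) = r ^ CARD('n) * (\<integral>x. g (r *\<^sub>R x) \<partial>lborel)"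
    if [measurable]: "g \<in> borel_measurable borel" for g :: "real^'n \<Rightarrow> real"
    using r by (subst lborel_affine[of r 0]) (simp_all add: integral_density integral_distr)
  have ID: "(indicator D (r *\<^sub>R x) :: real) = indicator (cball 0 1 - {0}) x" for x
    using r by (auto simp: D_def indicator_def)
  have "(\<integral>x. indicator D x * f (R x) \<partial>lborel)
    = r ^ CARD('n) * (\<integral>x. indicator D (r *\<^sub>R x) * f (R (r *\<^sub>R x)) \<partial>lborel)"
    by (rule scl) measurable
  also have "(\<lambda>x. indicator D (r *\<^sub>R x) * f (R (r *\<^sub>R x))) =
     (\<lambda>x. indicator (cball 0 1 - {0}) x * f ((r / norm x) *\<^sub>R x))"
    using r by (simp add: ID R_def)
  finally have J: "(\<integral>x. indicator D x * f (R x) \<partial>lborel) = r ^ CARD('n) *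
     (\<integral>x. indicator (cball 0 1 - {0}) x * f ((r / norm x) *\<^sub>R x) \<partial>lborel)" .
  have [measurable]: "cball (0 :: real^'n) r \<in> sets borel" by simp
  have "measure N (sphere 0 r) = measure lborel D"
    unfolding N_def using RM
    by (subst measure_distr)
       (auto simp: M_def space_restrict_space measure_restrict_space sets_restrict_space
         intro!: arg_cong[where f = "measure lborel"] dest: measurable_space)
  also have "\<dots> = measure lborel (cball (0 :: real^'n) r)"
    unfolding D_def by (rule measure_Diff_null_set) auto
  also have "\<dots> = (\<integral>x. indicator (cball (0 :: real^'n) r) x \<partial>lborel)" by simp
  also have "\<dots> = r ^ CARD('n) * (\<integral>x. indicator (cball (0 :: real^'n) r) (r *\<^sub>R x) \<partial>lborel)"
    by (rule scl) measurable
  also have "(\<lambda>x. indicator (cball (0 :: real^'n) r) (r *\<^sub>R x) :: real) = indicator (cball 0 1)"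
    using r by (auto simp: indicator_def fun_eq_iff)
  finally have V: "measure (sphere_measure r) (sphere (0 :: real^'n) r)
      = c * (r ^ CARD('n) * measure lborel (cball (0 :: real^'n) 1))"
    using c by (simp add: S)
  show ?thesis
    unfolding sphere_average_def I J V using r c by simp
qed

lemma integrable_radial:
  fixes f :: "real^'n \<Rightarrow> real"
  assumes "continuous_on UNIV f"
  shows "integrable lborel (\<lambda>x. indicator (cball 0 1 - {0}) x * f ((r / norm x) *\<^sub>R x))"
proof -
  have [measurable]: "f \<in> borel_measurable borel"
    using assms by (rule borel_measurable_continuous_onI)
  have R: "(\<lambda>x :: real^'n. (r / norm x) *\<^sub>R x) \<in> borel_measurable borel"
    and D [measurable]: "cball 0 1 - {0} \<in> sets (borel :: (real^'n) measure)"
    by measurable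
  have [measurable]: "(\<lambda>x. f ((r / norm x) *\<^sub>R x)) \<in> borel_measurable borel"
    by (rule measurable_compose[OF R]) measurable
  have "bounded (f ` cball 0 \<bar>r\<bar>)"
    using assms by (intro compact_imp_bounded compact_continuous_image) (auto intro: continuous_on_subset)
  then obtain B where B: "\<And>x. x \<in> cball 0 \<bar>r\<bar> \<Longrightarrow> \<bar>f x\<bar> \<le> B"
    unfolding bounded_iff by fastforce
  have "set_integrable lborel (cball 0 1 - {0}) (\<lambda>x. f ((r / norm x) *\<^sub>R x))"
    unfolding set_integrable_def
  proof (rule Bochner_Integration.integrable_bound)
    show "integrable lborel (\<lambda>x. B * indicator (cball (0 :: real^'n) 1) x)"
      using emeasure_lborel_cball_finite[of "0 :: real^'n" 1]
      by (intro integrable_mult_right integrable_real_indicator) auto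
    show "AE x in lborel. norm (indicat_real (cball 0 1 - {0}) x *\<^sub>R f ((r / norm x) *\<^sub>R x))
       \<le> norm (B * indicator (cball (0 :: real^'n) 1) x)"
    proof (rule AE_I2)
      fix x :: "real^'n"
      have "(r / norm x) *\<^sub>R x \<in> cball 0 \<bar>r\<bar>" by simp
      then show "norm (indicat_real (cball 0 1 - {0}) x *\<^sub>R f ((r / norm x) *\<^sub>R x))
         \<le> norm (B * indicator (cball (0 :: real^'n) 1) x)"
        using B by (fastforce simp: indicator_def)
    qed
  qed measurable
  then show ?thesis by (simp add: set_integrable_def)
qed

lemma sphere_average_eq_continuous:
  fixes f :: "real^'n \<Rightarrow> real"
  assumes "r > 0" "continuous_on UNIV f"
  shows "sphere_average r f = (\<integral>x. indicator (cball 0 1 - {0}) x * f ((r / norm x) *\<^sub>R x) \<partial>lborel)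
     / measure lborel (cball 0 1 :: (real^'n) set)"
  using assms by (intro sphere_average_eq borel_measurable_continuous_onI)

lemma sphere_average_add:
  fixes f g :: "real^'n \<Rightarrow> real"
  assumes "r > 0" "continuous_on UNIV f" "continuous_on UNIV g"
  shows "sphere_average r (\<lambda>x. f x + g x) = sphere_average r f + sphere_average r g"
  using assms integrable_radial[of f r] integrable_radial[of g r]
  by (simp add: sphere_average_eq_continuous continuous_on_add distrib_left add_divide_distrib)

lemma sphere_average_scale:
  fixes f :: "real^'n \<Rightarrow> real"
  assumes "r > 0" "continuous_on UNIV f"
  shows "sphere_average r (\<lambda>x. c * f x) = c * sphere_average r f"
  using assms
  by (simp add: sphere_average_eq_continuous continuous_on_mult mult.left_commute[of _ c])

lemma sphere_average_cong:
  fixes f g :: "real^'n \<Rightarrow> real"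
  assumes "r > 0" "continuous_on UNIV f" "continuous_on UNIV g" "\<And>x. norm x = r \<Longrightarrow> f x = g x"
  shows "sphere_average r f = sphere_average r g"
proof -
  have "indicator (cball 0 1 - {0}) x * f ((r / norm x) *\<^sub>R x)
      = indicator (cball 0 1 - {0}) x * g ((r / norm x) *\<^sub>R x)" for x :: "real^'n"
    using assms(1,4) by (cases "x = 0") simp_all
  then show ?thesis using assms(1-3) by (simp only: sphere_average_eq_continuous)
qed

lemma sphere_average_const:
  assumes "r > 0"
  shows "sphere_average r (\<lambda>x :: real^'n. c) = c"
proof -
  have "measure lborel (cball (0 :: real^'n) 1 - {0}) = measure lborel (cball (0 :: real^'n) 1)"
    by (rule measure_Diff_null_set) auto
  moreover have "measure lborel (cball (0 :: real^'n) 1) > 0"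
    using content_cball_pos[of 1 "0 :: real^'n"] by simp
  ultimately show ?thesis
    using assms by (simp add: sphere_average_eq_continuous)
qed

lemma sphere_average_sum:
  fixes f :: "'j \<Rightarrow> real^'n \<Rightarrow> real"
  assumes "r > 0" "\<And>j. j \<in> J \<Longrightarrow> continuous_on UNIV (f j)"
  shows "sphere_average r (\<lambda>x. \<Sum>j\<in>J. f j x) = (\<Sum>j\<in>J. sphere_average r (f j))"
  using assms(2)
  by (induction J rule: infinite_finite_induct)
     (simp_all add: sphere_average_add[OF assms(1)] sphere_average_const[OF assms(1)] continuous_on_sum)

text \<open>\<open>Q\<close> preserves norms and commutes with radial projection, so the invariance
  of Lebesgue measure passes to the sphere.\<close>

lemma sphere_average_comp_orthogonal:
  fixes f :: "real^'n \<Rightarrow> real" and Q :: "real^'n \<Rightarrow> real^'n"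
  assumes "r > 0" "continuous_on UNIV f" "orthogonal_transformation Q"
  shows "sphere_average r (\<lambda>x. f (Q x)) = sphere_average r f"
proof -
  have lin: "linear Q" and nrm: "\<And>x. norm (Q x) = norm x"
    using assms(3) by (auto simp: orthogonal_transformation)
  have cQ: "continuous_on A Q" for A
    using lin by (intro linear_continuous_on) (simp add: linear_conv_bounded_linear)
  have cfQ: "continuous_on UNIV (\<lambda>x. f (Q x))"
    by (rule continuous_on_compose2[OF assms(2) cQ]) simp
  have R [measurable]: "(\<lambda>x :: real^'n. (r / norm x) *\<^sub>R x) \<in> borel_measurable borel"
    "cball 0 1 - {0} \<in> sets (borel :: (real^'n) measure)"
    by measurable
  have Qm [measurable]: "Q \<in> borel_measurable borel" and fm [measurable]: "f \<in> borel_measurable borel"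
    using cQ assms(2) by (simp_all add: borel_measurable_continuous_onI)
  define g where "g = (\<lambda>x. indicator (cball 0 1 - {0}) x * f ((r / norm x) *\<^sub>R x))"
  have [measurable]: "g \<in> borel_measurable borel"
    unfolding g_def using measurable_compose[OF R(1) fm] R(2) by measurable
  have "(\<integral>x. g x \<partial>lborel) = (\<integral>x. g x \<partial>distr lborel borel Q)"
    by (simp add: lborel_distr_orthogonal[OF assms(3)])
  also have "\<dots> = (\<integral>x. g (Q x) \<partial>lborel)" by (rule integral_distr) measurable
  also have "(\<lambda>x. g (Q x)) = (\<lambda>x. indicator (cball 0 1 - {0}) x * f (Q ((r / norm x) *\<^sub>R x)))"
  proof
    fix x
    have "Q x = 0 \<longleftrightarrow> x = 0" using nrm[of x] by (metis norm_eq_zero)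
    then show "g (Q x) = indicator (cball 0 1 - {0}) x * f (Q ((r / norm x) *\<^sub>R x))"
      by (simp add: g_def nrm linear_scale[OF lin] indicator_def)
  qed
  finally show ?thesis
    unfolding sphere_average_eq_continuous[OF assms(1,2)] sphere_average_eq_continuous[OF assms(1) cfQ] g_def
    by simp
qed

lemma sphere_average_comp_similarity:
  fixes f :: "real^'n \<Rightarrow> real" and \<rho> :: "real^'n \<Rightarrow> real^'n"
  assumes r: "r > 0" and f: "continuous_on UNIV f" and \<rho>: "linear \<rho>"
    and c: "c > 0" "\<And>x. norm (\<rho> x) = c * norm x"
  shows "sphere_average (r / c) (\<lambda>x. f (\<rho> x)) = sphere_average r f"
proof -
  define Q where "Q = (\<lambda>x. (1 / c) *\<^sub>R \<rho> x)"
  have Q: "orthogonal_transformation Q"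
    using \<rho> c unfolding Q_def orthogonal_transformation
    by (auto simp: linear_compose_scale_right)
  have \<rho>Q: "\<rho> x = Q (c *\<^sub>R x)" for x
    using c(1) by (simp add: Q_def linear_scale[OF \<rho>])
  have "continuous_on UNIV \<rho>"
    using \<rho> by (intro linear_continuous_on) (simp add: linear_conv_bounded_linear)
  then have c1: "continuous_on UNIV (\<lambda>x. f (\<rho> x))"
    by (intro continuous_on_compose2[OF f]) auto
  have "continuous_on UNIV Q"
    using orthogonal_transformation_linear[OF Q]
    by (intro linear_continuous_on) (simp add: linear_conv_bounded_linear)
  then have c2: "continuous_on UNIV (\<lambda>x. f (Q x))"
    by (intro continuous_on_compose2[OF f]) auto
  have "sphere_average (r / c) (\<lambda>x. f (\<rho> x)) = sphere_average r (\<lambda>x. f (Q x))"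
    using r c(1) c1 c2 by (simp add: sphere_average_eq_continuous \<rho>Q)
  also have "\<dots> = sphere_average r f"
    by (rule sphere_average_comp_orthogonal[OF r f Q])
  finally show ?thesis .
qed

text \<open>Everything follows from rotation invariance. Odd moments change sign under
  \<open>x \<mapsto> - x\<close>; the moments of \<open>u \<bullet> x\<close> depend on
  \<open>norm u\<close> only; summing over the coordinate axes fixes the constants; polarization
  yields the mixed moments.\<close>

lemma sphere_average_moments:
  fixes u v :: "real^'n"
  assumes r: "r > 0"
  shows "sphere_average r (\<lambda>x. u \<bullet> x) = 0"
    and "sphere_average r (\<lambda>x. (u \<bullet> x) ^ 3) = 0"
    and "sphere_average r (\<lambda>x. (u \<bullet> x) * (v \<bullet> x)) = r\<^sup>2 / real CARD('n) * (u \<bullet> v)"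
    and "sphere_average r (\<lambda>x. (u \<bullet> x)\<^sup>2 * (v \<bullet> x)\<^sup>2)
      = r ^ 4 / (real CARD('n) * (real CARD('n) + 2)) * ((norm u)\<^sup>2 * (norm v)\<^sup>2 + 2 * (u \<bullet> v)\<^sup>2)"
proof -
  define n where "n = real CARD('n)"
  have n: "n > 0" by (simp add: n_def)
  note ca = continuous_intros
  have neg: "orthogonal_transformation (\<lambda>x :: real^'n. - x)"
    by (simp add: orthogonal_transformation linear_iff)
  show "sphere_average r (\<lambda>x. u \<bullet> x) = 0"
    using sphere_average_comp_orthogonal[OF r _ neg, of "\<lambda>x. u \<bullet> x"]
      sphere_average_scale[OF r, of "\<lambda>x. u \<bullet> x" "- 1"]
    by (simp add: ca)
  show "sphere_average r (\<lambda>x. (u \<bullet> x) ^ 3) = 0"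
    using sphere_average_comp_orthogonal[OF r _ neg, of "\<lambda>x. (u \<bullet> x) ^ 3"]
      sphere_average_scale[OF r, of "\<lambda>x. (u \<bullet> x) ^ 3" "- 1"]
    by (simp add: ca)
  have inv: "sphere_average r (\<lambda>x. (u \<bullet> x) ^ k) = sphere_average r (\<lambda>x. (v \<bullet> x) ^ k)"
    if "norm u = norm v" for u v :: "real^'n" and k
  proof -
    obtain Q where Q: "orthogonal_transformation Q" "Q v = u"
      using orthogonal_transformation_exists[of v u] \<open>norm u = norm v\<close> by metis
    have "sphere_average r (\<lambda>x. (u \<bullet> x) ^ k) = sphere_average r (\<lambda>x. (u \<bullet> Q x) ^ k)"
      by (rule sphere_average_comp_orthogonal[OF r _ Q(1), symmetric]) (intro ca)
    also have "(\<lambda>x. (u \<bullet> Q x) ^ k) = (\<lambda>x. (v \<bullet> x) ^ k)"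
      using Q by (auto simp: orthogonal_transformation_def)
    finally show ?thesis .
  qed
  define e where "e = (axis undefined 1 :: real^'n)"
  have [simp]: "norm e = 1" by (simp add: e_def)
  define m where "m k = sphere_average r (\<lambda>x. (e \<bullet> x) ^ k)" for k
  have mom: "sphere_average r (\<lambda>x. (u \<bullet> x) ^ k) = norm u ^ k * m k" for u :: "real^'n" and k
  proof -
    have "sphere_average r (\<lambda>x. (u \<bullet> x) ^ k) = sphere_average r (\<lambda>x. ((norm u *\<^sub>R e) \<bullet> x) ^ k)"
      by (rule inv) simp
    also have "\<dots> = sphere_average r (\<lambda>x. norm u ^ k * (e \<bullet> x) ^ k)"
      by (simp add: power_mult_distrib)
    also have "\<dots> = norm u ^ k * m k"
      unfolding m_def by (rule sphere_average_scale[OF r]) (intro ca)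
    finally show ?thesis .
  qed
  have axes: "(\<Sum>i\<in>UNIV. (axis i 1 \<bullet> x)\<^sup>2) = (norm x)\<^sup>2" for x :: "real^'n"
    by (simp add: inner_axis' norm_vec_def L2_set_def sum_nonneg)
  have "n * m 2 = (\<Sum>i\<in>(UNIV :: 'n set). sphere_average r (\<lambda>x. (axis i 1 \<bullet> x)\<^sup>2))"
    by (simp add: mom n_def)
  also have "\<dots> = sphere_average r (\<lambda>x :: real^'n. \<Sum>i\<in>UNIV. (axis i 1 \<bullet> x)\<^sup>2)"
    by (rule sphere_average_sum[OF r, symmetric]) (intro ca)
  also have "\<dots> = sphere_average r (\<lambda>x :: real^'n. r\<^sup>2)"
    by (rule sphere_average_cong[OF r]) (auto simp: axes intro!: ca)
  also have "\<dots> = r\<^sup>2" by (rule sphere_average_const[OF r])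
  finally have m2: "m 2 = r\<^sup>2 / n" using n by (simp add: field_simps)
  have p2: "2 * sphere_average r (\<lambda>x. (u \<bullet> x) * (v \<bullet> x)) = 2 * (m 2 * (u \<bullet> v))"
  proof -
    have "sphere_average r (\<lambda>x. ((u + v) \<bullet> x)\<^sup>2)
       = sphere_average r (\<lambda>x. ((u \<bullet> x)\<^sup>2 + (v \<bullet> x)\<^sup>2) + 2 * ((u \<bullet> x) * (v \<bullet> x)))"
      by (simp add: inner_add_left power2_eq_square algebra_simps)
    also have "\<dots> = (sphere_average r (\<lambda>x. (u \<bullet> x)\<^sup>2) + sphere_average r (\<lambda>x. (v \<bullet> x)\<^sup>2))
        + 2 * sphere_average r (\<lambda>x. (u \<bullet> x) * (v \<bullet> x))"
      by (simp add: sphere_average_add[OF r] sphere_average_scale[OF r] ca)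
    finally show ?thesis
      unfolding mom by (simp add: power2_norm_eq_inner inner_add_left inner_add_right inner_commute algebra_simps)
  qed
  then show p2': "sphere_average r (\<lambda>x. (u \<bullet> x) * (v \<bullet> x)) = r\<^sup>2 / real CARD('n) * (u \<bullet> v)"
    by (simp add: m2 n_def)
  have p4: "3 * sphere_average r (\<lambda>x. (u \<bullet> x)\<^sup>2 * (v \<bullet> x)\<^sup>2)
     = m 4 * ((norm u)\<^sup>2 * (norm v)\<^sup>2 + 2 * (u \<bullet> v)\<^sup>2)" for u v :: "real^'n"
  proof -
    have q: "norm w ^ 4 = (w \<bullet> w)\<^sup>2" for w :: "real^'n"
      by (simp add: power2_norm_eq_inner[symmetric])
    have "sphere_average r (\<lambda>x. ((u + v) \<bullet> x) ^ 4) + sphere_average r (\<lambda>x. ((u - v) \<bullet> x) ^ 4)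
       = sphere_average r (\<lambda>x. ((u + v) \<bullet> x) ^ 4 + ((u - v) \<bullet> x) ^ 4)"
      by (rule sphere_average_add[OF r, symmetric]) (intro ca)+
    \<comment> \<open>Polarization: the terms of odd degree in \<open>v\<close> cancel, so the mixed
      second moment is expressed by pure fourth powers.\<close>
    also have "(\<lambda>x. ((u + v) \<bullet> x) ^ 4 + ((u - v) \<bullet> x) ^ 4)
        = (\<lambda>x. (2 * (u \<bullet> x) ^ 4 + 2 * (v \<bullet> x) ^ 4) + 12 * ((u \<bullet> x)\<^sup>2 * (v \<bullet> x)\<^sup>2))"
      unfolding inner_add_left inner_diff_left by (rule ext) algebra
    also have "sphere_average r \<dots> = (2 * sphere_average r (\<lambda>x. (u \<bullet> x) ^ 4) + 2 * sphere_average r (\<lambda>x. (v \<bullet> x) ^ 4))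
        + 12 * sphere_average r (\<lambda>x. (u \<bullet> x)\<^sup>2 * (v \<bullet> x)\<^sup>2)"
      by (simp add: sphere_average_add[OF r] sphere_average_scale[OF r] ca)
    finally have "((u + v) \<bullet> (u + v))\<^sup>2 * m 4 + ((u - v) \<bullet> (u - v))\<^sup>2 * m 4
       = 2 * ((u \<bullet> u)\<^sup>2 * m 4) + 2 * ((v \<bullet> v)\<^sup>2 * m 4) + 12 * sphere_average r (\<lambda>x. (u \<bullet> x)\<^sup>2 * (v \<bullet> x)\<^sup>2)"
      by (simp only: mom q)
    then show ?thesis
      unfolding power2_norm_eq_inner inner_add_left inner_add_right inner_diff_left inner_diff_right
        inner_commute[of v u]
      by algebra
  qed
  \<comment> \<open>Taking \<open>v\<close> through all axes in \<open>p4\<close> at the unit vector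
    \<open>e\<close>, the first summand adds up to \<open>n\<close> and the second to 2, while the
    squares inside the average add up to the constant \<open>r\<^sup>2\<close>. This reduces the
    fourth moment to the second.\<close>
  have "(n + 2) * m 4 = (\<Sum>i\<in>(UNIV :: 'n set). m 4 * ((norm e)\<^sup>2 * (norm (axis i 1 :: real^'n))\<^sup>2 + 2 * (e \<bullet> axis i 1)\<^sup>2))"
    using axes[of e] by (simp add: sum.distrib sum_distrib_left[symmetric] n_def inner_commute[of e] distrib_left) (simp add: algebra_simps)
  also have "\<dots> = 3 * (\<Sum>i\<in>(UNIV :: 'n set). sphere_average r (\<lambda>x. (e \<bullet> x)\<^sup>2 * (axis i 1 \<bullet> x)\<^sup>2))"
    by (simp only: p4[symmetric] sum_distrib_left)
  also have "\<dots> = 3 * sphere_average r (\<lambda>x. \<Sum>i\<in>UNIV. (e \<bullet> x)\<^sup>2 * (axis i 1 \<bullet> x)\<^sup>2)"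
    by (subst sphere_average_sum[OF r]) (auto intro!: ca)
  also have "\<dots> = 3 * sphere_average r (\<lambda>x. r\<^sup>2 * (e \<bullet> x)\<^sup>2)"
    by (subst sphere_average_cong[OF r, where g = "\<lambda>x. r\<^sup>2 * (e \<bullet> x)\<^sup>2"])
       (auto simp: sum_distrib_left[symmetric] axes intro!: ca)
  also have "\<dots> = 3 * (r\<^sup>2 * m 2)"
    unfolding m_def by (subst sphere_average_scale[OF r]) (auto intro!: ca)
  also have "\<dots> = 3 * r ^ 4 / n"
    unfolding m2 by (simp add: power4_eq_xxxx power2_eq_square)
  finally have "m 4 * (n * (n + 2)) = 3 * r ^ 4" using n by (simp add: field_simps)
  moreover have "n * (n + 2) \<noteq> 0" using n by simp
  ultimately have m4: "m 4 = 3 * r ^ 4 / (n * (n + 2))"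
    by (simp only: nonzero_eq_divide_eq not_False_eq_True)
  show "sphere_average r (\<lambda>x. (u \<bullet> x)\<^sup>2 * (v \<bullet> x)\<^sup>2)
      = r ^ 4 / (real CARD('n) * (real CARD('n) + 2)) * ((norm u)\<^sup>2 * (norm v)\<^sup>2 + 2 * (u \<bullet> v)\<^sup>2)"
    using p4[of u v] by (simp add: m4 n_def)
qed

section \<open>The dimension of the space of quadratic polynomials on two spheres\<close>

text \<open>The monomials are the squares of coordinates and the square-free ones, indexed by sets
  of at most two coordinates. This split serves both the count and the choice of dual functionals in
  \<open>quadratic_zero_on_two_spheres\<close>.\<close>

lemma exponents_le_2:
  "{a :: 'n::finite \<Rightarrow> nat. (\<Sum>i\<in>UNIV. a i) \<le> 2}
     = range (\<lambda>i k. if k = i then 2 else 0) \<union> (\<lambda>A k. of_bool (k \<in> A)) ` {A. card A \<le> 2}"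
  (is "?E = ?D \<union> ?I")
proof (intro equalityI subsetI)
  fix a :: "'n \<Rightarrow> nat" assume "a \<in> ?E"
  then have a: "(\<Sum>i\<in>UNIV. a i) \<le> 2" by simp
  show "a \<in> ?D \<union> ?I"
  proof (cases "\<exists>i. a i \<ge> 2")
    case True
    then obtain i where i: "a i \<ge> 2" by blast
    have s: "(\<Sum>k\<in>UNIV. a k) = a i + (\<Sum>k\<in>UNIV - {i}. a k)" by (simp add: sum.remove)
    then have "(\<Sum>k\<in>UNIV - {i}. a k) = 0" and ai: "a i = 2" using a i by linarith+
    then have "a k = 0" if "k \<noteq> i" for k using that by simp
    then have "a = (\<lambda>k. if k = i then 2 else 0)" using ai by auto
    then show ?thesis by blast
  next
    case False
    then have "a k = of_bool (k \<in> {k. a k = 1})" for k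
      using less_2_cases[of "a k"] by (auto simp: not_le)
    then have eq: "a = (\<lambda>k. of_bool (k \<in> {k. a k = 1}))" by blast
    have "card {k. a k = 1} = (\<Sum>k\<in>UNIV. of_bool (k \<in> {k. a k = 1}))" by (simp add: of_bool_def sum.If_cases)
    also have "\<dots> = (\<Sum>k\<in>UNIV. a k)" by (subst (2) eq) simp
    finally have "card {k. a k = 1} \<le> 2" using a by simp
    then show ?thesis using eq by blast
  qed
next
  fix a :: "'n \<Rightarrow> nat" assume "a \<in> ?D \<union> ?I"
  then show "a \<in> ?E" by (auto simp: of_bool_def sum.If_cases)
qed

lemma card_exponents_le_2:
  "card {a :: 'n::finite \<Rightarrow> nat. (\<Sum>i\<in>UNIV. a i) \<le> 2} = (CARD('n) + 2) choose 2"
proof -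
  let ?d = "\<lambda>i k :: 'n. if k = i then 2 else 0 :: nat" and ?c = "\<lambda>A (k :: 'n). of_bool (k \<in> A) :: nat"
  have "inj ?d" by (rule injI) (metis zero_neq_numeral)
  moreover have "inj ?c" by (rule injI) (auto simp: fun_eq_iff of_bool_def split: if_splits)
  moreover have "range ?d \<inter> ?c ` {A. card A \<le> 2} = {}"
    by (auto simp: fun_eq_iff of_bool_def split: if_splits)
  ultimately have 1: "card {a :: 'n \<Rightarrow> nat. (\<Sum>i\<in>UNIV. a i) \<le> 2} = CARD('n) + card {A :: 'n set. card A \<le> 2}"
    unfolding exponents_le_2
    by (subst card_Un_disjoint) (simp_all add: card_image inj_on_subset)
  have le2: "m \<le> 2 \<longleftrightarrow> (m = 0 \<or> m = 1) \<or> m = 2" for m :: nat by auto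
  have "{A :: 'n set. card A \<le> 2} = {A. A \<subseteq> UNIV \<and> card A = 0} \<union> {A. A \<subseteq> UNIV \<and> card A = 1} \<union> {A. A \<subseteq> UNIV \<and> card A = 2}"
    unfolding Collect_disj_eq[symmetric] le2 by (simp only: subset_UNIV simp_thms)
  also have "card \<dots> = (CARD('n) choose 0) + (CARD('n) choose 1) + (CARD('n) choose 2)"
    by (subst card_Un_disjoint, simp, simp, force)+ (simp only: n_subsets[OF finite_class.finite_UNIV])
  finally show ?thesis
    unfolding 1 by (simp add: numeral_2_eq_2)
qed

lemma monomial_at_two_axes:
  fixes b :: "'n::finite \<Rightarrow> nat"
  assumes "i \<noteq> j"
  shows "(\<Prod>k\<in>UNIV. ((s *\<^sub>R axis i 1 + t *\<^sub>R axis j 1 :: real^'n) $ k) ^ b k)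
     = (if \<forall>k. k \<noteq> i \<longrightarrow> k \<noteq> j \<longrightarrow> b k = 0 then s ^ b i * t ^ b j else 0)"
proof -
  let ?x = "s *\<^sub>R axis i 1 + t *\<^sub>R axis j 1 :: real^'n"
  have x: "?x $ i = s" "?x $ j = t" "\<And>k. k \<noteq> i \<Longrightarrow> k \<noteq> j \<Longrightarrow> ?x $ k = 0"
    using assms by (auto simp: axis_def)
  have "(\<Prod>k\<in>UNIV. (?x $ k) ^ b k) = (\<Prod>k\<in>{i, j}. (?x $ k) ^ b k) * (\<Prod>k\<in>UNIV - {i, j}. (?x $ k) ^ b k)"
    by (subst prod.union_disjoint[symmetric]) (auto intro: prod.cong)
  also have "(\<Prod>k\<in>{i, j}. (?x $ k) ^ b k) = s ^ b i * t ^ b j"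
    using assms x(1,2) by (simp del: vector_add_component)
  \<comment> \<open>Because \<open>0 ^ 0 = 1\<close>, the remaining product is 1 or 0 according to
    whether all other exponents vanish.\<close>
  also have "(\<Prod>k\<in>UNIV - {i, j}. (?x $ k) ^ b k) = (\<Prod>k\<in>UNIV - {i, j}. 0 ^ b k)"
    by (rule prod.cong) (auto simp del: vector_add_component simp add: x(3))
  finally show ?thesis by (auto simp: prod_zero_iff)
qed

lemma monomial_at_axis:
  fixes b :: "'n::finite \<Rightarrow> nat"
  shows "(\<Prod>k\<in>UNIV. ((s *\<^sub>R axis i 1 :: real^'n) $ k) ^ b k)
     = (if \<forall>k. k \<noteq> i \<longrightarrow> b k = 0 then s ^ b i else 0)"
proof -
  let ?x = "s *\<^sub>R axis i 1 :: real^'n"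
  have "(\<Prod>k\<in>UNIV. (?x $ k) ^ b k) = s ^ b i * (\<Prod>k\<in>UNIV - {i}. (?x $ k) ^ b k)"
    by (simp add: prod.remove[of _ i])
  also have "(\<Prod>k\<in>UNIV - {i}. (?x $ k) ^ b k) = (\<Prod>k\<in>UNIV - {i}. 0 ^ b k)"
    by (rule prod.cong) (auto simp: axis_def)
  finally show ?thesis by (auto simp: prod_zero_iff)
qed

text \<open>Each coefficient is read off by an explicit combination of at most four point
  evaluations. Both radii matter only for the constant and the squares, as
  \<open>|x|\<^sup>2 - r1\<^sup>2\<close> vanishes on one sphere; linear and mixed coefficients are
  visible on the first sphere alone.\<close>

lemma quadratic_zero_on_two_spheres:
  fixes c :: "('n::finite \<Rightarrow> nat) \<Rightarrow> real"
  assumes r: "0 < r1" "0 < r2" "r1 \<noteq> r2"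
    and zero: "\<And>x :: real^'n. norm x = r1 \<or> norm x = r2 \<Longrightarrow>
      (\<Sum>b | (\<Sum>i\<in>UNIV. b i) \<le> 2. c b * (\<Prod>i\<in>UNIV. (x $ i) ^ b i)) = 0"
    and a: "(\<Sum>i\<in>UNIV. a i) \<le> 2"
  shows "c a = 0"
proof -
  define E where "E = {b :: 'n \<Rightarrow> nat. (\<Sum>i\<in>UNIV. b i) \<le> 2}"
  have fin: "finite E" unfolding E_def by (rule finite_exponents)
  define m where "m b x = (\<Prod>i\<in>UNIV. (x $ i) ^ b i)" for b :: "'n \<Rightarrow> nat" and x :: "real^'n"
  have z: "(\<Sum>b\<in>E. c b * m b x) = 0" if "norm x = r1 \<or> norm x = r2" for x
    using zero[OF that] by (simp add: E_def m_def)
  \<comment> \<open>A combination of point evaluations on the spheres that is dual to the monomial with exponent \<open>a\<close>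
    forces \<open>c a = 0\<close>.\<close>
  have dual: "c a = 0"
    if q: "norm q1 = r1" "norm q2 = r1" "norm q3 = r1 \<or> norm q3 = r2" "norm q4 = r1 \<or> norm q4 = r2"
      and K: "K \<noteq> 0"
      and L: "\<And>b. b \<in> E \<Longrightarrow> l1 * m b q1 + l2 * m b q2 + l3 * m b q3 + l4 * m b q4 = (if b = a then K else 0)"
    for q1 q2 q3 q4 l1 l2 l3 l4 K
  proof -
    have "0 = l1 * (\<Sum>b\<in>E. c b * m b q1) + l2 * (\<Sum>b\<in>E. c b * m b q2)
        + l3 * (\<Sum>b\<in>E. c b * m b q3) + l4 * (\<Sum>b\<in>E. c b * m b q4)"
      using q by (simp add: z)
    also have "\<dots> = (\<Sum>b\<in>E. c b * (l1 * m b q1 + l2 * m b q2 + l3 * m b q3 + l4 * m b q4))"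
      by (simp add: sum_distrib_left sum.distrib distrib_left mult.left_commute)
    also have "\<dots> = (\<Sum>b\<in>E. if b = a then c a * K else 0)"
      by (rule sum.cong) (auto simp: L)
    also have "\<dots> = c a * K" using a fin by (simp add: E_def)
    finally show ?thesis using K by simp
  qed
  have bi: "b i \<in> {0, 1, 2}" if "b \<in> E" for b i
  proof -
    have "b i \<le> (\<Sum>i\<in>UNIV. b i)" by (rule member_le_sum) auto
    then show ?thesis using that by (auto simp: E_def)
  qed
  have m1: "m b (s *\<^sub>R axis i 1) = (if \<forall>k. k \<noteq> i \<longrightarrow> b k = 0 then s ^ b i else 0)" for b s i
    unfolding m_def by (rule monomial_at_axis)
  have m2: "m b (s *\<^sub>R axis i 1 + t *\<^sub>R axis j 1)
      = (if \<forall>k. k \<noteq> i \<longrightarrow> k \<noteq> j \<longrightarrow> b k = 0 then s ^ b i * t ^ b j else 0)" if "i \<noteq> j" for b s t i j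
    unfolding m_def by (rule monomial_at_two_axes[OF that])
  have r12: "r1\<^sup>2 \<noteq> r2\<^sup>2" using r by (simp add: power2_eq_iff_nonneg)
  consider (double) i where "a = (\<lambda>k. if k = i then 2 else 0)"
    | (sub) A where "a = (\<lambda>k. of_bool (k \<in> A))" "card A \<le> 2"
    using a exponents_le_2[where 'n = 'n] by blast
  then show ?thesis
  proof cases
    case (double i)
    \<comment> \<open>The even parts on the two radii are subtracted: constants cancel and
      \<open>r1\<^sup>2 - r2\<^sup>2\<close> survives.\<close>
    show ?thesis
    proof (rule dual[of "r1 *\<^sub>R axis i 1" "- r1 *\<^sub>R axis i 1" "r2 *\<^sub>R axis i 1" "- r2 *\<^sub>R axis i 1"
          "2 * r1\<^sup>2 - 2 * r2\<^sup>2" 1 1 "- 1" "- 1"])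
      fix b assume b: "b \<in> E"
      define Z where "Z \<longleftrightarrow> (\<forall>k. k \<noteq> i \<longrightarrow> b k = 0)"
      have ba: "b = a \<longleftrightarrow> (\<forall>k. k \<noteq> i \<longrightarrow> b k = 0) \<and> b i = 2" by (auto simp: double fun_eq_iff)
      show "1 * m b (r1 *\<^sub>R axis i 1) + 1 * m b (- r1 *\<^sub>R axis i 1) + - 1 * m b (r2 *\<^sub>R axis i 1) + - 1 * m b (- r2 *\<^sub>R axis i 1)
          = (if b = a then 2 * r1\<^sup>2 - 2 * r2\<^sup>2 else 0)"
        using bi[OF b, of i] unfolding m1 ba Z_def[symmetric] by (cases Z; elim insertE emptyE; simp)
    qed (use r r12 in simp_all)
  next
    case (sub A)
    then consider "A = {}" | i where "A = {i}" | i j where "A = {i, j}" "i \<noteq> j"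
      by (metis card_1_singletonE card_2_iff card_eq_0_iff finite le_SucE le_zero_eq numeral_2_eq_2 One_nat_def)
    then show ?thesis
    proof cases
      case 1
      \<comment> \<open>Any axis will do. The weights \<open>r2\<^sup>2\<close> and
        \<open>- (r1\<^sup>2)\<close> cancel the quadratic part and keep the constant.\<close>
      define i :: 'n where "i = undefined"
      show ?thesis
      proof (rule dual[of "r1 *\<^sub>R axis i 1" "- r1 *\<^sub>R axis i 1" "r2 *\<^sub>R axis i 1" "- r2 *\<^sub>R axis i 1"
            "2 * r2\<^sup>2 - 2 * r1\<^sup>2" "r2\<^sup>2" "r2\<^sup>2" "- (r1\<^sup>2)" "- (r1\<^sup>2)"])
        fix b assume b: "b \<in> E"
        define Z where "Z \<longleftrightarrow> (\<forall>k. k \<noteq> i \<longrightarrow> b k = 0)"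
        have ba: "b = a \<longleftrightarrow> (\<forall>k. k \<noteq> i \<longrightarrow> b k = 0) \<and> b i = 0"
          by (auto simp: sub 1 fun_eq_iff) metis
        show "r2\<^sup>2 * m b (r1 *\<^sub>R axis i 1) + r2\<^sup>2 * m b (- r1 *\<^sub>R axis i 1) + - (r1\<^sup>2) * m b (r2 *\<^sub>R axis i 1)
            + - (r1\<^sup>2) * m b (- r2 *\<^sub>R axis i 1) = (if b = a then 2 * r2\<^sup>2 - 2 * r1\<^sup>2 else 0)"
          using bi[OF b, of i] unfolding m1 ba Z_def[symmetric] by (cases Z; elim insertE emptyE; simp)
      qed (use r r12 in simp_all)
    next
      case (2 i)
      \<comment> \<open>The odd part along the axis needs two points; the weights 0 fill the other
        places of \<open>dual\<close>.\<close>
      show ?thesis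
      proof (rule dual[of "r1 *\<^sub>R axis i 1" "- r1 *\<^sub>R axis i 1" "r1 *\<^sub>R axis i 1" "r1 *\<^sub>R axis i 1"
            "2 * r1" 1 "- 1" 0 0])
        fix b assume b: "b \<in> E"
        define Z where "Z \<longleftrightarrow> (\<forall>k. k \<noteq> i \<longrightarrow> b k = 0)"
        have ba: "b = a \<longleftrightarrow> (\<forall>k. k \<noteq> i \<longrightarrow> b k = 0) \<and> b i = 1" by (auto simp: sub 2 fun_eq_iff)
        show "1 * m b (r1 *\<^sub>R axis i 1) + - 1 * m b (- r1 *\<^sub>R axis i 1) + 0 * m b (r1 *\<^sub>R axis i 1)
            + 0 * m b (r1 *\<^sub>R axis i 1) = (if b = a then 2 * r1 else 0)"
          using bi[OF b, of i] unfolding m1 ba Z_def[symmetric] by (cases Z; elim insertE emptyE; simp)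
      qed (use r in simp_all)
    next
      case (3 i j)
      \<comment> \<open>The four points with coordinates \<open>h\<close>, \<open>- h\<close> lie on
        the first sphere, and their mixed second difference isolates the product of the two
        coordinates.\<close>
      define h where "h = r1 / sqrt 2"
      have h: "h > 0" "2 * h\<^sup>2 = r1\<^sup>2" using r by (auto simp: h_def power_divide)
      have ax: "axis i 1 \<bullet> (axis i 1 :: real^'n) = 1" "axis j 1 \<bullet> (axis j 1 :: real^'n) = 1"
        "axis i 1 \<bullet> (axis j 1 :: real^'n) = 0" "axis j 1 \<bullet> (axis i 1 :: real^'n) = 0"
        using 3(2) by (simp_all add: inner_axis_axis)
      have nh: "norm (s *\<^sub>R axis i 1 + t *\<^sub>R axis j 1 :: real^'n) = r1" if "s\<^sup>2 = h\<^sup>2" "t\<^sup>2 = h\<^sup>2" for s t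
      proof -
        have "(norm (s *\<^sub>R axis i 1 + t *\<^sub>R axis j 1 :: real^'n))\<^sup>2 = s\<^sup>2 + t\<^sup>2"
          unfolding power2_norm_eq_inner inner_add_left inner_add_right inner_scaleR_left inner_scaleR_right ax
          by (simp add: power2_eq_square)
        also have "\<dots> = r1\<^sup>2" using that h(2) by simp
        finally show ?thesis using r(1) by (simp add: power2_eq_iff_nonneg)
      qed
      show ?thesis
      proof (rule dual[of "h *\<^sub>R axis i 1 + h *\<^sub>R axis j 1" "h *\<^sub>R axis i 1 + (- h) *\<^sub>R axis j 1"
            "(- h) *\<^sub>R axis i 1 + h *\<^sub>R axis j 1" "(- h) *\<^sub>R axis i 1 + (- h) *\<^sub>R axis j 1"
            "4 * h\<^sup>2" 1 "- 1" "- 1" 1])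
        fix b assume b: "b \<in> E"
        have "b i + b j = (\<Sum>k\<in>{i, j}. b k)" using 3 by simp
        also have "\<dots> \<le> (\<Sum>k\<in>UNIV. b k)" by (rule sum_mono2) auto
        finally have s2: "b i + b j \<le> 2" using b by (simp add: E_def)
        define Z where "Z \<longleftrightarrow> (\<forall>k. k \<noteq> i \<longrightarrow> k \<noteq> j \<longrightarrow> b k = 0)"
        have ba: "b = a \<longleftrightarrow> (\<forall>k. k \<noteq> i \<longrightarrow> k \<noteq> j \<longrightarrow> b k = 0) \<and> b i = 1 \<and> b j = 1"
          using 3 by (auto simp: sub fun_eq_iff)
        show "1 * m b (h *\<^sub>R axis i 1 + h *\<^sub>R axis j 1) + - 1 * m b (h *\<^sub>R axis i 1 + (- h) *\<^sub>R axis j 1)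
            + - 1 * m b ((- h) *\<^sub>R axis i 1 + h *\<^sub>R axis j 1)
            + 1 * m b ((- h) *\<^sub>R axis i 1 + (- h) *\<^sub>R axis j 1) = (if b = a then 4 * h\<^sup>2 else 0)"
          using bi[OF b, of i] bi[OF b, of j] s2 unfolding m2[OF 3(2)] ba Z_def[symmetric]
          by (cases Z; elim insertE emptyE; simp add: power2_eq_square)
      next
        show "norm (h *\<^sub>R axis i 1 + h *\<^sub>R axis j 1 :: real^'n) = r1" by (rule nh) simp_all
        show "norm (h *\<^sub>R axis i 1 + (- h) *\<^sub>R axis j 1 :: real^'n) = r1" by (rule nh) simp_all
        show "norm ((- h) *\<^sub>R axis i 1 + h *\<^sub>R axis j 1 :: real^'n) = r1 \<or> norm ((- h) *\<^sub>R axis i 1 + h *\<^sub>R axis j 1 :: real^'n) = r2"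
          by (rule disjI1, rule nh) simp_all
        show "norm ((- h) *\<^sub>R axis i 1 + (- h) *\<^sub>R axis j 1 :: real^'n) = r1 \<or> norm ((- h) *\<^sub>R axis i 1 + (- h) *\<^sub>R axis j 1 :: real^'n) = r2"
          by (rule disjI1, rule nh) simp_all
        show "4 * h\<^sup>2 \<noteq> 0" using h(1) by simp
      qed
    qed
  qed
qed

lemma sum_fun_eval: "(\<Sum>j\<in>J. f j) x = (\<Sum>j\<in>J. f j x :: real)"
  by (induction J rule: infinite_finite_induct) auto

lemma dim_polynomials_on_two_spheres:
  assumes r: "0 < r1" "0 < r2" "r1 \<noteq> r2"
  shows "fun_space.dim (polynomials_on 2 (sphere 0 r1 \<union> sphere 0 r2 :: (real^'n) set))
    = (CARD('n) + 2) choose 2"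
proof -
  define S where "S = (sphere 0 r1 \<union> sphere 0 r2 :: (real^'n) set)"
  define E where "E = {b :: 'n \<Rightarrow> nat. (\<Sum>i\<in>UNIV. b i) \<le> 2}"
  have fin: "finite E" unfolding E_def by (rule finite_exponents)
  define e where "e b = (\<lambda>x :: real^'n. if x \<in> S then \<Prod>i\<in>UNIV. (x $ i) ^ b i else 0)" for b
  have lin_indep: "c a = 0" if "\<And>x. (\<Sum>b\<in>E. c b * e b x) = 0" "a \<in> E" for c a
  proof (rule quadratic_zero_on_two_spheres[OF r])
    show "(\<Sum>i\<in>UNIV. a i) \<le> 2" using that by (simp add: E_def)
    fix x :: "real^'n" assume "norm x = r1 \<or> norm x = r2"
    then have "x \<in> S" by (auto simp: S_def)
    then show "(\<Sum>b | (\<Sum>i\<in>UNIV. b i) \<le> 2. c b * (\<Prod>i\<in>UNIV. (x $ i) ^ b i)) = 0"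
      using that(1)[of x] by (simp add: E_def e_def)
  qed
  have inj: "inj_on e E"
  proof (rule inj_onI, rule ccontr)
    \<comment> \<open>Equal restrictions of distinct monomials would give the linear relation with
      coefficients 1 and -1.\<close>
    fix a b assume ab: "a \<in> E" "b \<in> E" "e a = e b" "a \<noteq> b"
    define c :: "('n \<Rightarrow> nat) \<Rightarrow> real" where "c d = (if d = a then 1 else if d = b then - 1 else 0)" for d
    have "(\<Sum>d\<in>E. c d * e d x) = 0" for x
    proof -
      have "(\<Sum>d\<in>E. c d * e d x) = (\<Sum>d\<in>{a, b}. c d * e d x)"
        by (rule sum.mono_neutral_right[OF fin]) (use ab in \<open>auto simp: c_def\<close>)
      then show ?thesis using ab by (simp add: c_def)
    qed
    from lin_indep[OF this ab(1)] show False by (simp add: c_def)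
  qed
  have "fun_space.independent (e ` E)"
  proof (rule fun_space.independent_if_scalars_zero)
    fix f x assume f: "(\<Sum>g\<in>e ` E. (\<lambda>x. f g * g x)) = 0" and "x \<in> e ` E"
    then obtain a where a: "x = e a" "a \<in> E" by blast
    have "(\<Sum>b\<in>E. f (e b) * e b y) = 0" for y
      using fun_cong[OF f, of y] by (simp add: sum_fun_eval sum.reindex[OF inj])
    from lin_indep[OF this a(2)] show "f x = 0" using a by simp
  qed (simp add: fin)
  moreover have "e ` E \<subseteq> polynomials_on 2 S"
    unfolding polynomials_on_def e_def E_def using polynomial_monomial by fastforce
  moreover have "polynomials_on 2 S \<subseteq> fun_space.span (e ` E)"
  proof
    fix g assume "g \<in> polynomials_on 2 S"
    then obtain f where g: "g = (\<lambda>x. if x \<in> S then f x else 0)" and "polynomial_of_degree_le 2 f"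
      unfolding polynomials_on_def by blast
    then obtain c where f: "\<And>x. f x = (\<Sum>b\<in>E. c b * (\<Prod>i\<in>UNIV. (x $ i) ^ b i))"
      unfolding polynomial_of_degree_le_def E_def by blast
    have "g = (\<Sum>b\<in>E. (\<lambda>x. c b * e b x))"
      by (rule ext) (simp add: g f sum_fun_eval e_def)
    also have "\<dots> \<in> fun_space.span (e ` E)"
      by (intro fun_space.span_sum fun_space.span_scale fun_space.span_base) auto
    finally show "g \<in> fun_space.span (e ` E)" .
  qed
  ultimately have "fun_space.dim (polynomials_on 2 S) = card (e ` E)"
    by (intro fun_space.dim_unique) auto
  also have "\<dots> = (CARD('n) + 2) choose 2"
    using card_image[OF inj] card_exponents_le_2[where 'n = 'n] by (simp add: E_def)
  finally show ?thesis by (simp add: S_def)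
qed

section \<open>Spherical 2-designs with two inner products\<close>

text \<open>The first and second moments of the unit sphere, the latter in polarized form. The
  dimension \<open>n\<close> is a real parameter independent of the type, so that the arguments
  below are pure algebra.\<close>

definition spherical_2_design :: "real \<Rightarrow> 'a::real_inner set \<Rightarrow> bool" where
  "spherical_2_design n Y \<longleftrightarrow> finite Y \<and> (\<forall>x\<in>Y. norm x = 1) \<and> (\<forall>v. (\<Sum>z\<in>Y. v \<bullet> z) = 0) \<and>
     (\<forall>u v. (\<Sum>z\<in>Y. (u \<bullet> z) * (v \<bullet> z)) = real (card Y) / n * (u \<bullet> v))"

lemma spherical_2_designD:
  assumes "spherical_2_design n Y"
  shows "finite Y" "x \<in> Y \<Longrightarrow> norm x = 1" "x \<in> Y \<Longrightarrow> x \<bullet> x = 1" "(\<Sum>z\<in>Y. v \<bullet> z) = 0"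
    "(\<Sum>z\<in>Y. (u \<bullet> z) * (v \<bullet> z)) = real (card Y) / n * (u \<bullet> v)"
  using assms by (auto simp: spherical_2_design_def dot_square_norm)

text \<open>The multiplication rule for combinations of Gram matrix, all-one matrix and identity:
  the Gram matrix squares to \<open>card Y / n\<close> times itself and annihilates constants. Since
  \<open>x\<close> and \<open>y\<close> may lie outside \<open>Y\<close>, the same rule covers sums
  over the other class.\<close>

lemma spherical_2_design_sum_product:
  fixes x y :: "'a::real_inner"
  assumes "spherical_2_design n Y"
  shows "(\<Sum>z\<in>Y. (a * (x \<bullet> z) + b + c * of_bool (z = x)) * (a' * (y \<bullet> z) + b' + c' * of_bool (z = y)))
    = a * a' * (real (card Y) / n) * (x \<bullet> y) + b * b' * real (card Y)
      + (if x \<in> Y then c * (a' * (x \<bullet> y) + b') else 0)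
      + (if y \<in> Y then c' * (a * (x \<bullet> y) + b) else 0)
      + (if x = y \<and> x \<in> Y then c * c' else 0)"
proof -
  note D = spherical_2_designD[OF assms]
  have "(\<Sum>z\<in>Y. (a * (x \<bullet> z) + b + c * of_bool (z = x)) * (a' * (y \<bullet> z) + b' + c' * of_bool (z = y)))
    = (\<Sum>z\<in>Y. a * a' * ((x \<bullet> z) * (y \<bullet> z)) + a * b' * (x \<bullet> z) + b * a' * (y \<bullet> z) + b * b'
        + (if z = x then c * (a' * (y \<bullet> x) + b') else 0) + (if z = y then c' * (a * (x \<bullet> y) + b) else 0)
        + (if z = x then if x = y then c * c' else 0 else 0))"
    by (rule sum.cong) (auto simp: algebra_simps)
  also have "\<dots> = a * a' * (real (card Y) / n * (x \<bullet> y)) + b * b' * real (card Y)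
      + (if x \<in> Y then c * (a' * (y \<bullet> x) + b') else 0)
      + (if y \<in> Y then c' * (a * (x \<bullet> y) + b) else 0)
      + (if x \<in> Y then if x = y then c * c' else 0 else 0)"
    using D(1) by (simp add: sum.distrib sum_distrib_left[symmetric] D(4,5))
  finally show ?thesis by (simp add: inner_commute)
qed

text \<open>The two moments at a point of \<open>Y\<close> give two equations for
  \<open>\<alpha>\<close>; eliminating it leaves the size of a regular simplex. Larger designs
  therefore have at least two inner products.\<close>

lemma spherical_2_design_one_angle:
  fixes Y :: "'a::real_inner set"
  assumes Y: "spherical_2_design n Y" and n: "n > 0" and two: "card Y \<ge> 2"
    and \<alpha>: "\<And>x y. x \<in> Y \<Longrightarrow> y \<in> Y \<Longrightarrow> x \<noteq> y \<Longrightarrow> x \<bullet> y = \<alpha>"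
  shows "real (card Y) = n + 1"
proof -
  note D = spherical_2_designD[OF Y]
  define N where "N = real (card Y)"
  have N: "N \<ge> 2" using two by (simp add: N_def)
  obtain x where x: "x \<in> Y" using two by fastforce
  have c: "real (card (Y - {x})) = N - 1"
    using x D(1) two by (simp add: N_def of_nat_diff)
  have "0 = 1 + (\<Sum>z\<in>Y - {x}. x \<bullet> z)" using D(4)[of x] D(3)[OF x] sum.remove[OF D(1) x, of "\<lambda>z. x \<bullet> z"] by simp
  also have "(\<Sum>z\<in>Y - {x}. x \<bullet> z) = (\<Sum>z\<in>Y - {x}. \<alpha>)" using \<alpha> x by (intro sum.cong) auto
  finally have 1: "1 + (N - 1) * \<alpha> = 0" by (simp only: sum_constant c)
  have "N / n = 1 + (\<Sum>z\<in>Y - {x}. (x \<bullet> z) * (x \<bullet> z))"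
    using D(5)[of x x] D(3)[OF x] sum.remove[OF D(1) x, of "\<lambda>z. (x \<bullet> z) * (x \<bullet> z)"] by (simp add: N_def)
  also have "(\<Sum>z\<in>Y - {x}. (x \<bullet> z) * (x \<bullet> z)) = (\<Sum>z\<in>Y - {x}. \<alpha> * \<alpha>)" using \<alpha> x by (intro sum.cong) auto
  finally have 2: "N / n = 1 + (N - 1) * (\<alpha> * \<alpha>)" by (simp only: sum_constant c)
  have "(N - 1) * (N / n) = (N - 1) + ((N - 1) * \<alpha>) * ((N - 1) * \<alpha>)" unfolding 2 by (simp add: algebra_simps)
  also have "(N - 1) * \<alpha> = - 1" using 1 by simp
  finally have "(N - 1) * N = N * n" using n by (simp add: field_simps)
  then show ?thesis using N by (simp add: N_def)
qed

text \<open>Off the diagonal the inner product is a root of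
  \<open>(t - \<alpha>1) * (t - \<alpha>2)\<close>; at \<open>t = 1\<close> this polynomial takes
  the value that appears as the diagonal correction.\<close>

lemma spherical_2_design_square:
  fixes Y :: "'a::real_inner set"
  assumes Y: "spherical_2_design n Y" and "x \<in> Y" "z \<in> Y"
    and \<alpha>: "\<And>x y. x \<in> Y \<Longrightarrow> y \<in> Y \<Longrightarrow> x \<noteq> y \<Longrightarrow> x \<bullet> y = \<alpha>1 \<or> x \<bullet> y = \<alpha>2"
  shows "(x \<bullet> z)\<^sup>2 = (\<alpha>1 + \<alpha>2) * (x \<bullet> z) + (- \<alpha>1 * \<alpha>2) + (1 - \<alpha>1) * (1 - \<alpha>2) * of_bool (z = x)"
proof (cases "z = x")
  case True
  then show ?thesis using spherical_2_designD(3)[OF Y \<open>x \<in> Y\<close>] by (simp add: algebra_simps)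
next
  case False
  then show ?thesis using \<alpha>[OF assms(2,3)] by (auto simp: algebra_simps power2_eq_square)
qed

text \<open>This is \<open>spherical_2_design_square\<close> summed over \<open>z\<close>: the
  second moment on the left, while the linear term on the right sums to zero.\<close>

lemma spherical_2_design_card_relation:
  fixes Y :: "'a::real_inner set"
  assumes Y: "spherical_2_design n Y" and "Y \<noteq> {}"
    and \<alpha>: "\<And>x y. x \<in> Y \<Longrightarrow> y \<in> Y \<Longrightarrow> x \<noteq> y \<Longrightarrow> x \<bullet> y = \<alpha>1 \<or> x \<bullet> y = \<alpha>2"
  shows "real (card Y) / n + real (card Y) * (\<alpha>1 * \<alpha>2) = (1 - \<alpha>1) * (1 - \<alpha>2)"
proof -
  note D = spherical_2_designD[OF Y]
  obtain x where x: "x \<in> Y" using \<open>Y \<noteq> {}\<close> by blast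
  have "real (card Y) / n = (\<Sum>z\<in>Y. (x \<bullet> z)\<^sup>2)"
    using D(5)[of x x] D(3)[OF x] by (simp add: power2_eq_square)
  also have "\<dots> = (\<Sum>z\<in>Y. (\<alpha>1 + \<alpha>2) * (x \<bullet> z) + (- \<alpha>1 * \<alpha>2) + (1 - \<alpha>1) * (1 - \<alpha>2) * of_bool (z = x))"
    by (intro sum.cong refl spherical_2_design_square[OF Y x _ \<alpha>])
  also have "\<dots> = - real (card Y) * (\<alpha>1 * \<alpha>2) + (1 - \<alpha>1) * (1 - \<alpha>2)"
    using D(1) x by (simp add: sum.distrib sum_subtractf sum_distrib_left[symmetric] D(4) of_bool_def)
  finally show ?thesis by simp
qed

text \<open>The cardinality relation is linear in \<open>\<alpha>2\<close>. If the coefficient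
  vanished, so would the constant term, and eliminating \<open>\<alpha>1\<close> leaves
  \<open>card Y * (card Y - (n + 1)) = 0\<close>, against the strict lower bound.\<close>

lemma spherical_2_design_second_angle:
  fixes Y :: "'a::real_inner set"
  assumes Y: "spherical_2_design n Y" and n: "n > 0" and N: "real (card Y) > n + 1"
    and \<alpha>: "\<And>x y. x \<in> Y \<Longrightarrow> y \<in> Y \<Longrightarrow> x \<noteq> y \<Longrightarrow> x \<bullet> y = \<alpha>1 \<or> x \<bullet> y = \<alpha>2"
  shows "(real (card Y) - 1) * \<alpha>1 + 1 \<noteq> 0"
    and "\<alpha>2 = - ((n * \<alpha>1 - n + real (card Y)) / (n * ((real (card Y) - 1) * \<alpha>1 + 1)))"
proof -
  define N where "N = real (card Y)"
  have "Y \<noteq> {}" using assms by auto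
  from spherical_2_design_card_relation[OF Y this \<alpha>]
  have "n * (N / n + N * (\<alpha>1 * \<alpha>2)) = n * ((1 - \<alpha>1) * (1 - \<alpha>2))" by (simp add: N_def)
  then have rel: "\<alpha>2 * (n * ((N - 1) * \<alpha>1 + 1)) = - (n * \<alpha>1 - n + N)"
    using n by (simp add: algebra_simps)
  show *: "(real (card Y) - 1) * \<alpha>1 + 1 \<noteq> 0"
  proof
    assume "(real (card Y) - 1) * \<alpha>1 + 1 = 0"
    then have 0: "(N - 1) * \<alpha>1 + 1 = 0" by (simp add: N_def)
    with rel have "n * \<alpha>1 - n + N = 0" by simp
    then have "(N - 1) * (n * \<alpha>1) = (N - 1) * (n - N)" by simp
    then have "n * ((N - 1) * \<alpha>1) = (N - 1) * (n - N)" by (simp add: mult.left_commute)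
    moreover have "(N - 1) * \<alpha>1 = - 1" using 0 by simp
    ultimately have "n * (- 1) = (N - 1) * (n - N)" by simp
    then have "N * (N - (n + 1)) = 0" by algebra
    then show False using assms(2,3) by (simp add: N_def)
  qed
  then have "n * ((N - 1) * \<alpha>1 + 1) \<noteq> 0" using n by (simp add: N_def)
  then have "\<alpha>2 = - (n * \<alpha>1 - n + N) / (n * ((N - 1) * \<alpha>1 + 1))"
    using rel by (simp only: nonzero_eq_divide_eq not_False_eq_True)
  then show "\<alpha>2 = - ((n * \<alpha>1 - n + real (card Y)) / (n * ((real (card Y) - 1) * \<alpha>1 + 1)))"
    unfolding N_def by (simp only: minus_divide_left)
qed

text \<open>Summing \<open>(t - \<gamma>1) * (t - \<gamma>2) = 0\<close> over
  \<open>t = x \<bullet> z\<close> kills the linear term and turns the square into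
  \<open>card Y / n\<close>. The values may coincide, which is how a single cross inner product is
  excluded later.\<close>

lemma spherical_2_design_cross_product:
  fixes Y :: "'a::real_inner set"
  assumes Y: "spherical_2_design n Y" "Y \<noteq> {}" and x: "norm x = 1"
    and \<gamma>: "\<And>z. z \<in> Y \<Longrightarrow> x \<bullet> z = \<gamma>1 \<or> x \<bullet> z = \<gamma>2"
  shows "\<gamma>1 * \<gamma>2 = - (1 / n)"
proof -
  note D = spherical_2_designD[OF Y(1)]
  have N: "real (card Y) \<noteq> 0" using D(1) Y(2) by simp
  have "0 = (\<Sum>z\<in>Y. ((x \<bullet> z) - \<gamma>1) * ((x \<bullet> z) - \<gamma>2))"
    by (rule sum.neutral[symmetric]) (use \<gamma> in auto)
  also have "\<dots> = (\<Sum>z\<in>Y. (x \<bullet> z) * (x \<bullet> z) + (- \<gamma>1 - \<gamma>2) * (x \<bullet> z) + \<gamma>1 * \<gamma>2)"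
    by (intro sum.cong) (auto simp: algebra_simps)
  also have "\<dots> = real (card Y) / n + real (card Y) * (\<gamma>1 * \<gamma>2)"
    using x by (simp add: sum.distrib sum_distrib_left[symmetric] D(4,5) dot_square_norm)
  also have "\<dots> = real (card Y) * (1 / n + \<gamma>1 * \<gamma>2)" by (simp add: algebra_simps)
  finally show ?thesis using N by simp
qed

text \<open>On \<open>Y\<close> the function \<open>(x \<bullet> z) - \<gamma>2\<close> is
  \<open>\<gamma>1 - \<gamma>2\<close> times the indicator of the counted set, and its sum is
  \<open>- card Y * \<gamma>2\<close>. Multiplying by \<open>n * \<gamma>1\<close> then eliminates
  \<open>\<gamma>2\<close> through the product of the two values.\<close>

lemma spherical_2_design_cross_count:
  fixes Y :: "'a::real_inner set"
  assumes Y: "spherical_2_design n Y" "Y \<noteq> {}" and x: "norm x = 1" and n: "n > 0"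
    and \<gamma>: "\<And>z. z \<in> Y \<Longrightarrow> x \<bullet> z = \<gamma>1 \<or> x \<bullet> z = \<gamma>2" and "\<gamma>1 > \<gamma>2"
  shows "real (card {z \<in> Y. x \<bullet> z = \<gamma>1}) = real (card Y) / (1 + n * \<gamma>1\<^sup>2)"
proof -
  note D = spherical_2_designD[OF Y(1)]
  have prod: "\<gamma>1 * \<gamma>2 = - (1 / n)" by (rule spherical_2_design_cross_product[OF Y x \<gamma>])
  have "(\<gamma>1 - \<gamma>2) * real (card {z \<in> Y. x \<bullet> z = \<gamma>1}) = (\<Sum>z\<in>Y. if x \<bullet> z = \<gamma>1 then \<gamma>1 - \<gamma>2 else 0)"
    using D(1) by (simp add: sum.If_cases Int_def)
  also have "\<dots> = (\<Sum>z\<in>Y. (x \<bullet> z) - \<gamma>2)"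
    by (rule sum.cong) (use \<gamma> \<open>\<gamma>1 > \<gamma>2\<close> in auto)
  also have "\<dots> = - real (card Y) * \<gamma>2" by (simp add: sum_subtractf D(4))
  finally have c: "(\<gamma>1 - \<gamma>2) * real (card {z \<in> Y. x \<bullet> z = \<gamma>1}) = - real (card Y) * \<gamma>2" .
  have "\<gamma>1 \<noteq> 0" using prod n by auto
  have "n * \<gamma>1 * ((\<gamma>1 - \<gamma>2) * real (card {z \<in> Y. x \<bullet> z = \<gamma>1})) = n * \<gamma>1 * (- real (card Y) * \<gamma>2)"
    unfolding c ..
  then have "(n * \<gamma>1\<^sup>2 - n * (\<gamma>1 * \<gamma>2)) * real (card {z \<in> Y. x \<bullet> z = \<gamma>1}) = - real (card Y) * (n * (\<gamma>1 * \<gamma>2))"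
    by (simp add: algebra_simps power2_eq_square)
  then have "(1 + n * \<gamma>1\<^sup>2) * real (card {z \<in> Y. x \<bullet> z = \<gamma>1}) = real (card Y)"
    unfolding prod using n by (simp add: algebra_simps)
  moreover have "1 + n * \<gamma>1\<^sup>2 > 0" using n by (simp add: add_pos_nonneg)
  ultimately show ?thesis by (simp add: nonzero_eq_divide_eq mult.commute)
qed

text \<open>What remains of a Euclidean 4-design after both spheres are scaled to radius 1. The
  numbers \<open>a1\<close>, \<open>a2\<close> stand for weight times fourth power of the radius and
  \<open>b1\<close>, \<open>b2\<close> for weight times cube. No order of the cardinalities is
  assumed, so the hypotheses are symmetric in the classes.\<close>

locale two_design_pair =
  fixes n :: real and Y1 Y2 :: "'a::real_inner set" and \<alpha>1 \<alpha>2 \<beta>1 \<beta>2 \<gamma>1 \<gamma>2 a1 a2 b1 b2 :: real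
  assumes n: "n > 1"
    and Y1: "spherical_2_design n Y1" and Y2: "spherical_2_design n Y2"
    and N1: "real (card Y1) > n + 1" and N2: "real (card Y2) > n + 1"
    and \<alpha>: "\<And>x y. x \<in> Y1 \<Longrightarrow> y \<in> Y1 \<Longrightarrow> x \<noteq> y \<Longrightarrow> x \<bullet> y = \<alpha>1 \<or> x \<bullet> y = \<alpha>2"
    and \<alpha>1: "\<exists>x\<in>Y1. \<exists>y\<in>Y1. x \<noteq> y \<and> x \<bullet> y = \<alpha>1" and \<alpha>2: "\<exists>x\<in>Y1. \<exists>y\<in>Y1. x \<noteq> y \<and> x \<bullet> y = \<alpha>2"
    and \<alpha>12: "\<alpha>1 > \<alpha>2"
    and \<beta>: "\<And>x y. x \<in> Y2 \<Longrightarrow> y \<in> Y2 \<Longrightarrow> x \<noteq> y \<Longrightarrow> x \<bullet> y = \<beta>1 \<or> x \<bullet> y = \<beta>2"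
    and \<beta>1: "\<exists>x\<in>Y2. \<exists>y\<in>Y2. x \<noteq> y \<and> x \<bullet> y = \<beta>1" and \<beta>2: "\<exists>x\<in>Y2. \<exists>y\<in>Y2. x \<noteq> y \<and> x \<bullet> y = \<beta>2"
    and \<beta>12: "\<beta>1 > \<beta>2"
    and \<gamma>: "\<And>x y. x \<in> Y1 \<Longrightarrow> y \<in> Y2 \<Longrightarrow> x \<bullet> y = \<gamma>1 \<or> x \<bullet> y = \<gamma>2"
    and \<gamma>1: "\<exists>x\<in>Y1. \<exists>y\<in>Y2. x \<bullet> y = \<gamma>1" and \<gamma>2: "\<exists>x\<in>Y1. \<exists>y\<in>Y2. x \<bullet> y = \<gamma>2"
    and \<gamma>12: "\<gamma>1 > \<gamma>2"
    and a: "a1 > 0" "a2 > 0" and b: "b1 > 0" "b2 > 0"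
    and cubic: "\<And>x. norm x = 1 \<Longrightarrow> b1 * (\<Sum>z\<in>Y1. (x \<bullet> z) ^ 3) + b2 * (\<Sum>z\<in>Y2. (x \<bullet> z) ^ 3) = 0"
    and quartic: "\<And>x y. norm x = 1 \<Longrightarrow> norm y = 1 \<Longrightarrow>
        a1 * (\<Sum>z\<in>Y1. (x \<bullet> z)\<^sup>2 * (y \<bullet> z)\<^sup>2) + a2 * (\<Sum>z\<in>Y2. (x \<bullet> z)\<^sup>2 * (y \<bullet> z)\<^sup>2)
          = (a1 * real (card Y1) + a2 * real (card Y2)) / (n * (n + 2)) * (1 + 2 * (x \<bullet> y)\<^sup>2)"
begin

lemma swap: "two_design_pair n Y2 Y1 \<beta>1 \<beta>2 \<alpha>1 \<alpha>2 \<gamma>1 \<gamma>2 a2 a1 b2 b1"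
proof (unfold_locales)
  show "\<And>x y. x \<in> Y2 \<Longrightarrow> y \<in> Y1 \<Longrightarrow> x \<bullet> y = \<gamma>1 \<or> x \<bullet> y = \<gamma>2"
    using \<gamma> by (metis inner_commute)
  show "\<exists>x\<in>Y2. \<exists>y\<in>Y1. x \<bullet> y = \<gamma>1" "\<exists>x\<in>Y2. \<exists>y\<in>Y1. x \<bullet> y = \<gamma>2"
    using \<gamma>1 \<gamma>2 by (metis inner_commute)+
qed (use n Y1 Y2 N1 N2 \<alpha> \<alpha>1 \<alpha>2 \<alpha>12 \<beta> \<beta>1 \<beta>2 \<beta>12 \<gamma>12 a b cubic quartic in \<open>auto simp: add.commute\<close>)

section \<open>Linear relations from the degree 3 and degree 4 conditions\<close>

definition N where "N = real (card Y1)"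
definition M where "M = real (card Y2)"
text \<open>Sums and products of the angles, so that the relations stay rational. \<open>g\<close>
  and \<open>h\<close> are the diagonal corrections in the formulas for squared inner products, and
  \<open>C\<close> is the constant of the degree 4 condition.\<close>

definition p where "p = \<alpha>1 + \<alpha>2"
definition P where "P = \<alpha>1 * \<alpha>2"
definition q where "q = \<beta>1 + \<beta>2"
definition R where "R = \<beta>1 * \<beta>2"
definition g where "g = (1 - \<alpha>1) * (1 - \<alpha>2)"
definition h where "h = (1 - \<beta>1) * (1 - \<beta>2)"
definition s where "s = \<gamma>1 + \<gamma>2"
definition C where "C = (a1 * N + a2 * M) / (n * (n + 2))"

lemmas params = N_def M_def p_def P_def q_def R_def g_def h_def s_def C_def

lemma nonempty: "Y1 \<noteq> {}" "Y2 \<noteq> {}" using N1 N2 n by auto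

lemma NM: "N > n + 1" "M > n + 1" using N1 N2 by (simp_all add: N_def M_def)

lemma C_pos: "C > 0" using NM n a by (simp add: C_def add_pos_pos)

lemma sq_1: "x \<in> Y1 \<Longrightarrow> z \<in> Y1 \<Longrightarrow> (x \<bullet> z)\<^sup>2 = p * (x \<bullet> z) + (- P) + g * of_bool (z = x)"
  using spherical_2_design_square[OF Y1 _ _ \<alpha>] by (simp add: params)

lemma sq_2: "x \<in> Y2 \<Longrightarrow> z \<in> Y2 \<Longrightarrow> (x \<bullet> z)\<^sup>2 = q * (x \<bullet> z) + (- R) + h * of_bool (z = x)"
  using spherical_2_design_square[OF Y2 _ _ \<beta>] by (simp add: params)

lemma gamma_prod: "\<gamma>1 * \<gamma>2 = - (1 / n)"
proof -
  obtain x where "x \<in> Y1" using nonempty by blast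
  then show ?thesis
    using spherical_2_design_cross_product[OF Y2 nonempty(2) _ \<gamma>] spherical_2_designD(2)[OF Y1] by blast
qed

text \<open>The term with coefficient 0 gives the formula the shape required by
  \<open>spherical_2_design_sum_product\<close>. It also makes it irrelevant whether the normalized
  classes meet.\<close>

lemma sq_12: "x \<in> Y1 \<Longrightarrow> z \<in> Y2 \<Longrightarrow> (x \<bullet> z)\<^sup>2 = s * (x \<bullet> z) + 1 / n + 0 * of_bool (z = x)"
  using \<gamma>[of x z] gamma_prod by (auto simp: s_def power2_eq_square algebra_simps)

lemma g_eq: "g = N / n + N * P" "g = 1 - p + P"
  using spherical_2_design_card_relation[OF Y1 nonempty(1) \<alpha>] by (simp_all add: params algebra_simps)

text \<open>Distinct unit vectors have inner product below 1, and both angles are attained.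
  \<open>a1_g\<close> divides by \<open>g\<close>.\<close>

lemma g_pos: "g > 0"
proof -
  have "x \<bullet> y < 1" if "x \<in> Y1" "y \<in> Y1" "x \<noteq> y" for x y
  proof -
    have "(norm (x - y))\<^sup>2 = 2 - 2 * (x \<bullet> y)"
      using that spherical_2_designD(3)[OF Y1]
      by (simp add: power2_norm_eq_inner inner_diff_left inner_diff_right inner_commute)
    moreover have "(norm (x - y))\<^sup>2 > 0" using that by simp
    ultimately show ?thesis by simp
  qed
  then have "\<alpha>1 < 1" "\<alpha>2 < 1" using \<alpha>1 \<alpha>2 by auto
  then show ?thesis by (simp add: g_def)
qed

text \<open>After the squares are expanded, only \<open>t\<close> and the diagonal indicator
  \<open>d\<close> depend on the pair: \<open>Y2\<close> contributes no diagonal term, and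
  \<open>t\<^sup>2\<close> on the right is again affine by \<open>sq_1\<close>.\<close>

lemma quartic_11:
  assumes x: "x \<in> Y1" and y: "y \<in> Y1"
  defines "t \<equiv> x \<bullet> y" and "d \<equiv> of_bool (x = y)"
  shows "(a1 * (p\<^sup>2 * (N / n) + 2 * g * p) + a2 * s\<^sup>2 * (M / n) - 2 * C * p) * t
     + (a1 * (P\<^sup>2 * N - 2 * g * P) + a2 * M / n\<^sup>2 - C * (1 - 2 * P)) + (a1 * g\<^sup>2 - 2 * C * g) * d = 0"
proof -
  have "(\<Sum>z\<in>Y1. (x \<bullet> z)\<^sup>2 * (y \<bullet> z)\<^sup>2) = (\<Sum>z\<in>Y1. (p * (x \<bullet> z) + (- P) + g * of_bool (z = x)) *
       (p * (y \<bullet> z) + (- P) + g * of_bool (z = y)))"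
    by (intro sum.cong refl arg_cong2[where f = "(*)"] sq_1 x y)
  also have "\<dots> = p\<^sup>2 * (N / n) * t + P\<^sup>2 * N + 2 * g * (p * t - P) + g\<^sup>2 * d"
    using x y unfolding spherical_2_design_sum_product[OF Y1]
    by (simp add: N_def t_def d_def power2_eq_square algebra_simps)
  finally have 1: "(\<Sum>z\<in>Y1. (x \<bullet> z)\<^sup>2 * (y \<bullet> z)\<^sup>2) = p\<^sup>2 * (N / n) * t + P\<^sup>2 * N + 2 * g * (p * t - P) + g\<^sup>2 * d" .
  have "(\<Sum>z\<in>Y2. (x \<bullet> z)\<^sup>2 * (y \<bullet> z)\<^sup>2) = (\<Sum>z\<in>Y2. (s * (x \<bullet> z) + 1 / n + 0 * of_bool (z = x)) *
       (s * (y \<bullet> z) + 1 / n + 0 * of_bool (z = y)))"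
    by (intro sum.cong refl arg_cong2[where f = "(*)"] sq_12 x y)
  also have "\<dots> = s\<^sup>2 * (M / n) * t + M / n\<^sup>2"
    unfolding spherical_2_design_sum_product[OF Y2]
    by (simp add: M_def t_def power2_eq_square algebra_simps)
  finally have 2: "(\<Sum>z\<in>Y2. (x \<bullet> z)\<^sup>2 * (y \<bullet> z)\<^sup>2) = s\<^sup>2 * (M / n) * t + M / n\<^sup>2" .
  have 3: "t\<^sup>2 = p * t - P + g * d" using sq_1[OF x y] by (auto simp: t_def d_def)
  have "a1 * (\<Sum>z\<in>Y1. (x \<bullet> z)\<^sup>2 * (y \<bullet> z)\<^sup>2) + a2 * (\<Sum>z\<in>Y2. (x \<bullet> z)\<^sup>2 * (y \<bullet> z)\<^sup>2) = C * (1 + 2 * t\<^sup>2)"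
    using quartic[of x y] spherical_2_designD(2)[OF Y1] x y by (simp add: C_def N_def M_def t_def)
  then show ?thesis unfolding 1 2 3 by (simp add: algebra_simps)
qed

text \<open>An affine function vanishing at the two distinct angles is zero, so only the diagonal
  coefficient \<open>g * (a1 * g - 2 * C)\<close> of \<open>quartic_11\<close> is left.\<close>

lemma a1_g: "a1 * g = 2 * C"
proof -
  define A where "A = a1 * (p\<^sup>2 * (N / n) + 2 * g * p) + a2 * s\<^sup>2 * (M / n) - 2 * C * p"
  define B where "B = a1 * (P\<^sup>2 * N - 2 * g * P) + a2 * M / n\<^sup>2 - C * (1 - 2 * P)"
  have AB: "A * (x \<bullet> y) + B + (a1 * g\<^sup>2 - 2 * C * g) * of_bool (x = y) = 0" if "x \<in> Y1" "y \<in> Y1" for x y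
    unfolding A_def B_def by (rule quartic_11[OF that])
  have "A * \<alpha>1 + B = 0" "A * \<alpha>2 + B = 0"
    using \<alpha>1 \<alpha>2 AB by fastforce+
  then have "A * (\<alpha>1 - \<alpha>2) = 0" by algebra
  then have "A = 0" using \<alpha>12 by simp
  then have "B = 0" using \<open>A * \<alpha>1 + B = 0\<close> by simp
  obtain x where "x \<in> Y1" using nonempty by blast
  then have "a1 * g\<^sup>2 - 2 * C * g = 0" using AB[of x x] \<open>A = 0\<close> \<open>B = 0\<close> by simp
  then have "g * (a1 * g - 2 * C) = 0" by (simp add: algebra_simps power2_eq_square)
  then show ?thesis using g_pos by simp
qed

lemma C_swap: "two_design_pair.C n Y2 Y1 a2 a1 = C"
  by (simp add: two_design_pair.C_def[OF swap] two_design_pair.N_def[OF swap] two_design_pair.M_def[OF swap]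
      params add.commute)

lemma h_eq: "h = M / n + M * R" "h = 1 - q + R"
  using two_design_pair.g_eq[OF swap]
  by (simp_all add: two_design_pair.params[OF swap] params)

lemma a2_h: "a2 * h = 2 * C"
  using two_design_pair.a1_g[OF swap] by (simp add: C_swap two_design_pair.g_def[OF swap] h_def)

text \<open>Each class contributes one in-class and one cross-class expansion. Both carry
  \<open>s\<close> in the coefficient of \<open>t\<close>, and so does \<open>t\<^sup>2\<close> on
  the right; hence the slope contains no information when \<open>s = 0\<close>.\<close>

lemma quartic_12:
  assumes x: "x \<in> Y1" and y: "y \<in> Y2"
  defines "t \<equiv> x \<bullet> y"
  shows "s * (a1 * (p * (N / n) + g) + a2 * (q * (M / n) + h) - 2 * C) * t
    + (a1 * (g / n - P * N / n) + a2 * (h / n - R * M / n) - C * (1 + 2 / n)) = 0"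
proof -
  have yx: "(y \<bullet> z)\<^sup>2 = s * (y \<bullet> z) + 1 / n + 0 * of_bool (z = y)" if "z \<in> Y1" for z
    using sq_12[OF that y] by (simp add: inner_commute)
  have "(\<Sum>z\<in>Y1. (x \<bullet> z)\<^sup>2 * (y \<bullet> z)\<^sup>2) = (\<Sum>z\<in>Y1. (p * (x \<bullet> z) + (- P) + g * of_bool (z = x)) *
       (s * (y \<bullet> z) + 1 / n + 0 * of_bool (z = y)))"
    by (intro sum.cong refl arg_cong2[where f = "(*)"] sq_1 yx x)
  also have "\<dots> = p * s * (N / n) * t - P * N / n + g * (s * t + 1 / n)"
    using x unfolding spherical_2_design_sum_product[OF Y1]
    by (simp add: N_def t_def algebra_simps)
  finally have 1: "(\<Sum>z\<in>Y1. (x \<bullet> z)\<^sup>2 * (y \<bullet> z)\<^sup>2) = p * s * (N / n) * t - P * N / n + g * (s * t + 1 / n)" .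
  have "(\<Sum>z\<in>Y2. (x \<bullet> z)\<^sup>2 * (y \<bullet> z)\<^sup>2) = (\<Sum>z\<in>Y2. (s * (x \<bullet> z) + 1 / n + 0 * of_bool (z = x)) *
       (q * (y \<bullet> z) + (- R) + h * of_bool (z = y)))"
    by (intro sum.cong refl arg_cong2[where f = "(*)"] sq_12 sq_2 x y)
  also have "\<dots> = q * s * (M / n) * t - R * M / n + h * (s * t + 1 / n)"
    using y unfolding spherical_2_design_sum_product[OF Y2]
    by (simp add: M_def t_def algebra_simps)
  finally have 2: "(\<Sum>z\<in>Y2. (x \<bullet> z)\<^sup>2 * (y \<bullet> z)\<^sup>2) = q * s * (M / n) * t - R * M / n + h * (s * t + 1 / n)" .
  have 3: "t\<^sup>2 = s * t + 1 / n" using sq_12[OF x y] by (simp add: t_def)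
  have "a1 * (\<Sum>z\<in>Y1. (x \<bullet> z)\<^sup>2 * (y \<bullet> z)\<^sup>2) + a2 * (\<Sum>z\<in>Y2. (x \<bullet> z)\<^sup>2 * (y \<bullet> z)\<^sup>2) = C * (1 + 2 * t\<^sup>2)"
    using quartic[of x y] spherical_2_designD(2)[OF Y1 x] spherical_2_designD(2)[OF Y2 y]
    by (simp add: C_def N_def M_def t_def)
  then show ?thesis unfolding 1 2 3 by (simp add: algebra_simps)
qed

text \<open>\<open>g_eq\<close> and \<open>h_eq\<close> express \<open>N * p\<close> and
  \<open>M * q\<close> by sizes and diagonal corrections. Weighted by \<open>a1\<close> and
  \<open>a2\<close>, every term becomes a multiple of \<open>C\<close>, because
  \<open>a1 * g = a2 * h = 2 * C\<close> and
  \<open>a1 * N + a2 * M = C * n * (n + 2)\<close>.\<close>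

lemma trace_relation:
  "a1 * (p * (N / n) + g) + a2 * (q * (M / n) + h) = C * ((n + 2) * (n - 1) + 4 + 4 * n - 2 * (N + M)) / n"
proof -
  have "N * p = N - N * g + N * P" using g_eq(2) by algebra
  also have "N * P = g - N / n" using g_eq(1) by simp
  finally have Np: "N * p = N - N * g + (g - N / n)" .
  have "M * q = M - M * h + M * R" using h_eq(2) by algebra
  also have "M * R = h - M / n" using h_eq(1) by simp
  finally have Mq: "M * q = M - M * h + (h - M / n)" .
  have "a1 * N + a2 * M = C * (n * (n + 2))" using n by (simp add: C_def)
  have "a1 * (N * p) = a1 * N * (1 - 1 / n) + a1 * g - a1 * g * N" unfolding Np by (simp add: algebra_simps)
  moreover have "a2 * (M * q) = a2 * M * (1 - 1 / n) + a2 * h - a2 * h * M" unfolding Mq by (simp add: algebra_simps)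
  ultimately have "a1 * (N * p) + a2 * (M * q) = (a1 * N + a2 * M) * (1 - 1 / n) + 4 * C - 2 * C * (N + M)"
    unfolding a1_g a2_h by (simp add: algebra_simps)
  also have "(a1 * N + a2 * M) * (1 - 1 / n) = C * (n + 2) * (n - 1)"
    unfolding \<open>a1 * N + a2 * M = _\<close> using n by (simp add: field_simps)
  finally have "a1 * (N * p) + a2 * (M * q) = C * ((n + 2) * (n - 1) + 4 - 2 * (N + M))" by (simp add: algebra_simps)
  moreover have "n * (a1 * (p * (N / n) + g) + a2 * (q * (M / n) + h)) = a1 * (N * p) + a2 * (M * q) + n * (a1 * g + a2 * h)"
    using n by (simp add: field_simps)
  ultimately have "n * (a1 * (p * (N / n) + g) + a2 * (q * (M / n) + h)) = C * ((n + 2) * (n - 1) + 4 + 4 * n - 2 * (N + M))"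
    unfolding a1_g a2_h by (simp add: algebra_simps)
  then show ?thesis using n by (simp add: nonzero_eq_divide_eq mult.commute)
qed

text \<open>The affine function of \<open>quartic_12\<close> vanishes at both
  \<open>\<gamma>1\<close> and \<open>\<gamma>2\<close>, so its slope is zero. Cancelling
  \<open>s\<close> evaluates the left side of \<open>trace_relation\<close> as
  \<open>2 * C\<close>.\<close>

lemma card_sum_tight:
  assumes "s \<noteq> 0"
  shows "2 * (N + M) = (n + 1) * (n + 2)"
proof -
  define A where "A = s * (a1 * (p * (N / n) + g) + a2 * (q * (M / n) + h) - 2 * C)"
  define B where "B = a1 * (g / n - P * N / n) + a2 * (h / n - R * M / n) - C * (1 + 2 / n)"
  have AB: "A * (x \<bullet> y) + B = 0" if "x \<in> Y1" "y \<in> Y2" for x y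
    unfolding A_def B_def by (rule quartic_12[OF that])
  have "A * \<gamma>1 + B = 0" "A * \<gamma>2 + B = 0" using \<gamma>1 \<gamma>2 AB by blast+
  then have "A * (\<gamma>1 - \<gamma>2) = 0" by algebra
  then have "A = 0" using \<gamma>12 by simp
  then have "a1 * (p * (N / n) + g) + a2 * (q * (M / n) + h) = 2 * C" using assms by (simp add: A_def)
  then have "C * ((n + 2) * (n - 1) + 4 + 4 * n - 2 * (N + M)) = C * (2 * n)"
    unfolding trace_relation using n by (simp add: field_simps)
  then have "(n + 2) * (n - 1) + 4 + 4 * n - 2 * (N + M) = 2 * n" using C_pos by simp
  then show ?thesis by (simp add: algebra_simps)
qed

text \<open>Seen from a point of \<open>Y1\<close>, every squared inner product with
  \<open>Y2\<close> equals \<open>1 / n\<close> when \<open>s = 0\<close>. The cubic sum over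
  \<open>Y2\<close> is then a linear sum and vanishes.\<close>

lemma cubic_zero:
  assumes "s = 0"
  shows "p * (N / n) + g = 0"
proof -
  obtain x where x: "x \<in> Y1" using nonempty by blast
  have "(\<Sum>z\<in>Y1. (x \<bullet> z) ^ 3) = (\<Sum>z\<in>Y1. (1 * (x \<bullet> z) + 0 + 0 * of_bool (z = x)) * (p * (x \<bullet> z) + (- P) + g * of_bool (z = x)))"
    using sq_1[OF x] by (intro sum.cong) (simp_all add: power3_eq_cube power2_eq_square)
  also have "\<dots> = p * (N / n) + g"
    using x spherical_2_designD(3)[OF Y1 x] unfolding spherical_2_design_sum_product[OF Y1] by (simp add: N_def)
  finally have 1: "(\<Sum>z\<in>Y1. (x \<bullet> z) ^ 3) = p * (N / n) + g" .
  have "(\<Sum>z\<in>Y2. (x \<bullet> z) ^ 3) = (\<Sum>z\<in>Y2. (x \<bullet> z) * (1 / n))"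
    using sq_12[OF x] assms by (intro sum.cong) (simp_all add: power3_eq_cube power2_eq_square)
  also have "\<dots> = 0" using spherical_2_designD(4)[OF Y2] by (simp add: sum_distrib_right[symmetric] sum_divide_distrib[symmetric])
  finally have "b1 * (p * (N / n) + g) = 0"
    using cubic[of x] spherical_2_designD(2)[OF Y1 x] 1 by simp
  then show ?thesis using b by simp
qed

lemma cubic_zero_2: "s = 0 \<Longrightarrow> q * (M / n) + h = 0"
  using two_design_pair.cubic_zero[OF swap] by (simp add: two_design_pair.params[OF swap] params)

lemma card_sum_exceptional:
  assumes "s = 0"
  shows "2 * (N + M) = n\<^sup>2 + 5 * n + 2"
proof -
  have "C * ((n + 2) * (n - 1) + 4 + 4 * n - 2 * (N + M)) / n = 0"
    using cubic_zero[OF assms] cubic_zero_2[OF assms] trace_relation by simp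
  then have "(n + 2) * (n - 1) + 4 + 4 * n - 2 * (N + M) = 0" using n C_pos by simp
  then show ?thesis by algebra
qed

text \<open>The cubic equation joins the two expressions of \<open>g_eq\<close>. Given
  \<open>N\<close> and \<open>n\<close>, these three equations are linear in \<open>p\<close>,
  \<open>P\<close> and \<open>g\<close>, so the sizes alone determine the angles.\<close>

lemma angles_exceptional:
  assumes "s = 0"
  shows "p = - (n - 1) / (N - n - 1)" and "P = (2 * n - N) / (n * (N - n - 1))" and "g = (n - 1) * N / (n * (N - n - 1))"
proof -
  have a: "N - n - 1 > 0" using NM by simp
  have pNg: "p * N + n * g = 0" using cubic_zero[OF assms] n by (simp add: field_simps)
  have ng: "n * g = N + n * N * P" using g_eq(1) n by (simp add: algebra_simps)
  then have "N * (p + 1 + n * P) = 0" using pNg by (simp add: algebra_simps)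
  then have p: "p = - 1 - n * P" using NM n by simp
  then have "n * (2 + (n + 1) * P) = N + n * N * P" using g_eq(2) ng by algebra
  then have "P * (n * (N - n - 1)) = 2 * n - N" by (simp add: algebra_simps)
  then show PP: "P = (2 * n - N) / (n * (N - n - 1))" using a n by (simp add: nonzero_eq_divide_eq)
  have "p * (N - n - 1) = - (N - n - 1) - P * (n * (N - n - 1))" unfolding p by (simp add: algebra_simps)
  also have "\<dots> = - (n - 1)" unfolding PP using a n by simp
  finally have pa: "p * (N - n - 1) = - (n - 1)" .
  then show "p = - (n - 1) / (N - n - 1)" using a by (simp add: nonzero_eq_divide_eq)
  have "g * (n * (N - n - 1)) = (n - 1) * N" using pNg pa by algebra
  then show "g = (n - 1) * N / (n * (N - n - 1))" using a n by (simp add: nonzero_eq_divide_eq)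
qed

lemma angles_exceptional_2:
  assumes "s = 0"
  shows "q = - (n - 1) / (M - n - 1)" and "R = (2 * n - M) / (n * (M - n - 1))"
    and "h = (n - 1) * M / (n * (M - n - 1))"
  using two_design_pair.angles_exceptional[OF swap] assms
  by (simp_all add: two_design_pair.params[OF swap] params)

end

section \<open>Integrality\<close>

lemma rational_root_monic_quadratic:
  fixes x :: real
  assumes "x \<in> \<rat>" "x\<^sup>2 = of_int m * x + of_int l"
  shows "x \<in> \<int>"
proof (rule rational_algebraic_int_is_int[OF _ assms(1)])
  show "algebraic_int x"
    unfolding algebraic_int_altdef_ipoly
    by (rule exI[of _ "[:- l, - m, 1:]"]) (use assms(2) in \<open>simp add: map_poly_pCons algebra_simps power2_eq_square\<close>)
qed

text \<open>Here \<open>a\<close> and \<open>b\<close> are the excesses of the class sizes over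
  \<open>n + 1\<close>, and the last equation is \<open>r\<^sup>2 * (\<beta>1 - \<beta>2)\<^sup>2 =
  (2 - \<beta>1 - \<beta>2)\<^sup>2\<close> with denominators cleared.\<close>

lemma exceptional_parameters:
  fixes n a b r :: int
  assumes n: "n \<ge> 3" and a: "a > 0" and ab: "a \<le> b" and sum: "2 * (a + b) = (n - 1) * (n + 2)"
    and r: "odd r" and eq: "r\<^sup>2 * (n * (n - 1)\<^sup>2 - 4 * b * (n - 1) + 4 * b\<^sup>2) = n * (2 * b + n - 1)\<^sup>2"
  shows "\<exists>k\<ge>2. n = (2 * k - 1)\<^sup>2 - 4 \<and> a = 2 * k * (2 * k - 3) * (k\<^sup>2 - k - 1)
    \<and> b = 2 * (k\<^sup>2 - k - 1) * (2 * k + 1) * (k - 1)"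
proof -
  \<comment> \<open>\<open>K\<close> is \<open>n * b\<^sup>2\<close> times the discriminant
    \<open>q\<^sup>2 - 4 * R\<close> of the quadratic with roots \<open>\<beta>1\<close>,
    \<open>\<beta>2\<close>.\<close>
  define K where "K = n * (n - 1)\<^sup>2 - 4 * b * (n - 1) + 4 * b\<^sup>2"
  have K: "K = (2 * b - (n - 1))\<^sup>2 + (n - 1) ^ 3" unfolding K_def by algebra
  have "(n - 1) ^ 3 > 0" using n by simp
  then have Kpos: "K > 0" unfolding K by (simp add: add_nonneg_pos)
  have diff: "(r\<^sup>2 - n) * K = n * (n - 1) * (8 * b - (n - 1)\<^sup>2)"
    using eq unfolding K_def by algebra
  have b6: "6 * b - n * (n - 1) > 0"
  proof -
    have "4 * b \<ge> (n - 1) * (n + 2)" using sum ab by simp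
    then have "2 * (6 * b - n * (n - 1)) \<ge> 3 * ((n - 1) * (n + 2)) - 2 * (n * (n - 1))" by simp
    also have "3 * ((n - 1) * (n + 2)) - 2 * (n * (n - 1)) = (n - 1) * (n + 6)" by algebra
    finally have "2 * (6 * b - n * (n - 1)) \<ge> (n - 1) * (n + 6)" .
    moreover have "0 < (n - 1) * (n + 6)" using n by simp
    ultimately have "0 < 2 * (6 * b - n * (n - 1))" by (rule less_le_trans[rotated])
    then show ?thesis by (simp only: zero_less_mult_iff) simp
  qed
  \<comment> \<open>As a function of \<open>b\<close>, the quotient \<open>(r\<^sup>2 - n)\<close> stays above its value \<open>3\<close> at \<open>a = 0\<close> ...\<close>
  have "(r\<^sup>2 - n - 3) * K = 2 * a * (6 * b - n * (n - 1))"
    using diff sum unfolding K_def by algebra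
  also have "\<dots> > 0" using a b6 by simp
  finally have low: "r\<^sup>2 - n - 3 > 0" using Kpos by (simp add: zero_less_mult_iff)
  \<comment> \<open>... and its maximum is \<open>4 n / (n - 1)\<close>, so it is equal to \<open>4\<close> up to finitely many cases.\<close>
  have "(4 * n - (n - 1) * (r\<^sup>2 - n)) * K = n * (2 * (2 * b - (n - 1)) - (n - 1)\<^sup>2)\<^sup>2"
    using diff unfolding K_def by algebra
  also have "\<dots> \<ge> 0" using n by simp
  finally have up: "(n - 1) * (r\<^sup>2 - n) \<le> 4 * n" using Kpos by (simp add: zero_le_mult_iff)
  have rn: "r\<^sup>2 = n + 4"
  proof (cases "n \<ge> 6")
    case True
    have "r\<^sup>2 - n < 5"
    proof (rule ccontr)
      assume "\<not> r\<^sup>2 - n < 5"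
      then have "(n - 1) * 5 \<le> (n - 1) * (r\<^sup>2 - n)" using n by (intro mult_left_mono) auto
      with up True show False by simp
    qed
    with low show ?thesis by simp
  next
    \<comment> \<open>For \<open>n\<close> equal to 3, 4 or 5 the bounds leave
      \<open>r\<^sup>2 = 9\<close> only. For 3 and 4 the resulting \<open>b\<close> is too small or
      not an integer; for 5 the value is already \<open>n + 4\<close>.\<close>
    case False
    have "r\<^sup>2 = 9" if "6 < r\<^sup>2" "r\<^sup>2 \<le> 10"
    proof -
      have "\<bar>r\<bar> < 4" using that abs_le_square_iff[of 4 r] by (simp add: not_le[symmetric])
      moreover have "odd \<bar>r\<bar>" using r by simp
      then have "\<bar>r\<bar> \<noteq> 0" "\<bar>r\<bar> \<noteq> 2" by (auto simp del: even_abs_add_iff dvd_abs_iff)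
      ultimately have "\<bar>r\<bar> = 1 \<or> \<bar>r\<bar> = 3" by arith
      then have "r = 1 \<or> r = - 1 \<or> r = 3 \<or> r = - 3" by arith
      then have "r\<^sup>2 = 1 \<or> r\<^sup>2 = 9" by (elim disjE) simp_all
      then show ?thesis using that by simp
    qed
    moreover have n345: "n = 3 \<or> n = 4 \<or> n = 5" using n False by arith
    then have "6 < r\<^sup>2" "r\<^sup>2 \<le> 10" using low up by (elim disjE; simp)+
    ultimately consider "n = 3" "r\<^sup>2 = 9" | "n = 4" "r\<^sup>2 = 9" | "n = 5" "r\<^sup>2 = 9"
      using n345 by blast
    then show ?thesis
    proof cases
      case 1
      have "24 * (b - 2)\<^sup>2 = 0" using eq unfolding 1 by algebra
      then show ?thesis using sum ab 1 by simp
    next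
      case 2
      have "4 * ((b - 3) * (5 * b - 24)) = 0" using eq unfolding 2 by algebra
      then have "b = 3 \<or> 5 * b = 24" by simp
      then show ?thesis using sum ab 2 by (elim disjE) (simp, presburger)
    qed simp
  qed
  \<comment> \<open>With \<open>r\<^sup>2 = n + 4\<close> the equation is quadratic in
    \<open>b\<close> and its square can be completed. The base on the left equals
    \<open>2 * (b - a)\<close>, so \<open>a \<le> b\<close> selects the root.\<close>
  have "(4 * b - (n - 1) * (n + 2))\<^sup>2 = ((n - 1) * r)\<^sup>2"
    using diff rn unfolding K_def by algebra
  moreover have "4 * b - (n - 1) * (n + 2) \<ge> 0" using sum ab by simp
  ultimately have b4: "4 * b - (n - 1) * (n + 2) = (n - 1) * \<bar>r\<bar>"
    using n by (simp only: power2_eq_iff abs_eq_iff[symmetric] abs_mult abs_of_nonneg diff_ge_0_iff_ge)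
  have "odd \<bar>r\<bar>" using r by simp
  then obtain j where "\<bar>r\<bar> = 2 * j + 1" by (elim oddE)
  then obtain k where k: "\<bar>r\<bar> = 2 * k - 1" using that[of "j + 1"] by simp
  have nk: "n = (2 * k - 1)\<^sup>2 - 4" using rn unfolding k[symmetric] by simp
  have k2: "k \<ge> 2"
  proof (rule ccontr)
    assume "\<not> k \<ge> 2"
    then have "2 * k - 1 \<le> 1" by simp
    moreover have "2 * k - 1 \<ge> 0" using k by simp
    ultimately have "(2 * k - 1)\<^sup>2 \<le> 1" by (simp add: abs_square_le_1)
    then show False using nk n by simp
  qed
  have "4 * b = 4 * (2 * (k\<^sup>2 - k - 1) * (2 * k + 1) * (k - 1))"
    using b4 unfolding k nk by algebra
  moreover from this have "4 * a = 4 * (2 * k * (2 * k - 3) * (k\<^sup>2 - k - 1))"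
    using sum unfolding nk by algebra
  ultimately show ?thesis using k2 nk by auto
qed

text \<open>
  \<open>- (r + 1) / 2\<close> is the eigenvalue, on the complement of the constant and linear functions, of the graph
  on \<open>Y\<close> whose edges are the pairs with inner product \<open>\<beta>1\<close>.
\<close>

lemma spherical_2_design_odd_eigenvalue:
  fixes Y :: "'a::real_inner set"
  assumes Y: "spherical_2_design n Y" and n: "n > 1"
    and \<beta>: "\<And>x y. x \<in> Y \<Longrightarrow> y \<in> Y \<Longrightarrow> x \<noteq> y \<Longrightarrow> x \<bullet> y = \<beta>1 \<or> x \<bullet> y = \<beta>2"
    and \<beta>1: "\<exists>x\<in>Y. \<exists>y\<in>Y. x \<noteq> y \<and> x \<bullet> y = \<beta>1" and \<beta>2: "\<exists>x\<in>Y. \<exists>y\<in>Y. x \<noteq> y \<and> x \<bullet> y = \<beta>2"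
    and "\<beta>1 > \<beta>2" and rat: "\<beta>1 + \<beta>2 \<in> \<rat>" and nc: "(real (card Y) - 1) * (\<beta>1 + \<beta>2) \<noteq> - 2"
  shows "\<exists>r :: int. odd r \<and> of_int r * (\<beta>1 - \<beta>2) = 2 - (\<beta>1 + \<beta>2)"
proof -
  note D = spherical_2_designD[OF Y]
  define N where "N = real (card Y)"
  define d where "d = \<beta>1 - \<beta>2"
  have d: "d > 0" using \<open>\<beta>1 > \<beta>2\<close> by (simp add: d_def)
  define adj where "adj x y \<longleftrightarrow> x \<noteq> y \<and> x \<bullet> y = \<beta>1" for x y :: 'a
  \<comment> \<open>The adjacency matrix as a combination of Gram matrix, all-one matrix and
    identity. On the complement of constants and linear functions only the identity term acts, with
    value \<open>- (1 - \<beta>2)\<close>.\<close>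
  have adj: "d * of_bool (adj x z) = 1 * (x \<bullet> z) + (- \<beta>2) + (- (1 - \<beta>2)) * of_bool (z = x)"
    if "x \<in> Y" "z \<in> Y" for x z
    using \<beta>[OF that] D(3)[OF that(1)] \<open>\<beta>1 > \<beta>2\<close> by (auto simp: adj_def d_def)
  have count: "d\<^sup>2 * real (card {z \<in> Y. adj x z \<and> adj y z})
      = (N / n - 2 * (1 - \<beta>2)) * (x \<bullet> y) + N * \<beta>2\<^sup>2 + 2 * (1 - \<beta>2) * \<beta>2 + (1 - \<beta>2)\<^sup>2 * of_bool (x = y)"
    if xy: "x \<in> Y" "y \<in> Y" for x y
  proof -
    have "d\<^sup>2 * real (card {z \<in> Y. adj x z \<and> adj y z}) = d\<^sup>2 * (\<Sum>z\<in>Y. of_bool (adj x z \<and> adj y z))"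
      using D(1) by (simp add: of_bool_def sum.If_cases Int_def)
    also have "\<dots> = (\<Sum>z\<in>Y. (d * of_bool (adj x z)) * (d * of_bool (adj y z)))"
      unfolding sum_distrib_left by (rule sum.cong) (auto simp: power2_eq_square)
    also have "\<dots> = (\<Sum>z\<in>Y. (1 * (x \<bullet> z) + (- \<beta>2) + (- (1 - \<beta>2)) * of_bool (z = x))
        * (1 * (y \<bullet> z) + (- \<beta>2) + (- (1 - \<beta>2)) * of_bool (z = y)))"
      by (intro sum.cong refl arg_cong2[where f = "(*)"] adj xy)
    also have "\<dots> = (N / n - 2 * (1 - \<beta>2)) * (x \<bullet> y) + N * \<beta>2\<^sup>2 + 2 * (1 - \<beta>2) * \<beta>2 + (1 - \<beta>2)\<^sup>2 * of_bool (x = y)"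
      using xy unfolding spherical_2_design_sum_product[OF Y]
      by (auto simp: N_def power2_eq_square algebra_simps)
    finally show ?thesis .
  qed
  obtain x1 y1 where 1: "x1 \<in> Y" "y1 \<in> Y" "x1 \<noteq> y1" "x1 \<bullet> y1 = \<beta>1" using \<beta>1 by blast
  obtain x2 y2 where 2: "x2 \<in> Y" "y2 \<in> Y" "x2 \<noteq> y2" "x2 \<bullet> y2 = \<beta>2" using \<beta>2 by blast
  \<comment> \<open>Common neighbours of a pair with inner product \<open>\<beta>1\<close>, of a
    pair with \<open>\<beta>2\<close>, and the valency: the parameters of the strongly regular
    graph.\<close>
  define c1 c2 c0 where "c1 = card {z \<in> Y. adj x1 z \<and> adj y1 z}"
    and "c2 = card {z \<in> Y. adj x2 z \<and> adj y2 z}" and "c0 = card {z \<in> Y. adj x1 z \<and> adj x1 z}"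
  define L where "L = N / n - 2 * (1 - \<beta>2)"
  define B where "B = N * \<beta>2\<^sup>2 + 2 * (1 - \<beta>2) * \<beta>2"
  have e1: "d\<^sup>2 * real c1 = L * \<beta>1 + B" using count[OF 1(1,2)] 1 by (simp add: c1_def L_def B_def)
  have e2: "d\<^sup>2 * real c2 = L * \<beta>2 + B" using count[OF 2(1,2)] 2 by (simp add: c2_def L_def B_def)
  have e0: "d\<^sup>2 * real c0 = L + B + (1 - \<beta>2)\<^sup>2"
    using count[OF 1(1,1)] D(3)[OF 1(1)] by (simp add: c0_def L_def B_def)
  \<comment> \<open>\<open>- \<theta>\<close> is the eigenvalue in question, and \<open>quad\<close>
    is the usual quadratic equation of a strongly regular graph for it.\<close>
  define \<theta> where "\<theta> = (1 - \<beta>2) / d"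
  have \<theta>: "\<theta> * d = 1 - \<beta>2" using d by (simp add: \<theta>_def)
  have "d * (d * (real c1 - real c2)) = d * L" using e1 e2 unfolding d_def by algebra
  then have L: "d * (real c1 - real c2) = L" using d by simp
  have "d\<^sup>2 * (\<theta>\<^sup>2 + (real c1 - real c2) * \<theta> - (real c0 - real c2)) = 0"
    using e0 e2 L \<theta> by algebra
  then have "\<theta>\<^sup>2 + (real c1 - real c2) * \<theta> - (real c0 - real c2) = 0"
    using d by (metis mult_eq_0_iff power_eq_0_iff less_irrefl)
  then have quad: "\<theta>\<^sup>2 = of_int (int c2 - int c1) * \<theta> + of_int (int c0 - int c2)"
    by (simp add: algebra_simps)
  \<comment> \<open>The zero sum at \<open>x1\<close> is a linear equation for the angles with
    integer coefficients \<open>k1\<close> and \<open>k2\<close>. Together with the rational sum of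
    the angles it determines \<open>\<beta>1\<close> unless \<open>k1 = k2\<close>, and that case is
    what \<open>nc\<close> excludes.\<close>
  have "\<beta>1 \<in> \<rat>"
  proof -
    define k1 k2 where "k1 = real (card {z \<in> Y - {x1}. x1 \<bullet> z = \<beta>1})"
      and "k2 = real (card {z \<in> Y - {x1}. x1 \<bullet> z \<noteq> \<beta>1})"
    have "0 = 1 + (\<Sum>z\<in>Y - {x1}. x1 \<bullet> z)"
      using D(4)[of x1] D(3)[OF 1(1)] sum.remove[OF D(1) 1(1), of "\<lambda>z. x1 \<bullet> z"] by simp
    also have "(\<Sum>z\<in>Y - {x1}. x1 \<bullet> z) = (\<Sum>z\<in>Y - {x1}. if x1 \<bullet> z = \<beta>1 then \<beta>1 else \<beta>2)"
      by (rule sum.cong) (use \<beta>[OF 1(1)] in auto)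
    also have "\<dots> = k1 * \<beta>1 + k2 * \<beta>2"
      using D(1) by (simp add: sum.If_cases k1_def k2_def Int_def)
    finally have k\<beta>: "k1 * \<beta>1 + k2 * \<beta>2 = - 1" by simp
    have "card (Y - {x1}) = card ({z \<in> Y - {x1}. x1 \<bullet> z = \<beta>1} \<union> {z \<in> Y - {x1}. x1 \<bullet> z \<noteq> \<beta>1})"
      by (rule arg_cong[where f = card]) auto
    also have "\<dots> = card {z \<in> Y - {x1}. x1 \<bullet> z = \<beta>1} + card {z \<in> Y - {x1}. x1 \<bullet> z \<noteq> \<beta>1}"
      using D(1) by (intro card_Un_disjoint) auto
    finally have k: "k1 + k2 = N - 1"
      using 1(1) D(1) card_gt_0_iff[of Y] by (auto simp: k1_def k2_def N_def of_nat_diff Suc_le_eq)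
    have "k1 \<noteq> k2"
    proof
      assume "k1 = k2"
      then have "N - 1 = 2 * k1" "k1 * (\<beta>1 + \<beta>2) = - 1" using k k\<beta> by (simp_all add: algebra_simps)
      then have "(N - 1) * (\<beta>1 + \<beta>2) = - 2" by simp
      then show False using nc by (simp add: N_def)
    qed
    moreover have "(k1 - k2) * \<beta>1 = - 1 - k2 * (\<beta>1 + \<beta>2)" using k\<beta> by algebra
    ultimately have "\<beta>1 = (- 1 - k2 * (\<beta>1 + \<beta>2)) / (k1 - k2)" by (simp add: nonzero_eq_divide_eq mult.commute)
    moreover have "(- 1 - k2 * (\<beta>1 + \<beta>2)) / (k1 - k2) \<in> \<rat>"
      using rat by (intro Rats_divide Rats_diff Rats_mult) (auto simp: k1_def k2_def)
    ultimately show ?thesis by simp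
  qed
  moreover have "\<beta>2 = (\<beta>1 + \<beta>2) - \<beta>1" by simp
  ultimately have "\<beta>2 \<in> \<rat>" using rat by (metis Rats_diff)
  have "\<theta> \<in> \<rat>" unfolding \<theta>_def d_def using \<open>\<beta>1 \<in> \<rat>\<close> \<open>\<beta>2 \<in> \<rat>\<close> by (intro Rats_divide Rats_diff) auto
  then have "\<theta> \<in> \<int>" using quad by (rule rational_root_monic_quadratic)
  then obtain m where m: "\<theta> = of_int m" by (elim Ints_cases)
  show ?thesis
  proof (intro exI[of _ "2 * m - 1"] conjI)
    have "of_int (2 * m - 1) = 2 * \<theta> - 1" by (simp add: m)
    then show "of_int (2 * m - 1) * (\<beta>1 - \<beta>2) = 2 - (\<beta>1 + \<beta>2)"
      using \<theta> unfolding d_def by algebra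
  qed simp
qed

section \<open>Explicit parameters in the case \<open>s = 0\<close>\<close>

lemma ordered_pair_unique:
  fixes a b c d :: real
  assumes "a + b = c + d" "a * b = c * d" "a > b" "c > d"
  shows "a = c" "b = d"
proof -
  have "(a - c) * (a - d) = 0" using assms(1,2) by algebra
  then show "a = c" using assms by auto
  then show "b = d" using assms(1) by simp
qed

text \<open>Integrality is used for the graph on \<open>Y2\<close> only; the sizes it yields fix all
  other parameters. Angles are recovered from their sums and products, the ratio of the weights from
  \<open>a1 * g = a2 * h\<close>.\<close>

lemma (in two_design_pair) exceptional_values:
  fixes m :: nat
  assumes "s = 0" and m: "n = real m" "m \<ge> 3" and "card Y1 \<le> card Y2"
  shows "\<exists>k\<ge>2. int m = (2 * k - 1)\<^sup>2 - 4 \<and> int (card Y1) = 2 * (2 * k + 1) * (k - 1) ^ 3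
    \<and> int (card Y2) = 2 * k ^ 3 * (2 * k - 3)
    \<and> \<alpha>1 = (real_of_int k - 2) / (real_of_int k * (2 * real_of_int k - 3))
    \<and> \<alpha>2 = - (1 / (2 * real_of_int k - 3))
    \<and> \<beta>1 = 1 / (2 * real_of_int k + 1)
    \<and> \<beta>2 = - ((real_of_int k + 1) / ((real_of_int k - 1) * (2 * real_of_int k + 1)))
    \<and> a2 = a1 * (((2 * real_of_int k + 1)\<^sup>2 * (real_of_int k - 1) ^ 4) / ((2 * real_of_int k - 3)\<^sup>2 * real_of_int k ^ 4))"
proof -
  define ia ib where "ia = int (card Y1) - int m - 1" and "ib = int (card Y2) - int m - 1"
  have ra: "real_of_int ia = N - n - 1" and rb: "real_of_int ib = M - n - 1"
    by (simp_all add: ia_def ib_def N_def M_def m(1))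
  have pos: "N - n - 1 > 0" "M - n - 1 > 0" using NM by simp_all
  then have "ia > 0" using ra by simp
  have "ia \<le> ib" using assms(4) by (simp add: ia_def ib_def)
  have pa: "p * (N - n - 1) = - (n - 1)" and Pa: "P * (n * (N - n - 1)) = 2 * n - N"
    and ga: "g * (n * (N - n - 1)) = (n - 1) * N"
    unfolding angles_exceptional[OF \<open>s = 0\<close>] using pos n by simp_all
  have qb: "q * (M - n - 1) = - (n - 1)" and Rb: "R * (n * (M - n - 1)) = 2 * n - M"
    and hb: "h * (n * (M - n - 1)) = (n - 1) * M"
    unfolding angles_exceptional_2[OF \<open>s = 0\<close>] using pos n by simp_all
  have "real_of_int (2 * (ia + ib)) = real_of_int ((int m - 1) * (int m + 2))"
    using card_sum_exceptional[OF \<open>s = 0\<close>] by (simp add: ra rb m(1) algebra_simps power2_eq_square)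
  then have sum: "2 * (ia + ib) = (int m - 1) * (int m + 2)" by (simp only: of_int_eq_iff)
  have "q = real_of_int (1 - int m) / real_of_int ib"
    using qb pos(2) by (simp add: rb m(1) nonzero_eq_divide_eq)
  then have "q \<in> \<rat>" by (simp add: Rats_divide del: of_int_diff)
  \<comment> \<open>Equality would mean that both inner products occur equally often from each
    point; substituting the value of \<open>q\<close> makes this impossible for
    \<open>n \<ge> 3\<close>.\<close>
  moreover have "(M - 1) * q \<noteq> - 2"
  proof
    assume "(M - 1) * q = - 2"
    then have "M * (n - 3) + (n + 3) = 0" using qb by algebra
    moreover have "M * (n - 3) \<ge> 0" using NM n m by (intro mult_nonneg_nonneg) auto
    ultimately show False using n by simp
  qed
  ultimately obtain r :: int where r: "odd r" "of_int r * (\<beta>1 - \<beta>2) = 2 - q"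
    using spherical_2_design_odd_eigenvalue[OF Y2 n \<beta> \<beta>1 \<beta>2 \<beta>12] by (auto simp: q_def M_def)
  have "(of_int r)\<^sup>2 * (q\<^sup>2 - 4 * R) = (2 - q)\<^sup>2"
    using r(2) unfolding q_def R_def by algebra
  then have "(of_int r)\<^sup>2 * (n * (n - 1)\<^sup>2 - 4 * (M - n - 1) * (n - 1) + 4 * (M - n - 1)\<^sup>2)
      = n * (2 * (M - n - 1) + n - 1)\<^sup>2"
    using qb Rb by algebra
  then have "real_of_int (r\<^sup>2 * (int m * (int m - 1)\<^sup>2 - 4 * ib * (int m - 1) + 4 * ib\<^sup>2))
      = real_of_int (int m * (2 * ib + int m - 1)\<^sup>2)"
    by (simp add: rb m(1))
  then have eq: "r\<^sup>2 * (int m * (int m - 1)\<^sup>2 - 4 * ib * (int m - 1) + 4 * ib\<^sup>2) = int m * (2 * ib + int m - 1)\<^sup>2"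
    by (simp only: of_int_eq_iff)
  obtain k where k: "k \<ge> 2" and mk: "int m = (2 * k - 1)\<^sup>2 - 4" and ak: "ia = 2 * k * (2 * k - 3) * (k\<^sup>2 - k - 1)"
    and bk: "ib = 2 * (k\<^sup>2 - k - 1) * (2 * k + 1) * (k - 1)"
    using exceptional_parameters[OF _ \<open>ia > 0\<close> \<open>ia \<le> ib\<close> sum r(1) eq] m(2) by auto
  have N1: "int (card Y1) = 2 * (2 * k + 1) * (k - 1) ^ 3"
  proof -
    have "int (card Y1) = ia + int m + 1" by (simp add: ia_def)
    then show ?thesis unfolding ak mk by algebra
  qed
  have N2: "int (card Y2) = 2 * k ^ 3 * (2 * k - 3)"
  proof -
    have "int (card Y2) = ib + int m + 1" by (simp add: ib_def)
    then show ?thesis unfolding bk mk by algebra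
  qed
  define x where "x = real_of_int k"
  \<comment> \<open>\<open>D\<close> divides \<open>n - 1\<close> and both excesses
    \<open>N - n - 1\<close>, \<open>M - n - 1\<close>; it cancels from every parameter.\<close>
  define D where "D = x\<^sup>2 - x - 1"
  have x: "x \<ge> 2" using k by (simp add: x_def)
  then have "x * (x - 1) \<ge> 2 * 1" by (intro mult_mono) auto
  then have D: "D > 0" by (simp add: D_def power2_eq_square algebra_simps)
  have nx: "n = (2 * x - 3) * (2 * x + 1)"
  proof -
    have "n = real_of_int (int m)" by (simp add: m)
    also have "\<dots> = (2 * x - 1)\<^sup>2 - 4" unfolding mk by (simp add: x_def)
    finally show ?thesis by algebra
  qed
  have n1: "n - 1 = 4 * D" unfolding nx D_def by algebra
  have ax: "N - n - 1 = 2 * x * (2 * x - 3) * D" unfolding ra[symmetric] ak by (simp add: x_def D_def)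
  have bx: "M - n - 1 = 2 * D * (2 * x + 1) * (x - 1)" unfolding rb[symmetric] bk by (simp add: x_def D_def)
  have Nx: "N = 2 * (2 * x + 1) * (x - 1) ^ 3"
  proof -
    have "N = real_of_int (int (card Y1))" by (simp add: N_def)
    also have "\<dots> = 2 * (2 * x + 1) * (x - 1) ^ 3" unfolding N1 by (simp add: x_def)
    finally show ?thesis .
  qed
  have Mx: "M = 2 * x ^ 3 * (2 * x - 3)"
  proof -
    have "M = real_of_int (int (card Y2))" by (simp add: M_def)
    also have "\<dots> = 2 * x ^ 3 * (2 * x - 3)" unfolding N2 by (simp add: x_def)
    finally show ?thesis .
  qed
  have nz: "x \<noteq> 0" "2 * x - 3 \<noteq> 0" "2 * x + 1 \<noteq> 0" "x - 1 \<noteq> 0" "D \<noteq> 0" using x D by auto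
  \<comment> \<open>The factor \<open>c\<close> collects what has to be cancelled, so that each
    equation can be checked as a polynomial identity before dividing.\<close>
  have solve: "y = - e / d" if "c * (y * d + e) = 0" "c \<noteq> 0" "d \<noteq> 0" for c y d e :: real
  proof -
    have "y * d = - e" using that(1,2) by simp
    then show ?thesis using that(3) by (metis nonzero_mult_div_cancel_right)
  qed
  have "2 * D * (p * (x * (2 * x - 3)) + 2) = 0" using pa n1 ax by algebra
  then have px: "p = - 2 / (x * (2 * x - 3))" by (rule solve) (use nz in auto)
  have "2 * D * (2 * x + 1) * (P * (x * (2 * x - 3)\<^sup>2) + (x - 2)) = 0"
    using Pa n1 ax nx by algebra
  then have Px: "P = - (x - 2) / (x * (2 * x - 3)\<^sup>2)" by (rule solve) (use nz in auto)
  have "2 * D * (q * ((2 * x + 1) * (x - 1)) + 2) = 0" using qb n1 bx by algebra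
  then have qx: "q = - 2 / ((2 * x + 1) * (x - 1))" by (rule solve) (use nz in auto)
  have "2 * D * (2 * x - 3) * (R * ((2 * x + 1)\<^sup>2 * (x - 1)) + (x + 1)) = 0"
    using Rb n1 bx nx by algebra
  then have Rx: "R = - (x + 1) / ((2 * x + 1)\<^sup>2 * (x - 1))" by (rule solve) (use nz in auto)
  have \<alpha>x: "\<alpha>1 = (x - 2) / (x * (2 * x - 3))" "\<alpha>2 = - (1 / (2 * x - 3))"
  proof -
    have "1 / (2 * x - 3) = x / (x * (2 * x - 3))" using nz by simp
    then have "(x - 2) / (x * (2 * x - 3)) + - (1 / (2 * x - 3)) = (x - 2 - x) / (x * (2 * x - 3))"
      by (simp only: diff_divide_distrib)
    then have 1: "\<alpha>1 + \<alpha>2 = (x - 2) / (x * (2 * x - 3)) + - (1 / (2 * x - 3))"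
      using px by (simp add: p_def)
    have 2: "\<alpha>1 * \<alpha>2 = (x - 2) / (x * (2 * x - 3)) * - (1 / (2 * x - 3))"
    proof -
      have "u / (x * y) * - (1 / y) = - u / (x * y\<^sup>2)" for u y :: real by (simp add: power2_eq_square)
      then show ?thesis using Px by (simp only: P_def)
    qed
    have "(x - 2) / (x * (2 * x - 3)) \<ge> 0" "1 / (2 * x - 3) > 0" using x by auto
    then have 3: "(x - 2) / (x * (2 * x - 3)) > - (1 / (2 * x - 3))" by linarith
    show "\<alpha>1 = (x - 2) / (x * (2 * x - 3))" "\<alpha>2 = - (1 / (2 * x - 3))"
      by (rule ordered_pair_unique[OF 1 2 \<alpha>12 3])+
  qed
  have \<beta>x: "\<beta>1 = 1 / (2 * x + 1)" "\<beta>2 = - ((x + 1) / ((x - 1) * (2 * x + 1)))"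
  proof -
    have "1 / (2 * x + 1) = (x - 1) / ((x - 1) * (2 * x + 1))" using nz by simp
    then have "1 / (2 * x + 1) + - ((x + 1) / ((x - 1) * (2 * x + 1))) = (x - 1 - (x + 1)) / ((x - 1) * (2 * x + 1))"
      by (simp only: diff_divide_distrib)
    then have 1: "\<beta>1 + \<beta>2 = 1 / (2 * x + 1) + - ((x + 1) / ((x - 1) * (2 * x + 1)))"
      using qx by (simp add: q_def mult.commute)
    have 2: "\<beta>1 * \<beta>2 = 1 / (2 * x + 1) * - ((x + 1) / ((x - 1) * (2 * x + 1)))"
    proof -
      have "1 / y * - (u / (z * y)) = - u / (y\<^sup>2 * z)" for u y z :: real by (simp add: power2_eq_square mult_ac)
      then show ?thesis using Rx by (simp only: R_def)
    qed
    have "(x + 1) / ((x - 1) * (2 * x + 1)) > 0" "1 / (2 * x + 1) > 0" using x by auto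
    then have 3: "1 / (2 * x + 1) > - ((x + 1) / ((x - 1) * (2 * x + 1)))" by linarith
    show "\<beta>1 = 1 / (2 * x + 1)" "\<beta>2 = - ((x + 1) / ((x - 1) * (2 * x + 1)))"
      by (rule ordered_pair_unique[OF 1 2 \<beta>12 3])+
  qed
  \<comment> \<open>The ratio of the weights is \<open>g / h\<close>, evaluated through
    \<open>ga\<close> and \<open>hb\<close> without fractions.\<close>
  have "(n - 1) * (a2 * (M * (N - n - 1))) = a2 * (N - n - 1) * ((n - 1) * M)" by (simp only: mult_ac)
  also have "\<dots> = (a2 * h) * (n * (N - n - 1) * (M - n - 1))" unfolding hb[symmetric] by (simp only: mult_ac)
  also have "a2 * h = a1 * g" using a1_g a2_h by simp
  also have "(a1 * g) * (n * (N - n - 1) * (M - n - 1)) = a1 * (M - n - 1) * (g * (n * (N - n - 1)))" by (simp only: mult_ac)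
  also have "\<dots> = (n - 1) * (a1 * (N * (M - n - 1)))" unfolding ga by (simp only: mult_ac)
  finally have "a2 * (M * (N - n - 1)) = a1 * (N * (M - n - 1))" using n by simp
  moreover have "M * (N - n - 1) = 4 * D * ((2 * x - 3)\<^sup>2 * x ^ 4)"
  proof -
    have "2 * x ^ 3 * y * (2 * x * y * D) = 4 * D * (y\<^sup>2 * x ^ 4)" for y
      by (simp add: power2_eq_square power3_eq_cube power4_eq_xxxx)
    then show ?thesis unfolding ax Mx .
  qed
  moreover have "N * (M - n - 1) = 4 * D * ((2 * x + 1)\<^sup>2 * (x - 1) ^ 4)"
  proof -
    have "2 * y * z ^ 3 * (2 * D * y * z) = 4 * D * (y\<^sup>2 * z ^ 4)" for y z
      by (simp add: power2_eq_square power3_eq_cube power4_eq_xxxx)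
    then show ?thesis unfolding bx Nx .
  qed
  ultimately have "4 * D * (a2 * ((2 * x - 3)\<^sup>2 * x ^ 4)) = 4 * D * (a1 * ((2 * x + 1)\<^sup>2 * (x - 1) ^ 4))"
    by (simp only: mult_ac)
  then have "a2 * ((2 * x - 3)\<^sup>2 * x ^ 4) = a1 * ((2 * x + 1)\<^sup>2 * (x - 1) ^ 4)"
    using nz by (metis mult_cancel_left mult_eq_0_iff zero_neq_numeral)
  then have "a2 = a1 * (((2 * x + 1)\<^sup>2 * (x - 1) ^ 4) / ((2 * x - 3)\<^sup>2 * x ^ 4))"
    using nz by (simp add: nonzero_eq_divide_eq)
  then show ?thesis using k mk N1 N2 \<alpha>x \<beta>x unfolding x_def by blast
qed

text \<open>The sizes add up to 8 and both exceed 3, hence both are 4, and the general formulas for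
  \<open>s = 0\<close> give the angles of a square.\<close>

lemma (in two_design_pair) planar_values:
  assumes "s = 0" and "n = 2"
  shows "card Y1 = 4" "card Y2 = 4" "\<alpha>1 = 0" "\<alpha>2 = - 1" "\<beta>1 = 0" "\<beta>2 = - 1" "a1 = a2"
proof -
  have "N + M = 8" using card_sum_exceptional[OF \<open>s = 0\<close>] \<open>n = 2\<close> by simp
  then have "card Y1 + card Y2 = 8" by (simp add: N_def M_def flip: of_nat_add)
  moreover have "card Y1 > 3" "card Y2 > 3" using NM \<open>n = 2\<close> by (simp_all add: N_def M_def)
  ultimately show c: "card Y1 = 4" "card Y2 = 4" by simp_all
  then have NM4: "N = 4" "M = 4" by (simp_all add: N_def M_def)
  note 1 = angles_exceptional[OF \<open>s = 0\<close>, unfolded NM4 \<open>n = 2\<close>]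
  note 2 = angles_exceptional_2[OF \<open>s = 0\<close>, unfolded NM4 \<open>n = 2\<close>]
  show "\<alpha>1 = 0" "\<alpha>2 = - 1"
    using ordered_pair_unique[of \<alpha>1 \<alpha>2 0 "- 1"] 1(1,2) \<alpha>12 by (simp_all add: p_def P_def)
  show "\<beta>1 = 0" "\<beta>2 = - 1"
    using ordered_pair_unique[of \<beta>1 \<beta>2 0 "- 1"] 2(1,2) \<beta>12 by (simp_all add: q_def R_def)
  show "a1 = a2" using a1_g a2_h 1(3) 2(3) by simp
qed

section \<open>Normalization and similarity\<close>

lemma polynomial_norm_square: "polynomial_of_degree_le 2 (\<lambda>x :: real^'n. x \<bullet> x)"
  unfolding inner_vec_def inner_real_def
  using polynomial_mult[OF polynomial_component polynomial_component]
  by (intro polynomial_sum) (simp add: numeral_2_eq_2)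

lemma sphere_average_norm_square_mult:
  fixes f :: "real^'n \<Rightarrow> real"
  assumes r: "r > 0" and f: "continuous_on UNIV f"
  shows "sphere_average r (\<lambda>x. (x \<bullet> x) * f x) = r\<^sup>2 * sphere_average r f"
proof -
  have "sphere_average r (\<lambda>x. (x \<bullet> x) * f x) = sphere_average r (\<lambda>x. r\<^sup>2 * f x)"
    by (rule sphere_average_cong[OF r]) (auto intro!: continuous_intros f simp: dot_square_norm)
  then show ?thesis by (simp add: sphere_average_scale[OF r f])
qed

text \<open>The determinant of the system is a nonzero multiple of
  \<open>r2\<^sup>2 - r1\<^sup>2\<close>; the second equation comes from testing with the extra
  factor \<open>x \<bullet> x\<close>.\<close>

lemma separate_spheres:
  fixes r1 r2 :: real
  assumes "r1 > 0" "r2 > 0" "r1 \<noteq> r2" "c1 > 0" "c2 > 0"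
    and "c1 * A + c2 * B = 0" "c1 * r1\<^sup>2 * A + c2 * r2\<^sup>2 * B = 0"
  shows "A = 0" "B = 0"
proof -
  have r: "r1\<^sup>2 - r2\<^sup>2 \<noteq> 0" using assms(1-3) by (simp add: power2_eq_iff_nonneg)
  have "c1 * (r1\<^sup>2 - r2\<^sup>2) * A = 0" "c2 * (r1\<^sup>2 - r2\<^sup>2) * B = 0" using assms(6,7) by algebra+
  then show "A = 0" "B = 0" using r assms(4,5) by auto
qed

definition normalized :: "real \<Rightarrow> (real^'n) set \<Rightarrow> (real^'n) set" where
  "normalized r X = (\<lambda>x. (1 / r) *\<^sub>R x) ` X"

lemma normalized_facts:
  assumes r: "r > 0" and X: "finite X" "X \<subseteq> sphere 0 r"
  shows "finite (normalized r X)" "card (normalized r X) = card X"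
    "\<And>z. z \<in> normalized r X \<Longrightarrow> norm z = 1" "(\<Sum>x\<in>X. F x) = (\<Sum>z\<in>normalized r X. F (r *\<^sub>R z))"
proof -
  have inj: "inj_on (\<lambda>x. (1 / r) *\<^sub>R x) X" using r by (simp add: inj_on_def)
  show "finite (normalized r X)" using X by (simp add: normalized_def)
  show "card (normalized r X) = card X" unfolding normalized_def by (rule card_image[OF inj])
  show "norm z = 1" if "z \<in> normalized r X" for z
    using that X(2) r by (auto simp: normalized_def)
  show "(\<Sum>x\<in>X. F x) = (\<Sum>z\<in>normalized r X. F (r *\<^sub>R z))"
    unfolding normalized_def using r by (simp add: sum.reindex[OF inj])
qed

text \<open>Linear and quadratic test polynomials admit the factor \<open>x \<bullet> x\<close>
  within degree 4, so their defects vanish on each sphere separately. Cubes and products of squares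
  do not, which is why the last two identities couple the spheres.\<close>

lemma euclidean_4_design_normalized:
  fixes X1 X2 :: "(real^'n) set"
  assumes design: "euclidean_design 4 r1 r2 X1 X2 w" and r: "r1 > 0" "r2 > 0"
    and w1: "\<And>x. x \<in> X1 \<Longrightarrow> w x = w1" and w2: "\<And>x. x \<in> X2 \<Longrightarrow> w x = w2"
  defines "n \<equiv> real CARD('n)" and "Y1 \<equiv> normalized r1 X1" and "Y2 \<equiv> normalized r2 X2"
  shows "spherical_2_design n Y1" "spherical_2_design n Y2"
    "(w1 * r1 ^ 3) * (\<Sum>z\<in>Y1. (x \<bullet> z) ^ 3) + (w2 * r2 ^ 3) * (\<Sum>z\<in>Y2. (x \<bullet> z) ^ 3) = 0"
    "norm x = 1 \<Longrightarrow> norm y = 1 \<Longrightarrow>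
       (w1 * r1 ^ 4) * (\<Sum>z\<in>Y1. (x \<bullet> z)\<^sup>2 * (y \<bullet> z)\<^sup>2) + (w2 * r2 ^ 4) * (\<Sum>z\<in>Y2. (x \<bullet> z)\<^sup>2 * (y \<bullet> z)\<^sup>2)
       = ((w1 * r1 ^ 4) * real (card Y1) + (w2 * r2 ^ 4) * real (card Y2)) / (n * (n + 2)) * (1 + 2 * (x \<bullet> y)\<^sup>2)"
proof -
  have sup: "supported_by_two_spheres r1 r2 X1 X2 w"
    and des: "\<And>f. polynomial_of_degree_le 4 f \<Longrightarrow>
        (\<Sum>x\<in>X1. w x) * sphere_average r1 f + (\<Sum>x\<in>X2. w x) * sphere_average r2 f = (\<Sum>u\<in>X1 \<union> X2. w u * f u)"
    using design by (auto simp: euclidean_design_def)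
  have fin: "finite X1" "finite X2" and S: "X1 \<subseteq> sphere 0 r1" "X2 \<subseteq> sphere 0 r2" and dis: "X1 \<inter> X2 = {}"
    and ne: "X1 \<noteq> {}" "X2 \<noteq> {}" and r12: "r1 \<noteq> r2" and wpos: "\<And>x. x \<in> X1 \<union> X2 \<Longrightarrow> w x > 0"
    using sup by (auto simp: supported_by_two_spheres_def)
  have w: "w1 > 0" "w2 > 0" using ne wpos w1 w2 by (metis Un_iff ex_in_conv)+
  note F1 = normalized_facts[OF r(1) fin(1) S(1), folded Y1_def]
  note F2 = normalized_facts[OF r(2) fin(2) S(2), folded Y2_def]
  define N1 N2 where "N1 = real (card Y1)" and "N2 = real (card Y2)"
  have D: "w1 * (\<Sum>z\<in>Y1. f (r1 *\<^sub>R z)) + w2 * (\<Sum>z\<in>Y2. f (r2 *\<^sub>R z))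
      = w1 * N1 * sphere_average r1 f + w2 * N2 * sphere_average r2 f"
    if "polynomial_of_degree_le 4 f" for f
  proof -
    have "(\<Sum>u\<in>X1 \<union> X2. w u * f u) = (\<Sum>u\<in>X1. w1 * f u) + (\<Sum>u\<in>X2. w2 * f u)"
      using w1 w2 by (subst sum.union_disjoint[OF fin dis]) (simp_all cong: sum.cong)
    also have "\<dots> = w1 * (\<Sum>z\<in>Y1. f (r1 *\<^sub>R z)) + w2 * (\<Sum>z\<in>Y2. f (r2 *\<^sub>R z))"
      by (simp add: sum_distrib_left[symmetric] F1(4) F2(4))
    finally show ?thesis
      using des[OF that] w1 w2 by (simp add: N1_def N2_def F1(2) F2(2) mult.commute)
  qed
  note pm = polynomial_mult
  have unit: "r *\<^sub>R z \<bullet> r *\<^sub>R z = r\<^sup>2" if "norm z = 1" for r and z :: "real^'n"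
    using that by (simp add: dot_square_norm power2_eq_square)
  have lin: "(\<Sum>z\<in>Y1. v \<bullet> z) = 0" "(\<Sum>z\<in>Y2. v \<bullet> z) = 0" for v
  proof -
    have 1: "(w1 * r1) * (\<Sum>z\<in>Y1. v \<bullet> z) + (w2 * r2) * (\<Sum>z\<in>Y2. v \<bullet> z) = 0"
      using D[OF polynomial_mono[OF polynomial_inner[of v]]]
      by (simp add: sphere_average_moments r sum_distrib_left[symmetric] mult.assoc)
    have "polynomial_of_degree_le 4 (\<lambda>x. (x \<bullet> x) * (v \<bullet> x))"
      by (rule polynomial_mono[OF pm[OF polynomial_norm_square polynomial_inner]]) simp
    note D' = D[OF this]
    have c: "continuous_on UNIV (\<lambda>x. v \<bullet> x)" by (intro continuous_intros)
    have "w1 * (\<Sum>z\<in>Y1. r1\<^sup>2 * (r1 * (v \<bullet> z))) + w2 * (\<Sum>z\<in>Y2. r2\<^sup>2 * (r2 * (v \<bullet> z)))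
        = w1 * N1 * (r1\<^sup>2 * 0) + w2 * N2 * (r2\<^sup>2 * 0)"
      using D' F1(3) F2(3)
      by (simp only: unit inner_scaleR_right[of v] sphere_average_norm_square_mult[OF r(1) c]
          sphere_average_norm_square_mult[OF r(2) c] sphere_average_moments(1)[OF r(1)] sphere_average_moments(1)[OF r(2)]
          cong: sum.cong)
    then have 2: "(w1 * r1) * r1\<^sup>2 * (\<Sum>z\<in>Y1. v \<bullet> z) + (w2 * r2) * r2\<^sup>2 * (\<Sum>z\<in>Y2. v \<bullet> z) = 0"
      by (simp add: sum_distrib_left[symmetric] sum_distrib_right[symmetric] mult_ac)
    show "(\<Sum>z\<in>Y1. v \<bullet> z) = 0" "(\<Sum>z\<in>Y2. v \<bullet> z) = 0"
      by (rule separate_spheres[OF r r12 _ _ 1 2]; use w r in simp)+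
  qed
  have quad: "(\<Sum>z\<in>Y1. (u \<bullet> z) * (v \<bullet> z)) = N1 / n * (u \<bullet> v)" "(\<Sum>z\<in>Y2. (u \<bullet> z) * (v \<bullet> z)) = N2 / n * (u \<bullet> v)" for u v
  proof -
    define A where "A = (\<Sum>z\<in>Y1. (u \<bullet> z) * (v \<bullet> z)) - N1 / n * (u \<bullet> v)"
    define B where "B = (\<Sum>z\<in>Y2. (u \<bullet> z) * (v \<bullet> z)) - N2 / n * (u \<bullet> v)"
    have p: "polynomial_of_degree_le 2 (\<lambda>x. (u \<bullet> x) * (v \<bullet> x))"
      using pm[OF polynomial_inner polynomial_inner] by (simp add: numeral_2_eq_2)
    have c: "continuous_on UNIV (\<lambda>x. (u \<bullet> x) * (v \<bullet> x))" by (intro continuous_intros)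
    have s: "(u \<bullet> r *\<^sub>R z) * (v \<bullet> r *\<^sub>R z) = r\<^sup>2 * ((u \<bullet> z) * (v \<bullet> z))" for r z
      by (simp add: power2_eq_square)
    have "w1 * (r1\<^sup>2 * (\<Sum>z\<in>Y1. (u \<bullet> z) * (v \<bullet> z))) + w2 * (r2\<^sup>2 * (\<Sum>z\<in>Y2. (u \<bullet> z) * (v \<bullet> z)))
       = w1 * N1 * (r1\<^sup>2 / n * (u \<bullet> v)) + w2 * N2 * (r2\<^sup>2 / n * (u \<bullet> v))"
      using D[OF polynomial_mono[OF p]]
      by (simp only: s sum_distrib_left[symmetric] sphere_average_moments(3)[OF r(1)] sphere_average_moments(3)[OF r(2)] n_def)
    then have 1: "(w1 * r1\<^sup>2) * A + (w2 * r2\<^sup>2) * B = 0"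
      by (simp add: A_def B_def algebra_simps)
    have q: "polynomial_of_degree_le 4 (\<lambda>x. (x \<bullet> x) * ((u \<bullet> x) * (v \<bullet> x)))"
      by (rule polynomial_mono[OF pm[OF polynomial_norm_square p]]) simp
    have "w1 * (r1\<^sup>2 * (r1\<^sup>2 * (\<Sum>z\<in>Y1. (u \<bullet> z) * (v \<bullet> z)))) + w2 * (r2\<^sup>2 * (r2\<^sup>2 * (\<Sum>z\<in>Y2. (u \<bullet> z) * (v \<bullet> z))))
       = w1 * N1 * (r1\<^sup>2 * (r1\<^sup>2 / n * (u \<bullet> v))) + w2 * N2 * (r2\<^sup>2 * (r2\<^sup>2 / n * (u \<bullet> v)))"
      using D[OF q] F1(3) F2(3)
      by (simp only: s unit sum_distrib_left[symmetric] sphere_average_norm_square_mult[OF r(1) c]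
          sphere_average_norm_square_mult[OF r(2) c] sphere_average_moments(3)[OF r(1)] sphere_average_moments(3)[OF r(2)] n_def
          cong: sum.cong)
    then have 2: "(w1 * r1\<^sup>2) * r1\<^sup>2 * A + (w2 * r2\<^sup>2) * r2\<^sup>2 * B = 0"
      by (simp add: A_def B_def algebra_simps)
    have "A = 0" "B = 0"
      by (rule separate_spheres[OF r r12 _ _ 1 2]; use w r in simp)+
    then show "(\<Sum>z\<in>Y1. (u \<bullet> z) * (v \<bullet> z)) = N1 / n * (u \<bullet> v)" "(\<Sum>z\<in>Y2. (u \<bullet> z) * (v \<bullet> z)) = N2 / n * (u \<bullet> v)"
      by (simp_all add: A_def B_def)
  qed
  show "spherical_2_design n Y1" "spherical_2_design n Y2"
    unfolding spherical_2_design_def using F1(1,3) F2(1,3) lin quad by (simp_all add: N1_def N2_def)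
  have "polynomial_of_degree_le 4 (\<lambda>y. (x \<bullet> y) ^ 3)"
    by (rule polynomial_mono[OF polynomial_power[OF polynomial_inner]]) simp
  from D[OF this] show "(w1 * r1 ^ 3) * (\<Sum>z\<in>Y1. (x \<bullet> z) ^ 3) + (w2 * r2 ^ 3) * (\<Sum>z\<in>Y2. (x \<bullet> z) ^ 3) = 0"
    by (simp add: sphere_average_moments r power_mult_distrib sum_distrib_left[symmetric] mult.assoc)
  assume xy: "norm x = 1" "norm y = 1"
  have q: "polynomial_of_degree_le 4 (\<lambda>z. (x \<bullet> z)\<^sup>2 * (y \<bullet> z)\<^sup>2)"
    using pm[OF polynomial_power[OF polynomial_inner, of 2] polynomial_power[OF polynomial_inner, of 2]] by simp
  have s: "(x \<bullet> r *\<^sub>R z)\<^sup>2 * (y \<bullet> r *\<^sub>R z)\<^sup>2 = r ^ 4 * ((x \<bullet> z)\<^sup>2 * (y \<bullet> z)\<^sup>2)" for r z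
    by (simp add: power2_eq_square power4_eq_xxxx)
  have "w1 * (r1 ^ 4 * (\<Sum>z\<in>Y1. (x \<bullet> z)\<^sup>2 * (y \<bullet> z)\<^sup>2)) + w2 * (r2 ^ 4 * (\<Sum>z\<in>Y2. (x \<bullet> z)\<^sup>2 * (y \<bullet> z)\<^sup>2))
     = w1 * N1 * (r1 ^ 4 / (n * (n + 2)) * (1 + 2 * (x \<bullet> y)\<^sup>2)) + w2 * N2 * (r2 ^ 4 / (n * (n + 2)) * (1 + 2 * (x \<bullet> y)\<^sup>2))"
    using D[OF q] unfolding s sum_distrib_left[symmetric] sphere_average_moments(4)[OF r(1)]
      sphere_average_moments(4)[OF r(2)] n_def xy by simp
  then show "(w1 * r1 ^ 4) * (\<Sum>z\<in>Y1. (x \<bullet> z)\<^sup>2 * (y \<bullet> z)\<^sup>2) + (w2 * r2 ^ 4) * (\<Sum>z\<in>Y2. (x \<bullet> z)\<^sup>2 * (y \<bullet> z)\<^sup>2)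
       = ((w1 * r1 ^ 4) * real (card Y1) + (w2 * r2 ^ 4) * real (card Y2)) / (n * (n + 2)) * (1 + 2 * (x \<bullet> y)\<^sup>2)"
    by (simp add: N1_def N2_def add_divide_distrib distrib_right distrib_left mult_ac)
qed

section \<open>Transport of designs along similarities\<close>

lemma euclidean_design_vimage:
  fixes X1 X2 :: "(real^'n) set" and \<rho> :: "real^'n \<Rightarrow> real^'n"
  assumes design: "euclidean_design t r1 r2 X1 X2 w" and r: "r1 > 0" "r2 > 0"
    and \<rho>: "linear \<rho>" "bij \<rho>" and c: "c > 0" "\<And>x. norm (\<rho> x) = c * norm x" and \<mu>: "\<mu> > 0"
  shows "euclidean_design t (r1 / c) (r2 / c) (\<rho> -` X1) (\<rho> -` X2) (\<lambda>x. \<mu> * w (\<rho> x))"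
proof -
  have sup: "supported_by_two_spheres r1 r2 X1 X2 w"
    and des: "\<And>f. polynomial_of_degree_le t f \<Longrightarrow>
        (\<Sum>x\<in>X1. w x) * sphere_average r1 f + (\<Sum>x\<in>X2. w x) * sphere_average r2 f = (\<Sum>u\<in>X1 \<union> X2. w u * f u)"
    using design by (auto simp: euclidean_design_def)
  have bb: "bij_betw \<rho> (\<rho> -` X) X" for X
    using \<rho>(2) by (metis bij_betw_subset bij_is_surj image_vimage_eq inf_top_right subset_UNIV)
  have sums: "(\<Sum>x\<in>\<rho> -` X. F (\<rho> x)) = (\<Sum>x\<in>X. F x)" for X and F :: "real^'n \<Rightarrow> real"
    by (rule sum.reindex_bij_betw[OF bb])
  have sph: "\<rho> x \<in> X \<Longrightarrow> X \<subseteq> sphere 0 r \<Longrightarrow> norm x = r / c" for x X r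
    using c by (auto simp: subset_iff field_simps)
  have "supported_by_two_spheres (r1 / c) (r2 / c) (\<rho> -` X1) (\<rho> -` X2) (\<lambda>x. \<mu> * w (\<rho> x))"
    unfolding supported_by_two_spheres_def
  proof (intro conjI)
    show "finite (\<rho> -` X1 \<union> \<rho> -` X2)"
      using sup bij_betw_finite[OF bb] by (auto simp: supported_by_two_spheres_def)
    show "\<rho> -` X1 \<noteq> {}" "\<rho> -` X2 \<noteq> {}"
      using sup bij_is_surj[OF \<rho>(2)] by (auto simp: supported_by_two_spheres_def vimage_def surj_def) (metis ex_in_conv)+
  qed (use sup r c \<mu> sph in \<open>auto simp: supported_by_two_spheres_def\<close>)
  moreover have "(\<Sum>x\<in>\<rho> -` X1. \<mu> * w (\<rho> x)) * sphere_average (r1 / c) f + (\<Sum>x\<in>\<rho> -` X2. \<mu> * w (\<rho> x)) * sphere_average (r2 / c) f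
      = (\<Sum>u\<in>\<rho> -` X1 \<union> \<rho> -` X2. \<mu> * w (\<rho> u) * f u)" if f: "polynomial_of_degree_le t f" for f
  proof -
    \<comment> \<open>Testing the transported design with \<open>f\<close> amounts to testing the
      original one with \<open>f\<close> composed with the inverse, which has the same degree
      bound.\<close>
    define g where "g = (\<lambda>x. f (inv \<rho> x))"
    have inv: "inv \<rho> (\<rho> x) = x" for x using \<rho>(2) by (simp add: bij_is_inj)
    have "linear (inv \<rho>)"
      using \<rho> by (metis bij_is_inj bij_is_surj inv_o_cancel linear_injective_left_inverse surj_iff o_assoc o_id id_o)
    then have g: "polynomial_of_degree_le t g" unfolding g_def by (rule polynomial_comp_linear[OF f])
    have f_eq: "f = (\<lambda>x. g (\<rho> x))" by (simp add: g_def inv)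
    have avg: "sphere_average (r / c) f = sphere_average r g" if "r > 0" for r
      unfolding f_eq by (rule sphere_average_comp_similarity[OF that continuous_polynomial[OF g] \<rho>(1) c])
    have "(\<Sum>u\<in>\<rho> -` X1 \<union> \<rho> -` X2. \<mu> * w (\<rho> u) * f u) = (\<Sum>u\<in>\<rho> -` (X1 \<union> X2). \<mu> * (w (\<rho> u) * g (\<rho> u)))"
      by (simp add: f_eq vimage_Un mult.assoc)
    also have "\<dots> = \<mu> * (\<Sum>u\<in>X1 \<union> X2. w u * g u)"
      unfolding sum_distrib_left[symmetric] by (simp only: sums[of "\<lambda>u. w u * g u"])
    finally have rhs: "(\<Sum>u\<in>\<rho> -` X1 \<union> \<rho> -` X2. \<mu> * w (\<rho> u) * f u) = \<mu> * (\<Sum>u\<in>X1 \<union> X2. w u * g u)" .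
    have weight: "(\<Sum>x\<in>\<rho> -` X. \<mu> * w (\<rho> x)) = \<mu> * (\<Sum>x\<in>X. w x)" for X
      unfolding sum_distrib_left[symmetric] by (simp only: sums[of w])
    show ?thesis
      unfolding rhs weight avg[OF r(1)] avg[OF r(2)] des[OF g, symmetric] by (simp add: algebra_simps)
  qed
  ultimately show ?thesis by (simp add: euclidean_design_def)
qed

lemma angle_set_vimage_scale:
  fixes X Y :: "(real^'n) set"
  assumes "c > 0"
  shows "angle_set (r / c) (s / c) ((\<lambda>x. c *\<^sub>R x) -` X) ((\<lambda>x. c *\<^sub>R x) -` Y) = angle_set r s X Y"
proof -
  have e: "(x \<bullet> y) / (r / c * (s / c)) = ((c *\<^sub>R x) \<bullet> (c *\<^sub>R y)) / (r * s)" for x y :: "real^'n"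
    using assms by (simp add: field_simps)
  have surj: "\<exists>u. x = c *\<^sub>R u" for x :: "real^'n"
    using assms by (intro exI[of _ "(1 / c) *\<^sub>R x"]) simp
  show ?thesis
    unfolding angle_set_def e
  proof (intro equalityI subsetI; clarify)
    fix x y assume "c *\<^sub>R x \<in> X" "c *\<^sub>R y \<in> Y" "x \<noteq> y"
    then show "\<exists>xa ya. c *\<^sub>R x \<bullet> c *\<^sub>R y / (r * s) = xa \<bullet> ya / (r * s) \<and> xa \<in> X \<and> ya \<in> Y \<and> xa \<noteq> ya"
      using assms by (metis less_irrefl scaleR_cancel_left)
  next
    fix x y assume *: "x \<in> X" "y \<in> Y" "x \<noteq> y"
    obtain u v where "x = c *\<^sub>R u" "y = c *\<^sub>R v" using surj by blast
    with * show "\<exists>xa ya. x \<bullet> y / (r * s) = c *\<^sub>R xa \<bullet> c *\<^sub>R ya / (r * s) \<and> xa \<in> (*\<^sub>R) c -` X \<and> ya \<in> (*\<^sub>R) c -` Y \<and> xa \<noteq> ya"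
      by auto
  qed
qed

lemma finite_angle_set: "finite X \<Longrightarrow> finite Y \<Longrightarrow> finite (angle_set r s X Y)"
  by (rule finite_subset[of _ "(\<lambda>(x, y). (x \<bullet> y) / (r * s)) ` (X \<times> Y)"]) (auto simp: angle_set_def)

lemma card_le_2_ordered:
  fixes S :: "real set"
  assumes "finite S" "card S \<le> 2" "S \<noteq> {}" "\<And>c. S \<noteq> {c}"
  obtains a b where "S = {a, b}" "a > b"
proof -
  have "card S \<noteq> 0" using assms by simp
  moreover have "card S \<noteq> 1" using assms(4) by (metis card_1_singletonE)
  ultimately have "card S = 2" using assms(2) by linarith
  then obtain a b where "S = {a, b}" "a \<noteq> b" by (auto simp: card_2_iff)
  then show thesis using that[of a b] that[of b a] by (cases "a > b") (auto simp: insert_commute)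
qed

lemma similar_vimage:
  fixes \<rho> :: "real^'n \<Rightarrow> real^'n"
  assumes \<rho>: "linear \<rho>" "bij \<rho>" and c: "c > 0" "\<And>x. norm (\<rho> x) = c * norm x" and \<mu>: "\<mu> > 0"
  shows "similar (X1 \<union> X2) w (\<rho> -` X1 \<union> \<rho> -` X2) (\<lambda>x. \<mu> * w (\<rho> x))"
proof -
  have "dist (\<rho> x) (\<rho> y) = c * dist x y" for x y
    using c(2)[of "x - y"] by (simp add: dist_norm linear_diff[OF \<rho>(1)])
  then have "similarity \<rho>" unfolding similarity_def using \<rho>(2) c(1) by blast
  then show ?thesis
    unfolding similar_def using \<mu> linear_0[OF \<rho>(1)] by (intro exI[of _ \<rho>] exI[of _ \<mu>]) auto
qed

text \<open>Unit vectors with inner product -1 are antipodal, and the zero sum forces the antipode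
  of every point into \<open>Y\<close>. Two antipodal pairs remain, and they are orthogonal.\<close>

lemma square_structure:
  fixes Y :: "'a::real_inner set"
  assumes Y: "spherical_2_design n Y" and card: "card Y = 4"
    and angles: "\<And>x y. x \<in> Y \<Longrightarrow> y \<in> Y \<Longrightarrow> x \<noteq> y \<Longrightarrow> x \<bullet> y = 0 \<or> x \<bullet> y = - 1"
  obtains e f where "Y = {e, - e, f, - f}" "norm e = 1" "norm f = 1" "e \<bullet> f = 0"
proof -
  note D = spherical_2_designD[OF Y]
  have anti: "z = - x" if "x \<in> Y" "z \<in> Y" "x \<bullet> z = - 1" for x z
  proof -
    have "(x + z) \<bullet> (x + z) = 0" using that D(3) by (simp add: inner_add_left inner_add_right inner_commute)
    then show ?thesis by (simp add: eq_neg_iff_add_eq_0 add.commute)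
  qed
  have neg: "- x \<in> Y" if x: "x \<in> Y" for x
  proof (rule ccontr)
    assume "- x \<notin> Y"
    then have "x \<bullet> z = 0" if "z \<in> Y - {x}" for z using angles[OF x, of z] anti[OF x, of z] that by auto
    then have "(\<Sum>z\<in>Y. x \<bullet> z) = 1" using sum.remove[OF D(1) x, of "\<lambda>z. x \<bullet> z"] D(3)[OF x] by simp
    then show False using D(4)[of x] by simp
  qed
  obtain e where e: "e \<in> Y" using card by fastforce
  have "\<not> Y \<subseteq> {e, - e}"
  proof
    assume "Y \<subseteq> {e, - e}"
    then have "card Y \<le> card {e, - e}" by (intro card_mono) auto
    also have "\<dots> \<le> 2" by (rule card_insert_le_m1) auto
    finally show False using card by simp
  qed
  then obtain f where f: "f \<in> Y" "f \<noteq> e" "f \<noteq> - e" by auto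
  then have ef: "e \<bullet> f = 0" using angles[OF e, of f] anti[OF e, of f] by auto
  have nz: "e \<noteq> 0" "f \<noteq> 0" using D(2)[OF e] D(2)[OF f(1)] by auto
  have "e \<noteq> - e" "f \<noteq> - f" using nz by (simp_all add: eq_neg_iff_add_eq_0 scaleR_2[symmetric])
  then have "card {e, - e, f, - f} = 4" using f by (auto simp: card_insert_if)
  moreover have "{e, - e, f, - f} \<subseteq> Y" using e f neg by auto
  ultimately have "Y = {e, - e, f, - f}" using card D(1) by (metis card_subset_eq)
  then show thesis using that D(2)[OF e] D(2)[OF f(1)] ef by blast
qed

lemma plane_point_components:
  fixes i j :: "'n::finite"
  assumes "i \<noteq> j"
  shows "(plane_point i j a b :: real^'n) $ i = a" "(plane_point i j a b :: real^'n) $ j = b"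
  using assms by (auto simp: plane_point_def axis_def)

lemma plane_point_eq:
  fixes z :: "real^'n"
  assumes "UNIV = {i, j}" "i \<noteq> j"
  shows "z = plane_point i j (z $ i) (z $ j)"
proof -
  have "k = i \<or> k = j" for k using assms(1) by auto
  then show ?thesis unfolding vec_eq_iff using plane_point_components[OF assms(2)] by metis
qed

text \<open>The orthonormal pair \<open>e\<close>, \<open>f\<close> spanning the second square
  serves as the coordinate system. In it the first class has all coordinates equal to plus or minus
  \<open>1 / sqrt 2\<close>, which leaves four candidates for its four points.\<close>

lemma square_design_similar:
  fixes X1 X2 :: "(real^'n) set"
  assumes design: "euclidean_design 4 r1 r2 X1 X2 w" and r: "r1 > 0" "r2 > 0"
    and w: "\<And>x. x \<in> X1 \<Longrightarrow> w x = w1" "\<And>x. x \<in> X2 \<Longrightarrow> w x = w2" "w1 > 0" and weights: "w1 * r1 ^ 4 = w2 * r2 ^ 4"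
    and n: "CARD('n) = 2" and card: "card X1 = 4"
    and Y2: "normalized r2 X2 = {e, - e, f, - f}" and ef: "norm e = 1" "norm f = 1" "e \<bullet> f = 0"
    and cross: "\<And>x y. x \<in> normalized r1 X1 \<Longrightarrow> y \<in> normalized r2 X2 \<Longrightarrow> x \<bullet> y = 1 / sqrt 2 \<or> x \<bullet> y = - (1 / sqrt 2)"
  shows "\<exists>r2' X1' X2' w'. similar (X1 \<union> X2) w (X1' \<union> X2') w' \<and> square_design r2' X1' X2' w'"
proof -
  obtain i j :: 'n where ij: "UNIV = {i, j}" "i \<noteq> j" using n by (auto simp: card_2_iff)
  define q where "q = r2 / r1"
  have sup: "supported_by_two_spheres r1 r2 X1 X2 w" using design by (simp add: euclidean_design_def)
  have q: "q > 0" "q \<noteq> 1" using r sup by (auto simp: q_def supported_by_two_spheres_def)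
  \<comment> \<open>Sends the coordinate axes to \<open>e\<close> and \<open>f\<close>, stretched by
    \<open>r1\<close>, so that the preimage of the first sphere has radius 1.\<close>
  define \<rho> :: "real^'n \<Rightarrow> real^'n" where "\<rho> z = r1 *\<^sub>R ((z $ i) *\<^sub>R e + (z $ j) *\<^sub>R f)" for z
  have lin: "linear \<rho>" unfolding \<rho>_def by (rule linearI) (simp_all add: algebra_simps)
  have ee: "e \<bullet> e = 1" "f \<bullet> f = 1" "f \<bullet> e = 0" using ef by (simp_all add: dot_square_norm inner_commute)
  have nrm: "norm (\<rho> z) = r1 * norm z" for z
  proof -
    have "(\<Sum>k\<in>UNIV. (z $ k)\<^sup>2) = (z $ i)\<^sup>2 + (z $ j)\<^sup>2" unfolding ij(1) using ij(2) by simp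
    then have z: "(norm z)\<^sup>2 = (z $ i)\<^sup>2 + (z $ j)\<^sup>2"
      by (simp add: norm_vec_def L2_set_def sum_nonneg)
    have "(norm (\<rho> z))\<^sup>2 = r1\<^sup>2 * ((z $ i)\<^sup>2 + (z $ j)\<^sup>2)"
      unfolding power2_norm_eq_inner \<rho>_def inner_scaleR_left inner_scaleR_right inner_add_left inner_add_right ee ef
      by (simp add: power2_eq_square algebra_simps)
    also have "\<dots> = (r1 * norm z)\<^sup>2" by (simp add: z power_mult_distrib)
    finally show ?thesis using r(1) by (simp add: power2_eq_iff_nonneg)
  qed
  have inj: "inj \<rho>"
    unfolding linear_injective_0[OF lin] using nrm r(1) by (metis mult_eq_0_iff norm_eq_zero less_irrefl)
  then have bij: "bij \<rho>" using linear_injective_imp_surjective[OF lin] by (simp add: bij_def)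
  define \<mu> where "\<mu> = 1 / w1"
  have \<mu>: "\<mu> > 0" using w(3) by (simp add: \<mu>_def)
  define X1' X2' w' where "X1' = \<rho> -` X1" and "X2' = \<rho> -` X2" and "w' = (\<lambda>x. \<mu> * w (\<rho> x))"
  have sim: "similar (X1 \<union> X2) w (X1' \<union> X2') w'"
    unfolding X1'_def X2'_def w'_def by (rule similar_vimage[OF lin bij r(1) nrm \<mu>])
  have des: "euclidean_design 4 1 q X1' X2' w'"
    using euclidean_design_vimage[OF design r lin bij r(1) nrm \<mu>] r(1) by (simp add: X1'_def X2'_def w'_def q_def)
  have X2: "X2 = (\<lambda>z. r2 *\<^sub>R z) ` {e, - e, f, - f}"
    unfolding Y2[symmetric] normalized_def image_image using r(2) by simp
  have "X2' = {plane_point i j q 0, plane_point i j (- q) 0, plane_point i j 0 q, plane_point i j 0 (- q)}"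
  proof -
    have "\<rho> ` {plane_point i j q 0, plane_point i j (- q) 0, plane_point i j 0 q, plane_point i j 0 (- q)} = X2"
      unfolding X2 using r(1) by (simp add: \<rho>_def plane_point_components[OF ij(2)] q_def)
    then show ?thesis unfolding X2'_def using inj by (metis inj_vimage_image_eq)
  qed
  moreover have "X1' = {plane_point i j (1 / sqrt 2) (1 / sqrt 2), - plane_point i j (1 / sqrt 2) (1 / sqrt 2),
      plane_point i j (1 / sqrt 2) (- (1 / sqrt 2)), - plane_point i j (1 / sqrt 2) (- (1 / sqrt 2))}" (is "_ = ?S")
  proof (rule card_seteq)
    show "X1' \<subseteq> ?S"
    proof
      fix z assume "z \<in> X1'"
      then have "(1 / r1) *\<^sub>R \<rho> z \<in> normalized r1 X1" by (auto simp: X1'_def normalized_def)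
      then have "z $ i *\<^sub>R e + z $ j *\<^sub>R f \<in> normalized r1 X1" using r(1) by (simp add: \<rho>_def)
      from cross[OF this, of e] cross[OF this, of f]
      have "z $ i = 1 / sqrt 2 \<or> z $ i = - (1 / sqrt 2)" "z $ j = 1 / sqrt 2 \<or> z $ j = - (1 / sqrt 2)"
        by (simp_all add: Y2 inner_add_left ee ef)
      moreover have "- plane_point i j a b = plane_point i j (- a) (- b)" for a b :: real
        by (simp add: plane_point_def)
      ultimately show "z \<in> ?S"
        using plane_point_eq[OF ij, of z] by (elim disjE) simp_all
    qed
    have "card X1' = card X1"
      unfolding X1'_def using bij by (intro card_vimage_inj) (auto simp: bij_def)
    moreover have "card ?S \<le> 4" by (auto simp: card_insert_if)
    ultimately show "card ?S \<le> card X1'" using card by simp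
  qed simp
  moreover have "w' x = 1" if "x \<in> X1'" for x
    using that w by (simp add: w'_def X1'_def \<mu>_def)
  moreover have "w' x = 1 / q ^ 4" if "x \<in> X2'" for x
  proof -
    have "w2 / w1 = r1 ^ 4 / r2 ^ 4" using weights w(3) r by (simp add: field_simps)
    then show ?thesis using that w by (simp add: w'_def X2'_def \<mu>_def q_def power_divide)
  qed
  ultimately have "square_design q X1' X2' w'"
    unfolding square_design_def using n q des ij(2) by blast
  with sim show ?thesis by blast
qed

lemma card_normalized_filter:
  fixes X :: "(real^'n) set"
  assumes "r > 0"
  shows "card {x \<in> X. Q ((1 / r) *\<^sub>R x)} = card {z \<in> normalized r X. Q z}"
proof -
  have "{z \<in> normalized r X. Q z} = (\<lambda>x. (1 / r) *\<^sub>R x) ` {x \<in> X. Q ((1 / r) *\<^sub>R x)}"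
    unfolding normalized_def by blast
  moreover have "inj_on (\<lambda>x. (1 / r) *\<^sub>R x) {x \<in> X. Q ((1 / r) *\<^sub>R x)}" using assms by (simp add: inj_on_def)
  ultimately show ?thesis by (simp only: card_image)
qed

theorem theorem4p2:
  fixes X1 X2 :: "(real ^ 'n) set" and w :: "real ^ 'n \<Rightarrow> real" and r1 r2 :: real
  assumes "CARD('n) \<ge> 2"
    and "euclidean_design 4 r1 r2 X1 X2 w"
    and "0 \<notin> X1 \<union> X2"
    and "w constant_on X1" and "w constant_on X2"
    and "card (angle_set r1 r1 X1 X1) \<le> 2"
    and "card (angle_set r1 r2 X1 X2) \<le> 2"
    and "card (angle_set r2 r1 X2 X1) \<le> 2"
    and "card (angle_set r2 r2 X2 X2) \<le> 2"
    and "card X2 \<ge> card X1" and "card X1 \<ge> CARD('n) + 2"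
  defines "n \<equiv> real CARD('n)" and "N1 \<equiv> real (card X1)" and "N2 \<equiv> real (card X2)"
  shows "\<exists>\<alpha>1 \<alpha>2 \<beta>1 \<beta>2 \<gamma>1 \<gamma>2.
    angle_set r1 r1 X1 X1 = {\<alpha>1, \<alpha>2} \<and> \<alpha>1 > \<alpha>2 \<and>
    angle_set r2 r2 X2 X2 = {\<beta>1, \<beta>2} \<and> \<beta>1 > \<beta>2 \<and>
    angle_set r1 r2 X1 X2 = {\<gamma>1, \<gamma>2} \<and> \<gamma>1 > \<gamma>2 \<and>
    \<gamma>1 * \<gamma>2 = - (1 / n) \<and>
    ((N1 - 1) * \<alpha>1 + 1 \<noteq> 0 \<and> \<alpha>2 = - ((n * \<alpha>1 - n + N1) / (n * ((N1 - 1) * \<alpha>1 + 1)))) \<and>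
    ((N2 - 1) * \<beta>1 + 1 \<noteq> 0 \<and> \<beta>2 = - ((n * \<beta>1 - n + N2) / (n * ((N2 - 1) * \<beta>1 + 1)))) \<and>
    (\<forall>x\<in>X1. real (card {z \<in> X2. (x \<bullet> z) / (r1 * r2) = \<gamma>1}) = N2 / (1 + n * \<gamma>1\<^sup>2)) \<and>
    (\<forall>y\<in>X2. real (card {z \<in> X1. (z \<bullet> y) / (r1 * r2) = \<gamma>1}) = N1 / (1 + n * \<gamma>1\<^sup>2)) \<and>
    (\<gamma>1 = 1 / sqrt n \<longrightarrow>
       (\<exists>r2' X1' X2' w'.
          similar (X1 \<union> X2) w (X1' \<union> X2') w' \<and>
          (square_design r2' X1' X2' w' \<or> (\<exists>k. exceptional_design k r2' X1' X2' w')))) \<and>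
    (\<gamma>1 \<noteq> 1 / sqrt n \<longrightarrow> tight_euclidean_4_design r1 r2 X1 X2 w)"
proof -
  note design = assms(2)
  have sup: "supported_by_two_spheres r1 r2 X1 X2 w" using design by (simp add: euclidean_design_def)
  have fin: "finite X1" "finite X2" and S: "X1 \<subseteq> sphere 0 r1" "X2 \<subseteq> sphere 0 r2"
    and ne: "X1 \<noteq> {}" "X2 \<noteq> {}" and r12: "r1 \<noteq> r2" and wpos: "\<And>x. x \<in> X1 \<union> X2 \<Longrightarrow> w x > 0"
    and r0: "r1 \<ge> 0" "r2 \<ge> 0" and disj: "X1 \<inter> X2 = {}"
    using sup by (auto simp: supported_by_two_spheres_def)
  \<comment> \<open>A sphere of radius 0 is the origin, which the design avoids.\<close>
  have "r1 \<noteq> 0" "r2 \<noteq> 0" using ne S assms(3) by fastforce+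
  then have r: "r1 > 0" "r2 > 0" using r0 by auto
  obtain w1 w2 where w: "\<And>x. x \<in> X1 \<Longrightarrow> w x = w1" "\<And>x. x \<in> X2 \<Longrightarrow> w x = w2"
    using assms(4,5) unfolding constant_on_def by blast
  have wp: "w1 > 0" "w2 > 0" using ne wpos w by (metis Un_iff ex_in_conv)+
  define Y1 Y2 where "Y1 = normalized r1 X1" and "Y2 = normalized r2 X2"
  note F1 = normalized_facts[OF r(1) fin(1) S(1), folded Y1_def]
  note F2 = normalized_facts[OF r(2) fin(2) S(2), folded Y2_def]
  note E = euclidean_4_design_normalized[OF design r w, folded Y1_def Y2_def n_def]
  have YD: "spherical_2_design n Y1" "spherical_2_design n Y2" using E(1,2) by blast+
  have n2: "n \<ge> 2" using assms(1) by (simp add: n_def)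
  have n0: "n > 0" using n2 by simp
  have card_n: "real (card X1) > n + 1" "real (card X2) > n + 1" using assms(10,11) by (simp_all add: n_def)
  have scaled: "(x \<bullet> y) / (r * s) = ((1 / r) *\<^sub>R x) \<bullet> ((1 / s) *\<^sub>R y)" for x y :: "real^'n" and r s
    by simp
  have same: "angle_set r r X X = {x \<bullet> y | x y. x \<in> normalized r X \<and> y \<in> normalized r X \<and> x \<noteq> y}"
    if "r > 0" for r and X :: "(real^'n) set"
  proof -
    have "(1 / r) *\<^sub>R x = (1 / r) *\<^sub>R y \<longleftrightarrow> x = y" for x y :: "real^'n" using that by simp
    then show ?thesis unfolding angle_set_def scaled normalized_def by blast
  qed
  \<comment> \<open>The condition \<open>x \<noteq> y\<close> is automatic for the disjoint sets
    \<open>X1\<close> and \<open>X2\<close>. It has to disappear here, as normalized points of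
    different classes are not known to differ.\<close>
  have cross: "angle_set r1 r2 X1 X2 = {x \<bullet> y | x y. x \<in> Y1 \<and> y \<in> Y2}"
    using disj unfolding angle_set_def scaled normalized_def Y1_def Y2_def by blast
  \<comment> \<open>At least two points exclude an empty angle set, and more than
    \<open>n + 1\<close> points exclude a single angle.\<close>
  have pair: "\<exists>a b. angle_set r r X X = {a, b} \<and> a > b"
    if Y: "spherical_2_design n (normalized r X)" and fX: "finite X" and c: "real (card X) > n + 1"
      and le: "card (angle_set r r X X) \<le> 2" and r: "r > 0" and SX: "X \<subseteq> sphere 0 r" for r and X :: "(real^'n) set"
  proof -
    note F = normalized_facts[OF r fX SX]
    have two: "card (normalized r X) \<ge> 2" using c n2 F(2) by simp
    then obtain x y where "x \<in> normalized r X" "y \<in> normalized r X" "x \<noteq> y"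
      using F(1) by (metis card_le_Suc0_iff_eq not_less_eq_eq numeral_2_eq_2)
    then have "angle_set r r X X \<noteq> {}" unfolding same[OF r] by blast
    moreover have "angle_set r r X X \<noteq> {c}" for c
    proof
      assume "angle_set r r X X = {c}"
      then have "x \<bullet> y = c" if "x \<in> normalized r X" "y \<in> normalized r X" "x \<noteq> y" for x y
        using that unfolding same[OF r] by blast
      from spherical_2_design_one_angle[OF Y _ two this] show False using n2 c F(2) by simp
    qed
    ultimately show ?thesis using card_le_2_ordered[OF finite_angle_set[OF fX fX] le] by metis
  qed
  obtain \<alpha>1 \<alpha>2 where alpha_angles: "angle_set r1 r1 X1 X1 = {\<alpha>1, \<alpha>2}" "\<alpha>1 > \<alpha>2"
    using pair[OF YD(1)[unfolded Y1_def] fin(1) card_n(1) assms(6) r(1) S(1)] by blast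
  obtain \<beta>1 \<beta>2 where beta_angles: "angle_set r2 r2 X2 X2 = {\<beta>1, \<beta>2}" "\<beta>1 > \<beta>2"
    using pair[OF YD(2)[unfolded Y2_def] fin(2) card_n(2) assms(9) r(2) S(2)] by blast
  obtain \<gamma>1 \<gamma>2 where gamma_angles: "angle_set r1 r2 X1 X2 = {\<gamma>1, \<gamma>2}" "\<gamma>1 > \<gamma>2"
  proof (rule card_le_2_ordered[OF finite_angle_set[OF fin] assms(7)])
    have neY: "Y1 \<noteq> {}" "Y2 \<noteq> {}" using ne by (simp_all add: Y1_def Y2_def normalized_def)
    then obtain x where x: "x \<in> Y1" by blast
    show "angle_set r1 r2 X1 X2 \<noteq> {}" using neY unfolding cross by blast
    \<comment> \<open>A single cross value would have the negative square
      \<open>- (1 / n)\<close>.\<close>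
    fix c
    show "angle_set r1 r2 X1 X2 \<noteq> {c}"
    proof
      assume "angle_set r1 r2 X1 X2 = {c}"
      then have "x \<bullet> z = c \<or> x \<bullet> z = c" if "z \<in> Y2" for z using that x unfolding cross by blast
      from spherical_2_design_cross_product[OF YD(2) neY(2) F1(3)[OF x] this]
      have "c * c = - (1 / n)" .
      moreover have "c * c \<ge> 0" "1 / n > 0" using n2 by auto
      ultimately show False by linarith
    qed
  qed
  interpret two_design_pair n Y1 Y2 \<alpha>1 \<alpha>2 \<beta>1 \<beta>2 \<gamma>1 \<gamma>2 "w1 * r1 ^ 4" "w2 * r2 ^ 4" "w1 * r1 ^ 3" "w2 * r2 ^ 3"
  proof
    have a: "{x \<bullet> y | x y. x \<in> Y1 \<and> y \<in> Y1 \<and> x \<noteq> y} = {\<alpha>1, \<alpha>2}" using alpha_angles(1) same[OF r(1)] by (simp add: Y1_def)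
    then show "\<And>x y. x \<in> Y1 \<Longrightarrow> y \<in> Y1 \<Longrightarrow> x \<noteq> y \<Longrightarrow> x \<bullet> y = \<alpha>1 \<or> x \<bullet> y = \<alpha>2"
      by blast
    have "\<alpha>1 \<in> {x \<bullet> y | x y. x \<in> Y1 \<and> y \<in> Y1 \<and> x \<noteq> y}" "\<alpha>2 \<in> {x \<bullet> y | x y. x \<in> Y1 \<and> y \<in> Y1 \<and> x \<noteq> y}"
      unfolding a by simp_all
    then show "\<exists>x\<in>Y1. \<exists>y\<in>Y1. x \<noteq> y \<and> x \<bullet> y = \<alpha>1" "\<exists>x\<in>Y1. \<exists>y\<in>Y1. x \<noteq> y \<and> x \<bullet> y = \<alpha>2" by blast+
    have b: "{x \<bullet> y | x y. x \<in> Y2 \<and> y \<in> Y2 \<and> x \<noteq> y} = {\<beta>1, \<beta>2}" using beta_angles(1) same[OF r(2)] by (simp add: Y2_def)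
    then show "\<And>x y. x \<in> Y2 \<Longrightarrow> y \<in> Y2 \<Longrightarrow> x \<noteq> y \<Longrightarrow> x \<bullet> y = \<beta>1 \<or> x \<bullet> y = \<beta>2"
      by blast
    have "\<beta>1 \<in> {x \<bullet> y | x y. x \<in> Y2 \<and> y \<in> Y2 \<and> x \<noteq> y}" "\<beta>2 \<in> {x \<bullet> y | x y. x \<in> Y2 \<and> y \<in> Y2 \<and> x \<noteq> y}"
      unfolding b by simp_all
    then show "\<exists>x\<in>Y2. \<exists>y\<in>Y2. x \<noteq> y \<and> x \<bullet> y = \<beta>1" "\<exists>x\<in>Y2. \<exists>y\<in>Y2. x \<noteq> y \<and> x \<bullet> y = \<beta>2" by blast+
    have c: "{x \<bullet> y | x y. x \<in> Y1 \<and> y \<in> Y2} = {\<gamma>1, \<gamma>2}" using gamma_angles(1) cross by simp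
    then show "\<And>x y. x \<in> Y1 \<Longrightarrow> y \<in> Y2 \<Longrightarrow> x \<bullet> y = \<gamma>1 \<or> x \<bullet> y = \<gamma>2" by blast
    have "\<gamma>1 \<in> {x \<bullet> y | x y. x \<in> Y1 \<and> y \<in> Y2}" "\<gamma>2 \<in> {x \<bullet> y | x y. x \<in> Y1 \<and> y \<in> Y2}"
      unfolding c by simp_all
    then show "\<exists>x\<in>Y1. \<exists>y\<in>Y2. x \<bullet> y = \<gamma>1" "\<exists>x\<in>Y1. \<exists>y\<in>Y2. x \<bullet> y = \<gamma>2" by blast+
  qed (use n2 E card_n F1(2) F2(2) alpha_angles(2) beta_angles(2) gamma_angles(2) wp r in auto)
  have cards: "real (card Y1) = N1" "real (card Y2) = N2" by (simp_all add: F1(2) F2(2) N1_def N2_def)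
  have g1pos: "\<gamma>1 > 0"
  proof (rule ccontr)
    assume "\<not> \<gamma>1 > 0"
    then have "\<gamma>1 * \<gamma>2 \<ge> 0" using gamma_angles(2) by (intro mult_nonpos_nonpos) auto
    moreover have "1 / n > 0" using n2 by simp
    ultimately show False using gamma_prod by linarith
  qed
  have sqrt_n: "1 / sqrt n * (1 / sqrt n) = 1 / n" "1 / sqrt n > 0" using n2 by (simp_all flip: real_sqrt_mult)
  \<comment> \<open>The product of \<open>\<gamma>1\<close> and \<open>\<gamma>2\<close> is
    \<open>- (1 / n)\<close> and \<open>\<gamma>1\<close> is positive, so the values are opposite
    exactly when their modulus is \<open>1 / sqrt n\<close>.\<close>
  have s_iff: "s = 0 \<longleftrightarrow> \<gamma>1 = 1 / sqrt n"
  proof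
    assume "s = 0"
    then have "\<gamma>2 = - \<gamma>1" by (simp add: s_def)
    then have "\<gamma>1 * \<gamma>1 = 1 / sqrt n * (1 / sqrt n)" using gamma_prod sqrt_n(1) by simp
    then have "\<gamma>1\<^sup>2 = (1 / sqrt n)\<^sup>2" by (simp only: power2_eq_square)
    then show "\<gamma>1 = 1 / sqrt n" using g1pos sqrt_n(2) by (simp only: power2_eq_iff_nonneg less_imp_le)
  next
    assume eq: "\<gamma>1 = 1 / sqrt n"
    have "\<gamma>1 * \<gamma>1 = 1 / n" using sqrt_n(1) by (simp only: eq)
    then have "\<gamma>1 * (\<gamma>1 + \<gamma>2) = 0" using gamma_prod by (simp add: distrib_left)
    then show "s = 0" using g1pos by (simp add: s_def)
  qed
  have count1: "\<forall>x\<in>X1. real (card {z \<in> X2. (x \<bullet> z) / (r1 * r2) = \<gamma>1}) = N2 / (1 + n * \<gamma>1\<^sup>2)"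
  proof
    fix x assume "x \<in> X1"
    then have x: "(1 / r1) *\<^sub>R x \<in> Y1" by (auto simp: Y1_def normalized_def)
    have "card {z \<in> X2. (x \<bullet> z) / (r1 * r2) = \<gamma>1} = card {z \<in> Y2. ((1 / r1) *\<^sub>R x) \<bullet> z = \<gamma>1}"
      unfolding scaled Y2_def by (rule card_normalized_filter[OF r(2)])
    then show "real (card {z \<in> X2. (x \<bullet> z) / (r1 * r2) = \<gamma>1}) = N2 / (1 + n * \<gamma>1\<^sup>2)"
      using spherical_2_design_cross_count[OF YD(2) nonempty(2) F1(3)[OF x] n0 \<gamma>[OF x] gamma_angles(2)]
      by (simp only: cards)
  qed
  have count2: "\<forall>y\<in>X2. real (card {z \<in> X1. (z \<bullet> y) / (r1 * r2) = \<gamma>1}) = N1 / (1 + n * \<gamma>1\<^sup>2)"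
  proof
    fix y assume "y \<in> X2"
    then have y: "(1 / r2) *\<^sub>R y \<in> Y2" by (auto simp: Y2_def normalized_def)
    have "card {z \<in> X1. (z \<bullet> y) / (r1 * r2) = \<gamma>1} = card {z \<in> Y1. z \<bullet> ((1 / r2) *\<^sub>R y) = \<gamma>1}"
      unfolding scaled Y1_def by (rule card_normalized_filter[OF r(1)])
    also have "\<dots> = card {z \<in> Y1. ((1 / r2) *\<^sub>R y) \<bullet> z = \<gamma>1}" by (simp only: inner_commute)
    finally show "real (card {z \<in> X1. (z \<bullet> y) / (r1 * r2) = \<gamma>1}) = N1 / (1 + n * \<gamma>1\<^sup>2)"
      using spherical_2_design_cross_count[OF YD(1) nonempty(1) F2(3)[OF y] n0 two_design_pair.\<gamma>[OF swap y] gamma_angles(2)]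
      by (simp only: cards)
  qed
  have exceptional: "\<exists>r2' X1' X2' w'. similar (X1 \<union> X2) w (X1' \<union> X2') w' \<and>
      (square_design r2' X1' X2' w' \<or> (\<exists>k. exceptional_design k r2' X1' X2' w'))" if \<gamma>1: "\<gamma>1 = 1 / sqrt n"
  proof -
    have s0: "s = 0" using s_iff \<gamma>1 by simp
    then have "\<gamma>2 = - \<gamma>1" by (simp add: s_def)
    then have \<gamma>2: "\<gamma>2 = - (1 / sqrt n)" by (simp only: \<gamma>1)
    show ?thesis
    proof (cases "CARD('n) = 2")
      case True
      then have n: "n = 2" by (simp add: n_def)
      note V = planar_values[OF s0 n]
      obtain e f where ef: "Y2 = {e, - e, f, - f}" "norm e = 1" "norm f = 1" "e \<bullet> f = 0"
        using square_structure[OF YD(2) V(2)] \<beta> V(5,6) by metis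
      have c: "x \<bullet> y = 1 / sqrt 2 \<or> x \<bullet> y = - (1 / sqrt 2)" if "x \<in> Y1" "y \<in> Y2" for x y
        using \<gamma>[OF that] \<gamma>1 \<gamma>2 n by simp
      have "\<exists>r2' X1' X2' w'. similar (X1 \<union> X2) w (X1' \<union> X2') w' \<and> square_design r2' X1' X2' w'"
        by (rule square_design_similar[OF design r w wp(1) V(7) True _ ef[unfolded Y2_def] c[unfolded Y1_def Y2_def]])
           (use V(1) F1(2) in auto)
      then show ?thesis by blast
    next
      case False
      then have c3: "3 \<le> CARD('n)" using assms(1) by simp
      have "card Y1 \<le> card Y2" using assms(10) by (simp only: F1(2) F2(2))
      from exceptional_values[OF s0 n_def[THEN meta_eq_to_obj_eq] c3 this, unfolded F1(2) F2(2)] obtain k where k: "k \<ge> 2"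
        and nk: "int CARD('n) = (2 * k - 1)\<^sup>2 - 4" and N1k: "int (card X1) = 2 * (2 * k + 1) * (k - 1) ^ 3"
        and N2k: "int (card X2) = 2 * k ^ 3 * (2 * k - 3)"
        and alpha_k: "\<alpha>1 = (real_of_int k - 2) / (real_of_int k * (2 * real_of_int k - 3))"
          "\<alpha>2 = - (1 / (2 * real_of_int k - 3))"
        and beta_k: "\<beta>1 = 1 / (2 * real_of_int k + 1)"
          "\<beta>2 = - ((real_of_int k + 1) / ((real_of_int k - 1) * (2 * real_of_int k + 1)))"
        and wk: "w2 * r2 ^ 4 = w1 * r1 ^ 4 * (((2 * real_of_int k + 1)\<^sup>2 * (real_of_int k - 1) ^ 4) / ((2 * real_of_int k - 3)\<^sup>2 * real_of_int k ^ 4))"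
        by blast
      \<comment> \<open>Scaling by \<open>r1\<close> makes the first sphere the unit sphere, and
        \<open>\<mu>\<close> makes its weight 1; the angle sets do not change.\<close>
      define \<rho> where "\<rho> = (\<lambda>x :: real^'n. r1 *\<^sub>R x)"
      define \<mu> where "\<mu> = 1 / w1"
      have \<mu>: "\<mu> > 0" using wp by (simp add: \<mu>_def)
      have lin: "linear \<rho>" unfolding \<rho>_def by (rule linearI) (simp_all add: algebra_simps)
      have nrm: "norm (\<rho> x) = r1 * norm x" for x using r by (simp add: \<rho>_def)
      have bij: "bij \<rho>"
      proof (rule bijI)
        show "inj \<rho>" using r by (simp add: inj_def \<rho>_def)
        show "surj \<rho>" by (rule surjI[of _ "\<lambda>y. (1 / r1) *\<^sub>R y"]) (use r in \<open>simp add: \<rho>_def\<close>)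
      qed
      define q where "q = r2 / r1"
      have q: "q > 0" "q \<noteq> 1" using r r12 by (auto simp: q_def)
      define X1' X2' w' where "X1' = \<rho> -` X1" and "X2' = \<rho> -` X2" and "w' = (\<lambda>x. \<mu> * w (\<rho> x))"
      have sim: "similar (X1 \<union> X2) w (X1' \<union> X2') w'"
        unfolding X1'_def X2'_def w'_def by (rule similar_vimage[OF lin bij r(1) nrm \<mu>])
      have des: "euclidean_design 4 1 q X1' X2' w'"
        using euclidean_design_vimage[OF design r lin bij r(1) nrm \<mu>] r(1) by (simp add: X1'_def X2'_def w'_def q_def)
      have card': "card X1' = card X1" "card X2' = card X2"
        unfolding X1'_def X2'_def using bij by (auto simp: bij_def intro!: card_vimage_inj)
      have ang: "angle_set 1 1 X1' X1' = {\<alpha>1, \<alpha>2}" "angle_set q q X2' X2' = {\<beta>1, \<beta>2}" "angle_set 1 q X1' X2' = {\<gamma>1, \<gamma>2}"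
        using angle_set_vimage_scale[OF r(1), of r1 r1 X1 X1] angle_set_vimage_scale[OF r(1), of r2 r2 X2 X2]
          angle_set_vimage_scale[OF r(1), of r1 r2 X1 X2] alpha_angles(1) beta_angles(1) gamma_angles(1) r(1)
        by (simp_all add: X1'_def X2'_def \<rho>_def q_def)
      have w1': "\<forall>x\<in>X1'. w' x = 1" using w(1) wp(1) by (simp add: w'_def X1'_def \<mu>_def)
      have w2': "\<forall>x\<in>X2'. w' x = ((2 * real_of_int k + 1)\<^sup>2 * (real_of_int k - 1) ^ 4) / ((2 * real_of_int k - 3)\<^sup>2 * real_of_int k ^ 4) * (1 / q ^ 4)"
      proof
        fix x assume "x \<in> X2'"
        define K where "K = ((2 * real_of_int k + 1)\<^sup>2 * (real_of_int k - 1) ^ 4) / ((2 * real_of_int k - 3)\<^sup>2 * real_of_int k ^ 4)"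
        have "w2 * r2 ^ 4 = w1 * r1 ^ 4 * K" unfolding K_def by (rule wk)
        then have "w2 / w1 = K * (1 / q ^ 4)" using wp r by (simp add: q_def power_divide field_simps)
        then show "w' x = ((2 * real_of_int k + 1)\<^sup>2 * (real_of_int k - 1) ^ 4) / ((2 * real_of_int k - 3)\<^sup>2 * real_of_int k ^ 4) * (1 / q ^ 4)"
          using \<open>x \<in> X2'\<close> w(2) unfolding K_def by (simp add: w'_def X2'_def \<mu>_def)
      qed
      have "exceptional_design k q X1' X2' w'"
        unfolding exceptional_design_def Let_def n_def[symmetric]
        by (intro conjI; fact k nk q des N1k[folded card'] N2k[folded card'] w1' w2'
            ang(1)[unfolded alpha_k] ang(2)[unfolded beta_k] ang(3)[unfolded \<gamma>1 \<gamma>2])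
      with sim show ?thesis by blast
    qed
  qed
  have tight: "tight_euclidean_4_design r1 r2 X1 X2 w" if "\<gamma>1 \<noteq> 1 / sqrt n"
  proof -
    have "s \<noteq> 0" using s_iff that by simp
    from card_sum_tight[OF this] have "2 * (N1 + N2) = (n + 1) * (n + 2)"
      by (simp only: N_def M_def cards)
    then have "real (2 * card (X1 \<union> X2)) = real ((CARD('n) + 1) * (CARD('n) + 2))"
      by (simp add: card_Un_disjoint[OF fin disj] N1_def N2_def n_def algebra_simps)
    then have "2 * card (X1 \<union> X2) = (CARD('n) + 1) * (CARD('n) + 2)" by (simp only: of_nat_eq_iff)
    then have "card (X1 \<union> X2) = (CARD('n) + 2) choose 2" by (simp add: choose_two mult.commute)
    then show ?thesis
      using design dim_polynomials_on_two_spheres[OF r r12, where 'n = 'n] by (simp add: tight_euclidean_4_design_def)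
  qed
  have "(real (card Y1) - 1) * \<alpha>1 + 1 \<noteq> 0"
    by (rule spherical_2_design_second_angle(1)[OF YD(1) n0 N1]) (rule \<alpha>)
  moreover have "\<alpha>2 = - ((n * \<alpha>1 - n + real (card Y1)) / (n * ((real (card Y1) - 1) * \<alpha>1 + 1)))"
    by (rule spherical_2_design_second_angle(2)[OF YD(1) n0 N1]) (rule \<alpha>)
  ultimately have second1: "(N1 - 1) * \<alpha>1 + 1 \<noteq> 0"
    "\<alpha>2 = - ((n * \<alpha>1 - n + N1) / (n * ((N1 - 1) * \<alpha>1 + 1)))"
    unfolding cards by simp_all
  have "(real (card Y2) - 1) * \<beta>1 + 1 \<noteq> 0"
    by (rule spherical_2_design_second_angle(1)[OF YD(2) n0 N2]) (rule \<beta>)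
  moreover have "\<beta>2 = - ((n * \<beta>1 - n + real (card Y2)) / (n * ((real (card Y2) - 1) * \<beta>1 + 1)))"
    by (rule spherical_2_design_second_angle(2)[OF YD(2) n0 N2]) (rule \<beta>)
  ultimately have second2: "(N2 - 1) * \<beta>1 + 1 \<noteq> 0"
    "\<beta>2 = - ((n * \<beta>1 - n + N2) / (n * ((N2 - 1) * \<beta>1 + 1)))"
    unfolding cards by simp_all
  show ?thesis
    by (rule exI[of _ \<alpha>1], rule exI[of _ \<alpha>2], rule exI[of _ \<beta>1], rule exI[of _ \<beta>2],
        rule exI[of _ \<gamma>1], rule exI[of _ \<gamma>2], intro conjI impI)
      (fact alpha_angles beta_angles gamma_angles gamma_prod second1 second2 count1 count2
        | erule exceptional | erule tight)+
qed

end
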